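(* Let $E$ be a spectral measure on $(\Omega,\mathscr A)$, $\mathfrak I\in\mathbb S$, and let $J$ be an imaginary operator associated with $E$. For any $\mathscr A$-measurable, $E$-a.e. finite $f,g:\Omega\to\mathbb C_{\mathfrak I}\cup\{\infty\}$ and $c\in\mathbb C_{\mathfrak I}$, we have the following: (i) $\mathbb I(\bar f)=\mathbb I(f)^*$. (ii) $\mathbb I(fg)=\overline{\mathbb I(f)\mathbb I(g)}$. (iii) $\mathbb I(fc+g)=\overline{\mathbb I(f)(\mathrm{Re}(c)I+\mathrm{Im}(c)J)+\mathbb I(g)}$ for all $c\in\mathbb C_{\mathfrak I}$. (iv) $\mathbb I(f)$ is a closed normal operator belonging to $\mathcal L(\mathcal H_n)$. (v) $\mathcal D(\mathbb I(f)\mathbb I(g))=\mathcal D(\mathbb I(fg))\cap\mathcal D(\mathbb I(g))$.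
   Context: Let $n\ge1$. $\mathbb R_n$ is the real Clifford algebra (of real dimension $2^n$) generated by $e_1,\dots,e_n$ with $e_i^2=-1$ and $e_ie_j=-e_je_i$ for $i\ne j$; it has basis $e_\alpha=e_{i_1}\cdots e_{i_r}$ for $\alpha=\{i_1<\cdots<i_r\}\subseteq\{1,\dots,n\}$, $e_\emptyset=1$. For $a=\sum_\alpha a_\alpha e_\alpha$ ($a_\alpha\in\mathbb R$): $\mathrm{Re}(a)=a_\emptyset$, $|a|=(\sum_\alpha a_\alpha^2)^{1/2}$, and $a\mapsto\bar a$ is the real-linear map with $\overline{ab}=\bar b\,\bar a$, $\bar 1=1$, $\bar e_j=-e_j$. $\mathcal H$ is a real Hilbert space and $\mathcal H_n=\mathcal H\otimes\mathbb R_n$ is the two-sided Clifford module of elements $x=\sum_\alpha x_\alpha e_\alpha$ ($x_\alpha\in\mathcal H$), with $\langle x,y\rangle=\sum_{\alpha,\beta}\bar e_\beta e_\alpha\langle x_\alpha,y_\beta\rangle_{\mathcal H}\in\mathbb R_n$ (so $\langle xa,y\rangle=\langle x,y\rangle a$) and norm $\|x\|=(\sum_\alpha\|x_\alpha\|^2)^{1/2}=(\mathrm{Re}\langle x,x\rangle)^{1/2}$. $\mathcal L(\mathcal H_n)$ is the set of right $\mathbb R_n$-linear operators $T:\mathcal D(T)\to\mathcal H_n$, $\mathcal D(T)$ a right submodule; $\mathcal B(\mathcal H_n)$ is the set of everywhere defined bounded ones. For densely defined $T$, $\mathcal D(T^* )$ is the set of $y$ for which there is $z$ with $\langle Tx,y\rangle=\langle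 x,z\rangle$ for all $x\in\mathcal D(T)$, and $T^*y=z$. $T$ is normal if it is densely defined and closed, $\mathcal D(T)=\mathcal D(T^* )$ and $TT^*=T^*T$. $\overline S$ is the closure of a closable operator $S$. An imaginary operator is a unitary $J\in\mathcal B(\mathcal H_n)$ with $J^*=-J$. An orthogonal projection is a self-adjoint $P\in\mathcal B(\mathcal H_n)$ with $P^2=P$. $\mathbb S=\{\sum_{j=1}^n\mathfrak I_je_j:\sum\mathfrak I_j^2=1\}$ (so $\mathfrak I^2=-1$). For $\mathfrak I\in\mathbb S$, $\mathbb C_{\mathfrak I}=\{\lambda_0+\lambda_1\mathfrak I:\lambda_0,\lambda_1\in\mathbb R\}$, $\mathrm{Re}(\lambda)=\lambda_0$, $\mathrm{Im}(\lambda)=\lambda_1\in\mathbb R$. A spectral measure on a $\sigma$-algebra $\mathscr A$ of subsets of $\Omega$ is a map $E$ from $\mathscr A$ to orthogonal projections on $\mathcal H_n$ that is countably additive (in the strong operator topology) with $E(\Omega)=I$. $J$ is associated with $E$ if $JE(M)=E(M)J$ for all $M\in\mathscr A$. For a simple function $f=\sum_jc_j\chi_{M_j}$ (disjoint $M_j\in\mathscr A$, $c_j\in\mathbb C_{\mathfrak I}$), $\mathbb I(f)=\sum_j\{\mathrm{Re}(c_j)E(M_j)+\mathrm{Im}(c_j)E(M_j)J\}$; for bounded measurable $f$, $\mathbb I(f)$ is the operator norm limit of $\mathbb I(f_j)$ for simple $f_j\to f$ uniformly; for measurable $f:\Omega\to\mathbb C_{\mathfrak I}\cup\{\infty\}$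 with $E(\{f=\infty\})=0$, $\mathcal D(\mathbb I(f))=\{x:\int_\Omega|f|^2\,d(\mathrm{Re}\langle E(\lambda)x,x\rangle)<\infty\}$ and $\mathbb I(f)x=\lim_j\mathbb I(f\chi_{M_j})x$, for any sequence $M_j\subseteq M_{j+1}$ in $\mathscr A$ with $f$ bounded on each $M_j$ and $E(\cup_jM_j)=I$ (the limit does not depend on the sequence). *)

theory Defs
  imports "HOL-Analysis.Analysis"
begin

section \<open>The real Clifford algebra and Clifford modules\<close>

text \<open>
  The generators are indexed by a finite, linearly ordered (hence non-empty) type \<open>'n\<close>, so that
  n is the cardinality of \<open>'n\<close>, and the basis elements by the subsets of \<open>'n\<close>.  An element of the
  Clifford module over \<open>'h\<close> is the family of its coefficients; the norm of type \<open>vec\<close> is the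
  Euclidean one.  The Clifford algebra is the case where \<open>'h\<close> is \<open>real\<close>.
  The componentwise operations \<open>*\<close> and \<open>1\<close> of type \<open>vec\<close> are not those of the Clifford algebra
  and are never used.
\<close>

type_synonym ('h, 'n) cl_module = "('h, 'n set) vec"
type_synonym 'n clifford = "(real, 'n set) vec"

definition cl_e :: "'n::{finite,linorder} set \<Rightarrow> 'n clifford" where
  "cl_e \<alpha> = axis \<alpha> 1"

abbreviation cl_one :: "'n::{finite,linorder} clifford" where
  "cl_one \<equiv> cl_e {}"

text \<open>
  The sign with which \<open>e\<^sub>\<alpha> e\<^sub>\<beta>\<close> equals the basis element of the symmetric difference: each pair
  \<open>i > j\<close> costs a transposition, each pair \<open>i = j\<close> a factor \<open>e\<^sub>i\<^sup>2 = -1\<close>.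
\<close>

definition cl_sign :: "'n::{finite,linorder} set \<Rightarrow> 'n set \<Rightarrow> real" where
  "cl_sign \<alpha> \<beta> = (-1) ^ card {(i, j). i \<in> \<alpha> \<and> j \<in> \<beta> \<and> j \<le> i}"

text \<open>
  Right multiplication on the Clifford module; for \<open>'h = real\<close> it is the multiplication of the
  Clifford algebra.
\<close>

definition cl_mult ::
    "('h::real_vector, 'n::{finite,linorder}) cl_module \<Rightarrow> 'n clifford \<Rightarrow> ('h, 'n) cl_module"
    (infixl "\<odot>" 70) where
  "x \<odot> a = (\<Sum>\<alpha>\<in>UNIV. \<Sum>\<beta>\<in>UNIV. (cl_sign \<alpha> \<beta> * a $ \<beta>) *\<^sub>R axis (sym_diff \<alpha> \<beta>) (x $ \<alpha>))"

text \<open>The conjugate of \<open>e\<^sub>\<alpha>\<close> is \<open>(-1)\<^sup>r e\<^sub>\<alpha>\<close> in reversed order, whence the sign below.\<close>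

definition cl_conj :: "'n::{finite,linorder} clifford \<Rightarrow> 'n clifford" where
  "cl_conj a = (\<chi> \<alpha>. (-1) ^ (card \<alpha> * (card \<alpha> + 1) div 2) * a $ \<alpha>)"

definition cl_re :: "'n::{finite,linorder} clifford \<Rightarrow> real" where
  "cl_re a = a $ {}"

definition cl_inner ::
    "('h::real_inner, 'n::{finite,linorder}) cl_module \<Rightarrow> ('h, 'n) cl_module \<Rightarrow> 'n clifford" where
  "cl_inner x y = (\<Sum>\<alpha>\<in>UNIV. \<Sum>\<beta>\<in>UNIV. (x $ \<alpha> \<bullet> y $ \<beta>) *\<^sub>R (cl_conj (cl_e \<beta>) \<odot> cl_e \<alpha>))"

definition imag_units :: "'n::{finite,linorder} clifford set" where
  "imag_units = {\<Sum>j\<in>UNIV. c j *\<^sub>R cl_e {j} | c. (\<Sum>j\<in>UNIV. (c j)\<^sup>2) = 1}"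

definition cplane :: "'n::{finite,linorder} clifford \<Rightarrow> 'n clifford set" where
  "cplane \<iota> = {a *\<^sub>R cl_one + b *\<^sub>R \<iota> | a b. True}"

definition cl_im :: "'n::{finite,linorder} clifford \<Rightarrow> 'n clifford \<Rightarrow> real" where
  "cl_im \<iota> c = (THE b. \<exists>a. c = a *\<^sub>R cl_one + b *\<^sub>R \<iota>)"


subsection \<open>The Clifford relations\<close>

lemma vec_axis_expand:
  fixes x :: "('h::real_vector, 'n::finite) vec"
  shows "x = (\<Sum>\<alpha>\<in>UNIV. axis \<alpha> (x $ \<alpha>))"
  by (simp add: vec_eq_iff axis_def)

lemma axis_add_right: "axis k (x + y) = axis k x + axis k (y :: 'h::real_vector)"
  by (simp add: vec_eq_iff axis_def)

lemma axis_scaleR_right: "axis k (r *\<^sub>R x) = r *\<^sub>R axis k (x :: 'h::real_vector)"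
  by (simp add: vec_eq_iff axis_def)

lemma linear_cl_mult_left: "linear (\<lambda>x. x \<odot> a)"
  by (rule linearI)
     (simp_all add: cl_mult_def axis_add_right axis_scaleR_right scaleR_add_right sum.distrib
       scaleR_right.sum mult_ac)

lemma linear_cl_mult_right: "linear (\<lambda>a. x \<odot> a)"
  by (rule linearI)
     (simp_all add: cl_mult_def scaleR_add_left distrib_left sum.distrib scaleR_right.sum
       mult.left_commute)

lemma cl_mult_axis: "axis \<alpha> h \<odot> axis \<beta> r = (cl_sign \<alpha> \<beta> * r) *\<^sub>R axis (sym_diff \<alpha> \<beta>) h"
proof -
  have "axis \<alpha> h \<odot> axis \<beta> r =
      (\<Sum>\<alpha>'\<in>UNIV. \<Sum>\<beta>'\<in>UNIV. if \<alpha>' = \<alpha> then if \<beta>' = \<beta>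
        then (cl_sign \<alpha> \<beta> * r) *\<^sub>R axis (sym_diff \<alpha> \<beta>) h else 0 else 0)"
    unfolding cl_mult_def
    by (intro sum.cong refl) (auto simp: axis_def vec_eq_iff)
  also have "\<dots> = (\<Sum>\<alpha>'\<in>UNIV. if \<alpha>' = \<alpha> then (\<Sum>\<beta>'\<in>UNIV. if \<beta>' = \<beta>
        then (cl_sign \<alpha> \<beta> * r) *\<^sub>R axis (sym_diff \<alpha> \<beta>) h else 0) else 0)"
    by (intro sum.cong refl) auto
  finally show ?thesis by simp
qed

lemma minus_one_power_card_sym_diff:
  assumes "finite A" "finite B"
  shows "(-1::real) ^ card (sym_diff A B) = (-1) ^ card A * (-1) ^ card B"
proof -
  have "card (sym_diff A B) = card (A - B) + card (B - A)"
    using assms by (intro card_Un_disjoint) auto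
  moreover have "card A = card (A \<inter> B) + card (A - B)" "card B = card (A \<inter> B) + card (B - A)"
    using assms by (metis card_Int_Diff, metis Int_commute card_Int_Diff)
  moreover have "(-1::real) ^ card (A \<inter> B) * (-1) ^ card (A \<inter> B) = 1"
    by (simp flip: power_add)
  ultimately show ?thesis by (simp add: power_add)
qed

lemma cl_sign_sym_diff_left: "cl_sign (sym_diff \<alpha> \<beta>) \<gamma> = cl_sign \<alpha> \<gamma> * cl_sign \<beta> \<gamma>"
proof -
  have "{(i, j). i \<in> sym_diff \<alpha> \<beta> \<and> j \<in> \<gamma> \<and> j \<le> i} =
      sym_diff {(i, j). i \<in> \<alpha> \<and> j \<in> \<gamma> \<and> j \<le> i} {(i, j). i \<in> \<beta> \<and> j \<in> \<gamma> \<and> j \<le> i}"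
    by auto
  then show ?thesis by (simp add: cl_sign_def minus_one_power_card_sym_diff)
qed

lemma cl_sign_sym_diff_right: "cl_sign \<alpha> (sym_diff \<beta> \<gamma>) = cl_sign \<alpha> \<beta> * cl_sign \<alpha> \<gamma>"
proof -
  have "{(i, j). i \<in> \<alpha> \<and> j \<in> sym_diff \<beta> \<gamma> \<and> j \<le> i} =
      sym_diff {(i, j). i \<in> \<alpha> \<and> j \<in> \<beta> \<and> j \<le> i} {(i, j). i \<in> \<alpha> \<and> j \<in> \<gamma> \<and> j \<le> i}"
    by auto
  then show ?thesis by (simp add: cl_sign_def minus_one_power_card_sym_diff)
qed

lemma cl_mult_assoc_axis: "(axis \<alpha> h \<odot> axis \<beta> r) \<odot> axis \<gamma> s = axis \<alpha> h \<odot> (axis \<beta> r \<odot> axis \<gamma> s)"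
proof -
  have sym: "sym_diff (sym_diff \<alpha> \<beta>) \<gamma> = sym_diff \<alpha> (sym_diff \<beta> \<gamma>)" by auto
  show ?thesis
    unfolding cl_mult_axis linear_scale[OF linear_cl_mult_left] linear_scale[OF linear_cl_mult_right]
      cl_sign_sym_diff_left cl_sign_sym_diff_right sym
    by (simp add: mult_ac)
qed

lemma cl_mult_assoc: "(x \<odot> a) \<odot> b = x \<odot> (a \<odot> b)"
proof -
  have x: "x = (\<Sum>\<alpha>\<in>UNIV. axis \<alpha> (x $ \<alpha>))" and a: "a = (\<Sum>\<alpha>\<in>UNIV. axis \<alpha> (a $ \<alpha>))"
    and b: "b = (\<Sum>\<alpha>\<in>UNIV. axis \<alpha> (b $ \<alpha>))"
    by (rule vec_axis_expand)+
  show ?thesis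
    by (subst (1 2) x, subst (1 2) a, subst (1 2) b)
       (simp only: linear_sum[OF linear_cl_mult_left] linear_sum[OF linear_cl_mult_right]
         cl_mult_assoc_axis)
qed

lemma cl_mult_one_right: "x \<odot> cl_one = x"
proof -
  have "axis \<alpha> h \<odot> cl_one = axis \<alpha> h" for \<alpha> :: "'b set" and h :: 'a
    by (simp add: cl_e_def cl_mult_axis cl_sign_def)
  then show ?thesis
    by (subst (1 2) vec_axis_expand) (simp only: linear_sum[OF linear_cl_mult_left])
qed

lemma cl_mult_one_left: "cl_one \<odot> a = a"
proof -
  have "cl_one \<odot> axis \<alpha> r = axis \<alpha> r" for \<alpha> :: "'a set" and r :: real
    by (simp add: cl_e_def cl_mult_axis cl_sign_def axis_scaleR_right[symmetric])
  then show ?thesis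
    by (subst (1 2) vec_axis_expand) (simp only: linear_sum[OF linear_cl_mult_right])
qed

lemma cl_generator_square: "cl_e {i} \<odot> cl_e {i} = - cl_one"
proof -
  have "{(i', j). i' \<in> {i} \<and> j \<in> {i} \<and> j \<le> i'} = {(i, i)}" by auto
  then show ?thesis by (simp add: cl_e_def cl_mult_axis cl_sign_def)
qed

lemma cl_generator_anticommute:
  assumes "i \<noteq> j"
  shows "cl_e {i} \<odot> cl_e {j} = - (cl_e {j} \<odot> cl_e {i})"
proof -
  have *: "{(i', j'). i' \<in> {i} \<and> j' \<in> {j} \<and> j' \<le> i'} = (if j \<le> i then {(i, j)} else {})"
    for i j :: 'a by auto
  have "sym_diff {i} {j} = sym_diff {j} {i}" by auto
  with assms show ?thesis unfolding cl_e_def cl_mult_axis cl_sign_def * by auto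
qed

lemma cl_e_insert_least:
  assumes "\<And>j. j \<in> \<alpha> \<Longrightarrow> i < j"
  shows "cl_e (insert i \<alpha>) = cl_e {i} \<odot> cl_e \<alpha>"
proof -
  have "{(i', j). i' \<in> {i} \<and> j \<in> \<alpha> \<and> j \<le> i'} = {}" "sym_diff {i} \<alpha> = insert i \<alpha>"
    using assms by fastforce+
  then show ?thesis by (simp only: cl_e_def cl_mult_axis cl_sign_def) simp
qed

lemma linear_cl_conj: "linear cl_conj"
  by (rule linearI) (simp_all add: cl_conj_def vec_eq_iff distrib_left)

lemma cl_conj_one: "cl_conj cl_one = cl_one"
  by (auto simp: cl_conj_def cl_e_def vec_eq_iff axis_def)

lemma cl_conj_generator: "cl_conj (cl_e {i}) = - cl_e {i}"
  by (auto simp: cl_conj_def cl_e_def vec_eq_iff axis_def)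

lemma cl_sign_self: "cl_sign \<alpha> \<alpha> = (-1) ^ (card \<alpha> * (card \<alpha> + 1) div 2)"
proof -
  have "finite \<alpha>" by simp
  then have "2 * card {(i, j). i \<in> \<alpha> \<and> j \<in> \<alpha> \<and> j \<le> i} = card \<alpha> * (card \<alpha> + 1)"
  proof (induction \<alpha> rule: finite_linorder_max_induct)
    case (insert b A)
    have "b \<notin> A" using insert.hyps by blast
    have "{(i, j). i \<in> insert b A \<and> j \<in> insert b A \<and> j \<le> i} =
        {(i, j). i \<in> A \<and> j \<in> A \<and> j \<le> i} \<union> {b} \<times> insert b A"
      using insert.hyps by (auto dest: order_less_imp_le order_less_le_trans)
    moreover have "{(i, j). i \<in> A \<and> j \<in> A \<and> j \<le> i} \<inter> {b} \<times> insert b A = {}"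
      using \<open>b \<notin> A\<close> by auto
    ultimately have "card {(i, j). i \<in> insert b A \<and> j \<in> insert b A \<and> j \<le> i} =
        card {(i, j). i \<in> A \<and> j \<in> A \<and> j \<le> i} + Suc (card A)"
      using \<open>b \<notin> A\<close> by (simp add: card_Un_disjoint card_cartesian_product_singleton)
    with insert.IH \<open>b \<notin> A\<close> show ?case by simp
  qed simp
  then have "card {(i, j). i \<in> \<alpha> \<and> j \<in> \<alpha> \<and> j \<le> i} = card \<alpha> * (card \<alpha> + 1) div 2"
    by linarith
  then show ?thesis by (simp only: cl_sign_def)
qed

lemma cl_conj_axis: "cl_conj (axis \<alpha> r) = cl_sign \<alpha> \<alpha> *\<^sub>R axis \<alpha> r"
  by (auto simp: cl_conj_def cl_sign_self vec_eq_iff axis_def)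

lemma cl_conj_mult: "cl_conj (a \<odot> b) = cl_conj b \<odot> cl_conj a"
proof -
  have sq: "cl_sign \<alpha> \<beta> * (cl_sign \<alpha> \<beta> * t) = t" for \<alpha> \<beta> :: "'a set" and t
    by (simp add: cl_sign_def flip: mult.assoc power_add)
  have *: "cl_conj (axis \<alpha> r \<odot> axis \<beta> s) = cl_conj (axis \<beta> s) \<odot> cl_conj (axis \<alpha> r)"
    for \<alpha> \<beta> :: "'a set" and r s
  proof -
    have sym: "sym_diff \<beta> \<alpha> = sym_diff \<alpha> \<beta>" by auto
    have ax: "axis \<gamma> t = t *\<^sub>R axis \<gamma> (1::real)" for \<gamma> :: "'a set" and t
      by (simp add: axis_scaleR_right[symmetric])
    have "cl_conj (axis \<alpha> r \<odot> axis \<beta> s) =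
        (cl_sign \<alpha> \<beta> * s * cl_sign (sym_diff \<alpha> \<beta>) (sym_diff \<alpha> \<beta>) * r) *\<^sub>R axis (sym_diff \<alpha> \<beta>) 1"
      unfolding cl_mult_axis linear_scale[OF linear_cl_conj] cl_conj_axis
      by (subst ax) simp
    also have "cl_sign \<alpha> \<beta> * s * cl_sign (sym_diff \<alpha> \<beta>) (sym_diff \<alpha> \<beta>) * r =
        cl_sign \<beta> \<beta> * (cl_sign \<alpha> \<alpha> * (cl_sign \<beta> \<alpha> * r)) * s"
      unfolding cl_sign_sym_diff_left cl_sign_sym_diff_right by (simp add: mult_ac sq)
    also have "\<dots> *\<^sub>R axis (sym_diff \<alpha> \<beta>) 1 = cl_conj (axis \<beta> s) \<odot> cl_conj (axis \<alpha> r)"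
      unfolding cl_mult_axis cl_conj_axis linear_scale[OF linear_cl_mult_left]
        linear_scale[OF linear_cl_mult_right] sym
      by (subst (2) ax) simp
    finally show ?thesis .
  qed
  have a: "a = (\<Sum>\<alpha>\<in>UNIV. axis \<alpha> (a $ \<alpha>))" and b: "b = (\<Sum>\<alpha>\<in>UNIV. axis \<alpha> (b $ \<alpha>))"
    by (rule vec_axis_expand)+
  show ?thesis
    by (subst (1 2) a, subst (1 2) b)
       (simp only: linear_sum[OF linear_cl_mult_left] linear_sum[OF linear_cl_mult_right]
         linear_sum[OF linear_cl_conj] *, rule sum.swap)
qed

lemma cl_re_inner:
  fixes x y :: "('h::real_inner, 'n::{finite,linorder}) cl_module"
  shows "cl_re (cl_inner x y) = x \<bullet> y"
proof -
  have *: "(cl_conj (cl_e \<beta>) \<odot> cl_e \<alpha>) $ {} = (if \<beta> = \<alpha> then 1 else 0)" for \<alpha> \<beta> :: "'n set"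
  proof (cases "\<beta> = \<alpha>")
    case True
    then show ?thesis
      by (simp add: cl_e_def cl_conj_axis linear_scale[OF linear_cl_mult_left] cl_mult_axis
        cl_sign_def flip: power_add)
  next
    case False
    then have "axis (sym_diff \<beta> \<alpha>) (1::real) $ {} = 0" by (auto simp: axis_def)
    with False show ?thesis
      unfolding cl_e_def cl_conj_axis linear_scale[OF linear_cl_mult_left] cl_mult_axis
      by (simp only: vector_scaleR_component) simp
  qed
  have "cl_re (cl_inner x y) =
      (\<Sum>\<alpha>\<in>UNIV. \<Sum>\<beta>\<in>UNIV. if \<beta> = \<alpha> then x $ \<alpha> \<bullet> y $ \<beta> else 0)"
    unfolding cl_re_def cl_inner_def sum_component vector_scaleR_component *
    by (intro sum.cong refl) auto
  then show ?thesis by (simp add: inner_vec_def)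
qed

lemma cl_inner_mult_left:
  fixes x y :: "('h::real_inner, 'n::{finite,linorder}) cl_module"
  shows "cl_inner (x \<odot> a) y = cl_inner x y \<odot> a"
proof -
  have lin: "linear (\<lambda>x. cl_inner x y)" for y :: "('h, 'n) cl_module"
    by (rule linearI)
       (simp_all add: cl_inner_def inner_add_left scaleR_add_left sum.distrib scaleR_right.sum)
  have ax: "cl_inner (axis \<alpha> h) y = (\<Sum>\<beta>\<in>UNIV. (h \<bullet> y $ \<beta>) *\<^sub>R (cl_conj (cl_e \<beta>) \<odot> cl_e \<alpha>))"
    for \<alpha> h
  proof -
    have "cl_inner (axis \<alpha> h) y = (\<Sum>\<alpha>'\<in>UNIV. if \<alpha>' = \<alpha>
        then \<Sum>\<beta>\<in>UNIV. (h \<bullet> y $ \<beta>) *\<^sub>R (cl_conj (cl_e \<beta>) \<odot> cl_e \<alpha>) else 0)"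
      unfolding cl_inner_def by (intro sum.cong refl) (auto simp: axis_def)
    then show ?thesis by simp
  qed
  have *: "cl_inner (axis \<alpha> h \<odot> axis \<gamma> r) y = cl_inner (axis \<alpha> h) y \<odot> axis \<gamma> r" for \<alpha> \<gamma> h r
  proof -
    have "(cl_sign \<alpha> \<gamma> * r) *\<^sub>R cl_e (sym_diff \<alpha> \<gamma>) = cl_e \<alpha> \<odot> axis \<gamma> r"
      by (simp add: cl_e_def cl_mult_axis)
    then have conj: "cl_conj (cl_e \<beta>) \<odot> cl_e \<alpha> \<odot> axis \<gamma> r =
        (cl_sign \<alpha> \<gamma> * r) *\<^sub>R (cl_conj (cl_e \<beta>) \<odot> cl_e (sym_diff \<alpha> \<gamma>))" for \<beta>
      by (metis cl_mult_assoc linear_scale linear_cl_mult_right)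
    then show ?thesis
      unfolding cl_mult_axis linear_scale[OF lin] ax linear_sum[OF linear_cl_mult_left]
        linear_scale[OF linear_cl_mult_left] scaleR_right.sum conj
      by (intro sum.cong refl scaleR_left_commute)
  qed
  have x: "x = (\<Sum>\<alpha>\<in>UNIV. axis \<alpha> (x $ \<alpha>))" and a: "a = (\<Sum>\<alpha>\<in>UNIV. axis \<alpha> (a $ \<alpha>))"
    by (rule vec_axis_expand)+
  show ?thesis
    by (subst (1 2) x, subst (1 2) a)
       (simp only: linear_sum[OF linear_cl_mult_left] linear_sum[OF linear_cl_mult_right]
         linear_sum[OF lin] *)
qed

lemma imag_unit_nth_empty: "\<iota> \<in> imag_units \<Longrightarrow> \<iota> $ {} = 0"
  by (auto simp: imag_units_def cl_e_def axis_def)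

lemma imag_unit_norm:
  assumes "\<iota> \<in> imag_units"
  shows "norm \<iota> = 1"
proof -
  obtain c where \<iota>: "\<iota> = (\<Sum>j\<in>UNIV. c j *\<^sub>R cl_e {j})" and c: "(\<Sum>j\<in>UNIV. (c j)\<^sup>2) = 1"
    using assms by (auto simp: imag_units_def)
  have "\<iota> \<bullet> \<iota> = (\<Sum>j\<in>UNIV. c j * c j)"
    unfolding \<iota> inner_sum_left inner_sum_right
    by (simp add: cl_e_def inner_axis_axis if_distrib sum.delta cong: if_cong)
  with c show ?thesis by (simp add: norm_eq_sqrt_inner power2_eq_square)
qed

lemma imag_unit_square:
  assumes "\<iota> \<in> imag_units"
  shows "\<iota> \<odot> \<iota> = - cl_one"
proof -
  obtain c where \<iota>: "\<iota> = (\<Sum>j\<in>UNIV. c j *\<^sub>R cl_e {j})" and c: "(\<Sum>j\<in>UNIV. (c j)\<^sup>2) = 1"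
    using assms by (auto simp: imag_units_def)
  define S where "S = (\<Sum>i\<in>UNIV. \<Sum>j\<in>UNIV. (c i * c j) *\<^sub>R (cl_e {i} \<odot> cl_e {j}))"
  have \<iota>\<iota>: "\<iota> \<odot> \<iota> = S"
    unfolding \<iota> S_def linear_sum[OF linear_cl_mult_left] linear_sum[OF linear_cl_mult_right]
      linear_scale[OF linear_cl_mult_left] linear_scale[OF linear_cl_mult_right]
    by (subst sum.swap) (simp add: scaleR_right.sum mult.commute)
  have "S + S = (\<Sum>i\<in>UNIV. \<Sum>j\<in>UNIV.
      (c i * c j) *\<^sub>R (cl_e {i} \<odot> cl_e {j}) + (c j * c i) *\<^sub>R (cl_e {j} \<odot> cl_e {i}))"
    unfolding sum.distrib S_def by (subst (2) sum.swap) simp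
  also have "\<dots> = (\<Sum>i\<in>UNIV. \<Sum>j\<in>UNIV. if j = i then (- 2 * (c i)\<^sup>2) *\<^sub>R cl_one else 0)"
  proof (intro sum.cong refl)
    fix i j
    show "(c i * c j) *\<^sub>R (cl_e {i} \<odot> cl_e {j}) + (c j * c i) *\<^sub>R (cl_e {j} \<odot> cl_e {i}) =
        (if j = i then (- 2 * (c i)\<^sup>2) *\<^sub>R cl_one else 0)"
    proof (cases "j = i")
      case True
      then show ?thesis
        by (simp only: cl_generator_square power2_eq_square scaleR_minus_right if_True)
           (simp flip: scaleR_left_distrib scaleR_minus_left)
    next
      case False
      then show ?thesis
        by (simp add: cl_generator_anticommute[of i j] mult.commute)
    qed
  qed
  also have "\<dots> = (\<Sum>i\<in>UNIV. (- 2 * (c i)\<^sup>2) *\<^sub>R cl_one)"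
    by (simp only: sum.delta finite UNIV_I if_True)
  also have "\<dots> = (- 2 * (\<Sum>i\<in>UNIV. (c i)\<^sup>2)) *\<^sub>R cl_one"
    by (simp only: sum_distrib_left scaleR_left.sum)
  finally have "2 *\<^sub>R S = 2 *\<^sub>R (- cl_one)"
    unfolding c scaleR_2[symmetric] by simp
  then show ?thesis using \<iota>\<iota> by (metis scaleR_cancel_left zero_neq_numeral)
qed

lemma cl_re_im_unique:
  assumes "\<iota> \<in> imag_units"
  shows "cl_re (a *\<^sub>R cl_one + b *\<^sub>R \<iota>) = a" "cl_im \<iota> (a *\<^sub>R cl_one + b *\<^sub>R \<iota>) = b"
proof -
  have re: "cl_re (a *\<^sub>R cl_one + b *\<^sub>R \<iota>) = a" for a b
    by (simp add: cl_re_def cl_e_def imag_unit_nth_empty[OF assms])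
  then show "cl_re (a *\<^sub>R cl_one + b *\<^sub>R \<iota>) = a" .
  have "b' = b" if "a *\<^sub>R cl_one + b *\<^sub>R \<iota> = a' *\<^sub>R cl_one + b' *\<^sub>R \<iota>" for a' b'
  proof -
    have "a = a'" using re[of a b] re[of a' b'] that by simp
    moreover have "\<iota> \<noteq> 0" using imag_unit_norm[OF assms] by auto
    ultimately show ?thesis using that by simp
  qed
  then show "cl_im \<iota> (a *\<^sub>R cl_one + b *\<^sub>R \<iota>) = b"
    unfolding cl_im_def by (intro the_equality) blast+
qed


section \<open>Operators on the Clifford module\<close>

text \<open>
  An operator with domain \<open>D\<close> is a partial function with \<open>dom T = D\<close>; the product of operators is
  \<open>\<circ>\<^sub>m\<close> and the identity operator is \<open>Some\<close>.  An everywhere defined operator is given by a total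
  function and is turned into a partial one by \<open>total_op\<close>.
\<close>

type_synonym ('h, 'n) cl_op = "('h, 'n) cl_module \<rightharpoonup> ('h, 'n) cl_module"

definition total_op :: "('a \<Rightarrow> 'b) \<Rightarrow> 'a \<rightharpoonup> 'b" where
  "total_op T = (\<lambda>x. Some (T x))"

definition op_add :: "('a \<rightharpoonup> 'b::plus) \<Rightarrow> ('a \<rightharpoonup> 'b) \<Rightarrow> 'a \<rightharpoonup> 'b" where
  "op_add S T = (\<lambda>x. if x \<in> dom S \<inter> dom T then Some (the (S x) + the (T x)) else None)"

definition right_linear_op :: "('h::real_vector, 'n::{finite,linorder}) cl_op \<Rightarrow> bool" where
  "right_linear_op T \<longleftrightarrow>
    0 \<in> dom T \<and>
    (\<forall>x\<in>dom T. \<forall>y\<in>dom T. x + y \<in> dom T \<and> the (T (x + y)) = the (T x) + the (T y)) \<and>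
    (\<forall>x\<in>dom T. \<forall>a. x \<odot> a \<in> dom T \<and> the (T (x \<odot> a)) = the (T x) \<odot> a)"

definition bounded_ops ::
    "(('h::real_inner, 'n::{finite,linorder}) cl_module \<Rightarrow> ('h, 'n) cl_module) set" where
  "bounded_ops = {T. bounded_linear T \<and> right_linear_op (total_op T)}"

definition densely_defined :: "('h::real_inner, 'n::{finite,linorder}) cl_op \<Rightarrow> bool" where
  "densely_defined T \<longleftrightarrow> closure (dom T) = UNIV"

definition closed_op :: "('h::real_inner, 'n::{finite,linorder}) cl_op \<Rightarrow> bool" where
  "closed_op T \<longleftrightarrow> closed (Map.graph T)"

definition closable_op :: "('h::real_inner, 'n::{finite,linorder}) cl_op \<Rightarrow> bool" where
  "closable_op S \<longleftrightarrow> single_valued (closure (Map.graph S))"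

text \<open>For closable \<open>S\<close>, the operator whose graph is the closure of the graph of \<open>S\<close>.\<close>

definition op_closure :: "('h::real_inner, 'n::{finite,linorder}) cl_op \<Rightarrow> ('h, 'n) cl_op" where
  "op_closure S = (\<lambda>x. if \<exists>y. (x, y) \<in> closure (Map.graph S)
    then Some (THE y. (x, y) \<in> closure (Map.graph S)) else None)"

text \<open>Meaningful only for densely defined \<open>T\<close>, where the vector \<open>z\<close> is unique.\<close>

definition op_adjoint :: "('h::real_inner, 'n::{finite,linorder}) cl_op \<Rightarrow> ('h, 'n) cl_op" where
  "op_adjoint T = (\<lambda>y. if \<exists>z. \<forall>x\<in>dom T. cl_inner (the (T x)) y = cl_inner x z
    then Some (THE z. \<forall>x\<in>dom T. cl_inner (the (T x)) y = cl_inner x z) else None)"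

definition normal_op :: "('h::real_inner, 'n::{finite,linorder}) cl_op \<Rightarrow> bool" where
  "normal_op T \<longleftrightarrow> densely_defined T \<and> closed_op T \<and> dom T = dom (op_adjoint T) \<and>
    T \<circ>\<^sub>m op_adjoint T = op_adjoint T \<circ>\<^sub>m T"

definition unitary_op ::
    "(('h::real_inner, 'n::{finite,linorder}) cl_module \<Rightarrow> ('h, 'n) cl_module) \<Rightarrow> bool" where
  "unitary_op U \<longleftrightarrow> U \<in> bounded_ops \<and>
    total_op U \<circ>\<^sub>m op_adjoint (total_op U) = Some \<and>
    op_adjoint (total_op U) \<circ>\<^sub>m total_op U = Some"

definition imaginary_op ::
    "(('h::real_inner, 'n::{finite,linorder}) cl_module \<Rightarrow> ('h, 'n) cl_module) \<Rightarrow> bool" where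
  "imaginary_op J \<longleftrightarrow> unitary_op J \<and> op_adjoint (total_op J) = total_op (\<lambda>x. - J x)"

definition orthogonal_projection ::
    "(('h::real_inner, 'n::{finite,linorder}) cl_module \<Rightarrow> ('h, 'n) cl_module) \<Rightarrow> bool" where
  "orthogonal_projection P \<longleftrightarrow>
    P \<in> bounded_ops \<and> op_adjoint (total_op P) = total_op P \<and> P \<circ> P = P"


section \<open>Spectral measures and spectral integrals\<close>

text \<open>
  A measurable space is given by \<open>M :: 'a measure\<close>, of which only \<open>space M\<close> and \<open>sets M\<close> are used.
\<close>

definition spectral_measure ::
    "'a measure \<Rightarrow>
     ('a set \<Rightarrow> ('h::real_inner, 'n::{finite,linorder}) cl_module \<Rightarrow> ('h, 'n) cl_module) \<Rightarrow> bool" where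
  "spectral_measure M E \<longleftrightarrow>
    (\<forall>A\<in>sets M. orthogonal_projection (E A)) \<and>
    (\<forall>A. range A \<subseteq> sets M \<longrightarrow> disjoint_family A \<longrightarrow>
      (\<forall>x. (\<lambda>i. E (A i) x) sums E (\<Union>i. A i) x)) \<and>
    E (space M) = id"

definition associated_op ::
    "'a measure \<Rightarrow> ('a set \<Rightarrow> ('h, 'n) cl_module \<Rightarrow> ('h, 'n) cl_module) \<Rightarrow>
     (('h, 'n) cl_module \<Rightarrow> ('h, 'n) cl_module) \<Rightarrow> bool" where
  "associated_op M E J \<longleftrightarrow> (\<forall>A\<in>sets M. J \<circ> E A = E A \<circ> J)"

definition spectral_scalar_measure ::
    "'a measure \<Rightarrow>
     ('a set \<Rightarrow> ('h::real_inner, 'n::{finite,linorder}) cl_module \<Rightarrow> ('h, 'n) cl_module) \<Rightarrow>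
     ('h, 'n) cl_module \<Rightarrow> 'a measure" where
  "spectral_scalar_measure M E x =
    measure_of (space M) (sets M) (\<lambda>A. ennreal (cl_re (cl_inner (E A x) x)))"

text \<open>The value \<open>None\<close> stands for \<open>\<infinity>\<close>; the sigma-algebra is the Borel one of \<open>\<complex>\<^sub>\<iota> \<union> {\<infinity>}\<close>.\<close>

definition ext_plane :: "'n::{finite,linorder} clifford \<Rightarrow> 'n clifford option set" where
  "ext_plane \<iota> = insert None (Some ` cplane \<iota>)"

definition ext_borel :: "'n::{finite,linorder} clifford \<Rightarrow> 'n clifford option measure" where
  "ext_borel \<iota> = sigma (ext_plane \<iota>) {B. B \<subseteq> ext_plane \<iota> \<and> Some -` B \<in> sets borel}"

definition ae_finite ::
    "'a measure \<Rightarrow> ('a set \<Rightarrow> ('h::real_inner, 'n::{finite,linorder}) cl_module \<Rightarrow> ('h, 'n) cl_module) \<Rightarrow>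
     ('a \<Rightarrow> 'n clifford option) \<Rightarrow> bool" where
  "ae_finite M E f \<longleftrightarrow> E {\<omega> \<in> space M. f \<omega> = None} = (\<lambda>x. 0)"

text \<open>
  Pointwise operations take the value \<open>\<infinity>\<close> as soon as one argument does; \<open>fc\<close> is the product with
  the constant function \<open>Some c\<close>.
\<close>

definition ext_conj :: "('a \<Rightarrow> 'n::{finite,linorder} clifford option) \<Rightarrow> 'a \<Rightarrow> 'n clifford option" where
  "ext_conj f = (\<lambda>\<omega>. map_option cl_conj (f \<omega>))"

definition ext_add ::
    "('a \<Rightarrow> 'n::{finite,linorder} clifford option) \<Rightarrow> ('a \<Rightarrow> 'n clifford option) \<Rightarrow>
     'a \<Rightarrow> 'n clifford option" where
  "ext_add f g = (\<lambda>\<omega>. case (f \<omega>, g \<omega>) of (Some a, Some b) \<Rightarrow> Some (a + b) | _ \<Rightarrow> None)"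

definition ext_mult ::
    "('a \<Rightarrow> 'n::{finite,linorder} clifford option) \<Rightarrow> ('a \<Rightarrow> 'n clifford option) \<Rightarrow>
     'a \<Rightarrow> 'n clifford option" where
  "ext_mult f g = (\<lambda>\<omega>. case (f \<omega>, g \<omega>) of (Some a, Some b) \<Rightarrow> Some (a \<odot> b) | _ \<Rightarrow> None)"

definition ext_norm :: "'n::{finite,linorder} clifford option \<Rightarrow> ennreal" where
  "ext_norm u = (case u of None \<Rightarrow> \<infinity> | Some a \<Rightarrow> ennreal (norm a))"

definition simple_plane_function ::
    "'a measure \<Rightarrow> 'n::{finite,linorder} clifford \<Rightarrow> ('a \<Rightarrow> 'n clifford) \<Rightarrow> bool" where
  "simple_plane_function M \<iota> f \<longleftrightarrow> simple_function M f \<and> f ` space M \<subseteq> cplane \<iota>"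

text \<open>As for \<open>simple_integral\<close>, the simple function is written with its distinct values.\<close>

definition spectral_int_simple ::
    "'a measure \<Rightarrow>
     ('a set \<Rightarrow> ('h::real_inner, 'n::{finite,linorder}) cl_module \<Rightarrow> ('h, 'n) cl_module) \<Rightarrow>
     'n clifford \<Rightarrow> (('h, 'n) cl_module \<Rightarrow> ('h, 'n) cl_module) \<Rightarrow> ('a \<Rightarrow> 'n clifford) \<Rightarrow>
     ('h, 'n) cl_module \<Rightarrow> ('h, 'n) cl_module" where
  "spectral_int_simple M E \<iota> J f = (\<lambda>x. \<Sum>c\<in>f ` space M.
    cl_re c *\<^sub>R E (f -` {c} \<inter> space M) x + cl_im \<iota> c *\<^sub>R E (f -` {c} \<inter> space M) (J x))"

definition spectral_int_bounded ::
    "'a measure \<Rightarrow>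
     ('a set \<Rightarrow> ('h::real_inner, 'n::{finite,linorder}) cl_module \<Rightarrow> ('h, 'n) cl_module) \<Rightarrow>
     'n clifford \<Rightarrow> (('h, 'n) cl_module \<Rightarrow> ('h, 'n) cl_module) \<Rightarrow> ('a \<Rightarrow> 'n clifford) \<Rightarrow>
     ('h, 'n) cl_module \<Rightarrow> ('h, 'n) cl_module" where
  "spectral_int_bounded M E \<iota> J f = (THE T. T \<in> bounded_ops \<and>
    (\<exists>F. (\<forall>j. simple_plane_function M \<iota> (F j)) \<and> uniform_limit (space M) F f sequentially \<and>
      (\<lambda>j. onorm (\<lambda>x. spectral_int_simple M E \<iota> J (F j) x - T x)) \<longlonglongrightarrow> 0))"

definition bounding_sequence ::
    "'a measure \<Rightarrow>
     ('a set \<Rightarrow> ('h::real_inner, 'n::{finite,linorder}) cl_module \<Rightarrow> ('h, 'n) cl_module) \<Rightarrow>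
     ('a \<Rightarrow> 'n clifford option) \<Rightarrow> (nat \<Rightarrow> 'a set) \<Rightarrow> bool" where
  "bounding_sequence M E f A \<longleftrightarrow>
    (\<forall>j. A j \<in> sets M \<and> A j \<subseteq> A (Suc j) \<and> (\<exists>K. \<forall>\<omega>\<in>A j. \<exists>a. f \<omega> = Some a \<and> norm a \<le> K)) \<and>
    E (\<Union>j. A j) = id"

definition ext_restrict ::
    "('a \<Rightarrow> 'n::{finite,linorder} clifford option) \<Rightarrow> 'a set \<Rightarrow> 'a \<Rightarrow> 'n clifford" where
  "ext_restrict f A = (\<lambda>\<omega>. if \<omega> \<in> A then the (f \<omega>) else 0)"

definition spectral_integral ::
    "'a measure \<Rightarrow>
     ('a set \<Rightarrow> ('h::real_inner, 'n::{finite,linorder}) cl_module \<Rightarrow> ('h, 'n) cl_module) \<Rightarrow>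
     'n clifford \<Rightarrow> (('h, 'n) cl_module \<Rightarrow> ('h, 'n) cl_module) \<Rightarrow> ('a \<Rightarrow> 'n clifford option) \<Rightarrow>
     ('h, 'n) cl_op" where
  "spectral_integral M E \<iota> J f = (\<lambda>x.
    if (\<integral>\<^sup>+\<omega>. (ext_norm (f \<omega>))\<^sup>2 \<partial>spectral_scalar_measure M E x) < \<infinity>
    then Some (THE y. \<exists>A. bounding_sequence M E f A \<and>
      (\<lambda>j. spectral_int_bounded M E \<iota> J (ext_restrict f (A j)) x) \<longlonglongrightarrow> y)
    else None)"

end

theory Submission
  imports Defs
begin

text \<open>
  \<open>J\<close> makes the Clifford module a complex Hilbert space on which \<open>E\<close> acts complex-linearly, so the
  integral of \<open>f\<close> is an ordinary functional calculus for complex functions; right linearity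
  holds because right multiplications commute with \<open>E\<close> and \<open>J\<close>.  Write \<open>\<mu>\<^sub>x\<close> for the scalar measure of \<open>x\<close>.
  For simple \<open>f\<close> one has \<open>\<parallel>\<II>(f)x\<parallel>\<^sup>2 = \<integral>|f|\<^sup>2 d\<mu>\<^sub>x\<close>, so \<open>f \<mapsto> \<II>(f)x\<close> extends to an isometry on
  \<open>L\<^sup>2(\<mu>\<^sub>x)\<close>, for bounded and unbounded \<open>f\<close> alike.  The scalar measure of \<open>\<II>(g)x\<close> has density \<open>|g|\<^sup>2\<close>
  with respect to \<open>\<mu>\<^sub>x\<close>, which gives the domain of a product and \<open>\<II>(f)\<II>(g)x = \<II>(fg)x\<close>.
  Adjoints are computed on the vectors \<open>E({|f| \<le> n})x\<close>; every \<open>\<II>(f)\<close>, being the adjoint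
  of \<open>\<II>(cnj f)\<close>, is closed, and these vectors form a core, which gives the closure statements.
\<close>

section \<open>Limits and approximation by simple functions\<close>

text \<open>Adjoints are defined through the Clifford-valued product, whose real part is the
  ordinary inner product of the module. Testing against all right multiples recovers the whole
  Clifford value from that real part, and the domains are right submodules, so adjoints may be
  computed in the underlying real Hilbert space. Hence the calculus lives in a locale that mentions
  no Clifford algebra. The other obstacle is that the integral is described by \<open>THE\<close>,
  over uniform approximations for bounded \<open>f\<close> and over bounding sequences for unbounded
  \<open>f\<close>. The locale instead fixes one pointwise approximation of \<open>f\<close> by
  simple functions, dominated by \<open>2 * cmod (f \<omega>)\<close>, and takes the limit along it
  at every vector of the domain. Agreement with both descriptions then needs two facts each time:
  every admissible sequence has this limit, and some admissible sequence exists.\<close>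

lemma tendsto_zero_of_ennreal_le:
  fixes u v :: "nat \<Rightarrow> ennreal"
  assumes "v \<longlonglongrightarrow> 0" "\<And>j. u j \<le> v j"
  shows "u \<longlonglongrightarrow> 0"
  by (rule tendsto_sandwich[OF _ _ tendsto_const assms(1)]) (auto simp: assms(2))

text \<open>Bridge from squared L2 distances, which are kept in \<open>ennreal\<close>, to norm
  convergence of vectors.\<close>

lemma tendsto_zero_of_ennreal_square_le:
  fixes u :: "nat \<Rightarrow> 'b::real_normed_vector" and v :: "nat \<Rightarrow> ennreal"
  assumes "v \<longlonglongrightarrow> 0" "\<And>j. ennreal ((norm (u j))\<^sup>2) \<le> v j"
  shows "u \<longlonglongrightarrow> 0"
proof -
  have "(\<lambda>j. ennreal ((norm (u j))\<^sup>2)) \<longlonglongrightarrow> 0"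
    by (rule tendsto_zero_of_ennreal_le[OF assms])
  then have "(\<lambda>j. (norm (u j))\<^sup>2) \<longlonglongrightarrow> 0"
    by (simp add: ennreal_tendsto_0_iff)
  then have "(\<lambda>j. sqrt ((norm (u j))\<^sup>2)) \<longlonglongrightarrow> sqrt 0"
    by (rule tendsto_real_sqrt)
  then show ?thesis by (simp add: tendsto_norm_zero_iff)
qed

lemma borel_measurable_cnj:
  assumes "f \<in> borel_measurable M"
  shows "(\<lambda>\<omega>. cnj (f \<omega>)) \<in> borel_measurable M"
  by (rule borel_measurable_continuous_on[OF _ assms]) (intro continuous_intros)

text \<open>Rounding real and imaginary parts down to multiples of \<open>1 / (j + 1)\<close> errs
  by at most that much in each coordinate. Uniform approximants are what the definition of the
  bounded integral asks for; this lemma supplies one such sequence.\<close>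

lemma bounded_uniform_simple_approx:
  fixes g :: "'a \<Rightarrow> complex"
  assumes g: "g \<in> borel_measurable M" and K: "\<And>\<omega>. \<omega> \<in> space M \<Longrightarrow> cmod (g \<omega>) \<le> K"
  shows "\<exists>G. (\<forall>j. simple_function M (G j)) \<and> uniform_limit (space M) G g sequentially"
proof -
  define r :: "nat \<Rightarrow> real \<Rightarrow> real" where "r j t = \<lfloor>real (Suc j) * t\<rfloor> / real (Suc j)" for j t
  have r: "\<bar>r j t - t\<bar> \<le> 1 / real (Suc j)" for j t
  proof -
    have "\<bar>\<lfloor>real (Suc j) * t\<rfloor> - real (Suc j) * t\<bar> \<le> 1" by linarith
    moreover have "r j t - t = (\<lfloor>real (Suc j) * t\<rfloor> - real (Suc j) * t) / real (Suc j)"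
      by (simp add: r_def diff_divide_distrib)
    ultimately show ?thesis by (simp add: divide_right_mono)
  qed
  define G where "G j \<omega> = Complex (r j (Re (g \<omega>))) (r j (Im (g \<omega>)))" for j \<omega>
  have simple: "simple_function M (G j)" for j
  proof -
    let ?I = "{\<lfloor>- (real (Suc j) * K)\<rfloor>..\<lfloor>real (Suc j) * K\<rfloor>}"
    note [measurable] = g
    \<comment> \<open>\<open>p\<close> stands for \<open>Re\<close> or \<open>Im\<close>. The bound
      \<open>K\<close> confines the rounded values to the finitely many integers of
      \<open>?I\<close>, so rounding leaves a simple function.\<close>
    have 1: "simple_function M (\<lambda>\<omega>. \<lfloor>real (Suc j) * p (g \<omega>)\<rfloor>)"
      if [measurable]: "(\<lambda>\<omega>. p (g \<omega>)) \<in> borel_measurable M" and p: "\<And>z. \<bar>p z\<bar> \<le> cmod z" for p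
    proof -
      have "\<bar>p (g \<omega>)\<bar> \<le> K" if "\<omega> \<in> space M" for \<omega> using p[of "g \<omega>"] K[OF that] by linarith
      then have scaled: "\<bar>real (Suc j) * p (g \<omega>)\<bar> \<le> real (Suc j) * K" if "\<omega> \<in> space M" for \<omega>
        unfolding abs_mult using that by (intro mult_mono) simp_all
      have "- (real (Suc j) * K) \<le> real (Suc j) * p (g \<omega>)"
          "real (Suc j) * p (g \<omega>) \<le> real (Suc j) * K" if "\<omega> \<in> space M" for \<omega>
        using scaled[OF that] by linarith+
      then have "(\<lambda>\<omega>. \<lfloor>real (Suc j) * p (g \<omega>)\<rfloor>) ` space M \<subseteq> ?I"
        by (intro image_subsetI) (simp only: atLeastAtMost_iff floor_mono)
      then have "finite ((\<lambda>\<omega>. \<lfloor>real (Suc j) * p (g \<omega>)\<rfloor>) ` space M)"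
        by (rule finite_subset) simp
      moreover have "(\<lambda>\<omega>. \<lfloor>real (Suc j) * p (g \<omega>)\<rfloor>) \<in> measurable M (count_space UNIV)" by measurable
      ultimately show ?thesis by (simp add: simple_function_def measurable_sets)
    qed
    have "simple_function M (\<lambda>\<omega>. \<lfloor>real (Suc j) * Re (g \<omega>)\<rfloor>)"
      "simple_function M (\<lambda>\<omega>. \<lfloor>real (Suc j) * Im (g \<omega>)\<rfloor>)"
      by (intro 1; simp add: abs_Re_le_cmod abs_Im_le_cmod)+
    from simple_function_compose2[OF this, of
        "\<lambda>m n. Complex (real_of_int m / real (Suc j)) (real_of_int n / real (Suc j))"]
    show ?thesis by (simp add: G_def[abs_def] r_def)
  qed
  have close: "dist (G j \<omega>) (g \<omega>) \<le> 2 * inverse (real (Suc j))" for j \<omega>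
  proof -
    have "dist (G j \<omega>) (g \<omega>) \<le> \<bar>Re (G j \<omega> - g \<omega>)\<bar> + \<bar>Im (G j \<omega> - g \<omega>)\<bar>"
      unfolding dist_norm by (rule cmod_le)
    also have "\<dots> \<le> 1 / real (Suc j) + 1 / real (Suc j)"
      using r[of j "Re (g \<omega>)"] r[of j "Im (g \<omega>)"] by (intro add_mono) (simp_all add: G_def)
    finally show ?thesis by (simp add: field_simps)
  qed
  have "uniform_limit (space M) G g sequentially"
  proof (rule uniform_limitI)
    fix e :: real assume "e > 0"
    have "(\<lambda>j. 2 * inverse (real (Suc j))) \<longlonglongrightarrow> 2 * 0"
      by (intro tendsto_intros LIMSEQ_inverse_real_of_nat)
    then have "\<forall>\<^sub>F j in sequentially. 2 * inverse (real (Suc j)) < e"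
      using \<open>e > 0\<close> by (intro order_tendstoD(2)) simp_all
    then show "\<forall>\<^sub>F j in sequentially. \<forall>\<omega>\<in>space M. dist (G j \<omega>) (g \<omega>) < e"
      by eventually_elim (intro ballI le_less_trans[OF close])
  qed
  with simple show ?thesis by blast
qed


section \<open>The functional calculus of a commuting complex structure and projection-valued measure\<close>

text \<open>The inner product stays real throughout: \<open>J_inner\<close> and \<open>J_J\<close>
  make \<open>J\<close> a skew-adjoint complex structure, and conjugation of scalars appears as the
  adjoint of the real-linear action \<open>smul\<close>. Multiplicativity of \<open>E\<close> on
  intersections is derived, not assumed.\<close>

locale spectral_calculus =
  fixes M :: "'a measure"
    and E :: "'a set \<Rightarrow> 'v::{real_inner,complete_space} \<Rightarrow> 'v"
    and J :: "'v \<Rightarrow> 'v"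
  assumes bounded_linear_E: "\<And>A. A \<in> sets M \<Longrightarrow> bounded_linear (E A)"
    and E_inner: "\<And>A x y. A \<in> sets M \<Longrightarrow> E A x \<bullet> y = x \<bullet> E A y"
    and E_idem: "\<And>A x. A \<in> sets M \<Longrightarrow> E A (E A x) = E A x"
    and E_sums: "\<And>A x. range A \<subseteq> sets M \<Longrightarrow> disjoint_family A \<Longrightarrow>
      (\<lambda>i. E (A i) x) sums E (\<Union>i. A i) x"
    and E_space: "\<And>x. E (space M) x = x"
    and bounded_linear_J: "bounded_linear J"
    and J_inner: "\<And>x y. J x \<bullet> y = - (x \<bullet> J y)"
    and J_J: "\<And>x. J (J x) = - x"
    and J_E: "\<And>A x. A \<in> sets M \<Longrightarrow> J (E A x) = E A (J x)"
begin

section \<open>Projections of a countably additive family: additivity, orthogonality,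
  multiplicativity\<close>

lemma linear_E: "A \<in> sets M \<Longrightarrow> linear (E A)"
  by (simp add: bounded_linear_E bounded_linear.linear)

lemma linear_J: "linear J"
  by (simp add: bounded_linear_J bounded_linear.linear)

text \<open>Additivity along the constant sequence of empty sets makes a series with constant terms
  converge, so its terms vanish.\<close>

lemma E_empty [simp]: "E {} x = 0"
proof -
  have "(\<lambda>i::nat. E {} x) sums E {} x"
    using E_sums[of "\<lambda>_. {}" x] by (simp add: disjoint_family_on_def)
  then have "(\<lambda>i::nat. E {} x) \<longlonglongrightarrow> 0"
    by (intro summable_LIMSEQ_zero) (simp add: sums_iff)
  then show ?thesis by (simp add: LIMSEQ_const_iff)
qed

lemma E_Un:
  assumes "A \<in> sets M" "B \<in> sets M" "A \<inter> B = {}"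
  shows "E (A \<union> B) x = E A x + E B x"
proof -
  have "range (binaryset A B) \<subseteq> sets M"
    using assms by (auto simp: binaryset_def)
  moreover have "disjoint_family (binaryset A B)"
    using assms by (auto simp: disjoint_family_on_def binaryset_def)
  ultimately have "(\<lambda>i. E (binaryset A B i) x) sums E (A \<union> B) x"
    using E_sums[of "binaryset A B" x] by (simp add: UN_binaryset_eq)
  moreover have "(\<lambda>i. E (binaryset A B i) x) sums (E A x + E B x)"
    by (rule binaryset_sums) simp
  ultimately show ?thesis by (rule sums_unique2)
qed

lemma E_UN:
  assumes "finite I" "\<And>i. i \<in> I \<Longrightarrow> A i \<in> sets M" "disjoint_family_on A I"
  shows "E (\<Union>i\<in>I. A i) x = (\<Sum>i\<in>I. E (A i) x)"
  using assms
proof (induction I rule: finite_induct)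
  case (insert i I)
  have "E (A i \<union> (\<Union>i\<in>I. A i)) x = E (A i) x + E (\<Union>i\<in>I. A i) x"
    using insert.prems insert.hyps
    by (intro E_Un sets.finite_UN) (auto simp: disjoint_family_on_def)
  moreover have "E (\<Union>i\<in>I. A i) x = (\<Sum>i\<in>I. E (A i) x)"
    using insert.prems by (intro insert.IH) (auto simp: disjoint_family_on_def)
  ultimately show ?case using insert.hyps by simp
qed simp

lemma E_disjoint:
  assumes "A \<in> sets M" "B \<in> sets M" "A \<inter> B = {}"
  shows "E A (E B x) = 0"
proof -
  note lin = linear_add[OF linear_E[OF assms(1)]] linear_add[OF linear_E[OF assms(2)]]
  \<comment> \<open>two projections whose sum is a projection anticommute, hence annihilate each other\<close>
  have anti: "E A (E B y) + E B (E A y) = 0" for y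
  proof -
    have "E (A \<union> B) (E (A \<union> B) y) = E (A \<union> B) y"
      using assms by (intro E_idem) auto
    then show ?thesis
      using assms by (simp add: E_Un lin E_idem)
  qed
  have "E A (E B x) + E A (E B (E A x)) = 0"
    using arg_cong[OF anti[of x], of "E A"] assms
    by (simp add: lin E_idem linear_0[OF linear_E])
  moreover have "E A (E B (E A x)) + E B (E A x) = 0"
    using anti[of "E A x"] assms by (simp add: E_idem)
  ultimately have "E A (E B x) = E B (E A x)"
    by (simp add: add_eq_0_iff)
  with anti[of x] have "2 *\<^sub>R E A (E B x) = 0" by (simp add: scaleR_2)
  then show ?thesis by simp
qed

text \<open>Split \<open>A\<close> and \<open>B\<close> along their intersection; all mixed terms
  vanish by \<open>E_disjoint\<close>, and only the idempotent \<open>E (A \<inter> B)\<close>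
  survives.\<close>

lemma E_Int:
  assumes "A \<in> sets M" "B \<in> sets M"
  shows "E A (E B x) = E (A \<inter> B) x"
proof -
  have A: "E A y = E (A \<inter> B) y + E (A - B) y" for y
    using E_Un[of "A \<inter> B" "A - B" y] assms by (simp add: Int_Diff_disjoint Int_Diff_Un)
  have B: "E B y = E (A \<inter> B) y + E (B - A) y" for y
    using E_Un[of "A \<inter> B" "B - A" y] assms
    by (simp add: Int_Diff_disjoint Int_Diff_Un Int_commute[of A B])
  have AB: "A \<inter> B \<in> sets M" "A - B \<in> sets M" "B - A \<in> sets M" using assms by auto
  have "E (A - B) (E (A \<inter> B) x) = 0" "E (A - B) (E (B - A) x) = 0" "E (A \<inter> B) (E (B - A) x) = 0"
    using AB by (auto intro!: E_disjoint)
  then have "E A (E (A \<inter> B) x) = E (A \<inter> B) x" "E A (E (B - A) x) = 0"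
    unfolding A using AB E_disjoint[of "A \<inter> B" "B - A" x] E_disjoint[of "A - B" "B - A" x]
    by (auto simp: E_idem)
  then show ?thesis
    unfolding B[of x] using assms by (simp add: linear_add[OF linear_E])
qed

lemma E_inner_self: "A \<in> sets M \<Longrightarrow> E A x \<bullet> x = (norm (E A x))\<^sup>2"
  by (metis E_idem E_inner power2_norm_eq_inner)

lemma norm_E_le: "A \<in> sets M \<Longrightarrow> norm (E A x) \<le> norm x"
  using norm_cauchy_schwarz[of "E A x" x]
  by (cases "E A x = 0") (auto simp: E_inner_self power2_eq_square)

lemma inner_J_self: "x \<bullet> J x = 0"
  using J_inner[of x x] by (simp add: inner_commute)


subsection \<open>The complex scalar action and the scalar measures\<close>

definition smul :: "complex \<Rightarrow> 'v \<Rightarrow> 'v" where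
  "smul c x = Re c *\<^sub>R x + Im c *\<^sub>R J x"

lemma bounded_linear_smul: "bounded_linear (smul c)"
  unfolding smul_def[abs_def]
  by (intro bounded_linear_add bounded_linear_scaleR_right bounded_linear_ident
      bounded_linear_compose[OF bounded_linear_scaleR_right bounded_linear_J])

lemma linear_smul: "linear (smul c)"
  by (simp add: bounded_linear_smul bounded_linear.linear)

lemma smul_zero [simp]: "smul c 0 = 0"
  by (rule linear_0[OF linear_smul])

lemma smul_zero_left [simp]: "smul 0 x = 0"
  by (simp add: smul_def)

lemma smul_one [simp]: "smul 1 x = x"
  by (simp add: smul_def)

lemma smul_add_left: "smul (c + d) x = smul c x + smul d x"
  by (simp add: smul_def algebra_simps)

lemma smul_mult: "smul (c * d) x = smul c (smul d x)"
  by (simp add: smul_def algebra_simps linear_add[OF linear_J] linear_scale[OF linear_J] J_J)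

lemma smul_E: "A \<in> sets M \<Longrightarrow> smul c (E A x) = E A (smul c x)"
  by (simp add: smul_def J_E linear_add[OF linear_E] linear_scale[OF linear_E])

text \<open>\<open>J\<close> is isometric, and \<open>J x\<close> is orthogonal to \<open>x\<close>,
  so the cross terms vanish and \<open>smul c\<close> scales all norms by the modulus of
  \<open>c\<close>.\<close>

lemma norm_smul: "norm (smul c x) = cmod c * norm x"
proof -
  have "smul c x \<bullet> smul c x = (Re c)\<^sup>2 * (x \<bullet> x) + (Im c)\<^sup>2 * (x \<bullet> x)"
    by (simp add: smul_def inner_add_left inner_add_right J_inner J_J inner_J_self power2_eq_square
        inner_commute[of "J x" x])
  also have "\<dots> = (cmod c)\<^sup>2 * (norm x)\<^sup>2"
    by (simp add: cmod_power2 power2_norm_eq_inner distrib_right)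
  finally have "(norm (smul c x))\<^sup>2 = (cmod c * norm x)\<^sup>2"
    by (simp add: power2_norm_eq_inner[symmetric] power_mult_distrib)
  then show ?thesis by (rule power2_eq_imp_eq) auto
qed

lemma smul_inner: "smul c x \<bullet> y = x \<bullet> smul (cnj c) y"
  by (simp add: smul_def inner_add_left inner_add_right inner_diff_right J_inner)

definition scalar_measure :: "'v \<Rightarrow> 'a measure" where
  "scalar_measure x = measure_of (space M) (sets M) (\<lambda>A. ennreal (E A x \<bullet> x))"

lemma sets_scalar_measure [simp, measurable_cong]: "sets (scalar_measure x) = sets M"
  by (simp add: scalar_measure_def)

lemma space_scalar_measure [simp]: "space (scalar_measure x) = space M"
  by (simp add: scalar_measure_def)

text \<open>By symmetry and idempotence \<open>E A x \<bullet> x\<close> is a squared norm, so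
  \<open>ennreal\<close> cuts nothing off, and continuity of the inner product carries over
  countable additivity.\<close>

lemma emeasure_scalar_measure:
  assumes "A \<in> sets M"
  shows "emeasure (scalar_measure x) A = ennreal ((norm (E A x))\<^sup>2)"
proof -
  have "emeasure (scalar_measure x) A = ennreal (E A x \<bullet> x)"
  proof (rule emeasure_measure_of[OF scalar_measure_def])
    show "sets M \<subseteq> Pow (space M)" by (rule sets.space_closed)
    show "positive (sets (scalar_measure x)) (\<lambda>A. ennreal (E A x \<bullet> x))"
      by (simp add: positive_def)
    show "countably_additive (sets (scalar_measure x)) (\<lambda>A. ennreal (E A x \<bullet> x))"
      unfolding countably_additive_def
    proof (intro allI impI)
      fix B :: "nat \<Rightarrow> 'a set"
      assume B: "range B \<subseteq> sets (scalar_measure x)" "disjoint_family B"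
        and "(\<Union>i. B i) \<in> sets (scalar_measure x)"
      have "(\<lambda>i. E (B i) x \<bullet> x) sums (E (\<Union>i. B i) x \<bullet> x)"
        using B by (intro bounded_linear.sums[OF bounded_linear_inner_left] E_sums) auto
      then show "(\<Sum>i. ennreal (E (B i) x \<bullet> x)) = ennreal (E (\<Union>i. B i) x \<bullet> x)"
        using B E_inner_self[of "B i" x for i]
        by (intro suminf_ennreal_eq) (auto simp: E_inner_self subset_eq)
    qed
    show "A \<in> sets (scalar_measure x)" using assms by simp
  qed
  with assms show ?thesis by (simp add: E_inner_self)
qed

text \<open>The squared norm of \<open>f\<close> in L2 of the scalar measure of \<open>x\<close>.
  Being \<open>ennreal\<close>-valued, it is defined for all \<open>f\<close>, and membership of
  \<open>x\<close> in the domain is its finiteness.\<close>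

definition L2 :: "('a \<Rightarrow> complex) \<Rightarrow> 'v \<Rightarrow> ennreal" where
  "L2 f x = (\<integral>\<^sup>+\<omega>. ennreal ((cmod (f \<omega>))\<^sup>2) \<partial>scalar_measure x)"

text \<open>The cruder \<open>(a + b)^2 \<le> 2 a^2 + 2 b^2\<close> replaces the Minkowski
  inequality: the factor 2 harms neither finiteness nor convergence to zero, and no roots of
  extended reals arise.\<close>

lemma L2_add_le:
  assumes [measurable]: "f \<in> borel_measurable M" "g \<in> borel_measurable M"
  shows "L2 (\<lambda>\<omega>. f \<omega> + g \<omega>) x \<le> 2 * L2 f x + 2 * L2 g x"
proof -
  have le: "(cmod (a + b))\<^sup>2 \<le> 2 * (cmod a)\<^sup>2 + 2 * (cmod b)\<^sup>2" for a b
  proof -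
    have "(cmod (a + b))\<^sup>2 \<le> (cmod a + cmod b)\<^sup>2"
      by (intro power_mono norm_triangle_ineq norm_ge_zero)
    also have "\<dots> \<le> 2 * (cmod a)\<^sup>2 + 2 * (cmod b)\<^sup>2"
      using zero_le_power2[of "cmod a - cmod b"] by (simp add: power2_eq_square algebra_simps)
    finally show ?thesis .
  qed
  have "L2 (\<lambda>\<omega>. f \<omega> + g \<omega>) x \<le>
      (\<integral>\<^sup>+\<omega>. 2 * ennreal ((cmod (f \<omega>))\<^sup>2) + 2 * ennreal ((cmod (g \<omega>))\<^sup>2) \<partial>scalar_measure x)"
    unfolding L2_def
  proof (rule nn_integral_mono)
    fix \<omega>
    have "ennreal ((cmod (f \<omega> + g \<omega>))\<^sup>2) \<le> ennreal (2 * (cmod (f \<omega>))\<^sup>2 + 2 * (cmod (g \<omega>))\<^sup>2)"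
      by (intro ennreal_leI le)
    then show "ennreal ((cmod (f \<omega> + g \<omega>))\<^sup>2) \<le>
        2 * ennreal ((cmod (f \<omega>))\<^sup>2) + 2 * ennreal ((cmod (g \<omega>))\<^sup>2)"
      by (simp add: ennreal_plus ennreal_mult)
  qed
  also have "\<dots> = 2 * L2 f x + 2 * L2 g x"
    by (subst nn_integral_add) (simp_all add: nn_integral_cmult L2_def)
  finally show ?thesis .
qed

lemma L2_diff_commute: "L2 (\<lambda>\<omega>. f \<omega> - g \<omega>) x = L2 (\<lambda>\<omega>. g \<omega> - f \<omega>) x"
  by (simp add: L2_def norm_minus_commute)

lemma L2_mono:
  assumes "\<And>\<omega>. \<omega> \<in> space M \<Longrightarrow> cmod (f \<omega>) \<le> cmod (g \<omega>)"
  shows "L2 f x \<le> L2 g x"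
  unfolding L2_def using assms by (auto intro!: nn_integral_mono ennreal_leI power_mono)

lemma L2_cong_AE:
  assumes "AE \<omega> in scalar_measure x. f \<omega> = g \<omega>"
  shows "L2 f x = L2 g x"
  unfolding L2_def using assms by (intro nn_integral_cong_AE) auto

lemma L2_mult_le:
  assumes "g \<in> borel_measurable M" and "\<And>\<omega>. \<omega> \<in> space M \<Longrightarrow> cmod (f \<omega>) \<le> K"
  shows "L2 (\<lambda>\<omega>. f \<omega> * g \<omega>) x \<le> ennreal (K\<^sup>2) * L2 g x"
proof -
  note [measurable] = assms(1)
  have "L2 (\<lambda>\<omega>. f \<omega> * g \<omega>) x \<le> (\<integral>\<^sup>+\<omega>. ennreal (K\<^sup>2) * ennreal ((cmod (g \<omega>))\<^sup>2) \<partial>scalar_measure x)"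
    unfolding L2_def
  proof (rule nn_integral_mono)
    fix \<omega> assume "\<omega> \<in> space (scalar_measure x)"
    then have "(cmod (f \<omega> * g \<omega>))\<^sup>2 \<le> K\<^sup>2 * (cmod (g \<omega>))\<^sup>2"
      unfolding norm_mult power_mult_distrib
      using assms(2)[of \<omega>] by (intro mult_right_mono power_mono) auto
    then show "ennreal ((cmod (f \<omega> * g \<omega>))\<^sup>2) \<le> ennreal (K\<^sup>2) * ennreal ((cmod (g \<omega>))\<^sup>2)"
      by (simp add: ennreal_leI flip: ennreal_mult)
  qed
  also have "\<dots> = ennreal (K\<^sup>2) * L2 g x"
    unfolding L2_def by (rule nn_integral_cmult) simp
  finally show ?thesis .
qed

lemma L2_bounded:
  assumes "\<And>\<omega>. \<omega> \<in> space M \<Longrightarrow> cmod (f \<omega>) \<le> K"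
  shows "L2 f x \<le> ennreal (K\<^sup>2 * (norm x)\<^sup>2)"
proof -
  have "L2 f x \<le> ennreal (K\<^sup>2) * L2 (\<lambda>_. 1) x"
    using L2_mult_le[of "\<lambda>_. 1" f K x] assms by simp
  also have "L2 (\<lambda>_. 1) x = ennreal ((norm x)\<^sup>2)"
    by (simp add: L2_def emeasure_scalar_measure E_space)
  finally show ?thesis by (simp add: ennreal_mult)
qed

text \<open>A set annihilated by \<open>E\<close> is null for the scalar measures of all vectors at
  once.\<close>

lemma AE_scalar_measure:
  assumes "N \<in> sets M" "\<And>x. E N x = 0" "\<And>\<omega>. \<omega> \<in> space M \<Longrightarrow> \<omega> \<notin> N \<Longrightarrow> P \<omega>"
  shows "AE \<omega> in scalar_measure x. P \<omega>"
proof (rule AE_I')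
  show "N \<in> null_sets (scalar_measure x)"
    using assms by (simp add: null_sets_def emeasure_scalar_measure)
  show "{\<omega> \<in> space (scalar_measure x). \<not> P \<omega>} \<subseteq> N" using assms(3) by auto
qed


subsection \<open>Simple functions\<close>

definition simple_int :: "('a \<Rightarrow> complex) \<Rightarrow> 'v \<Rightarrow> 'v" where
  "simple_int F x = (\<Sum>c\<in>F ` space M. smul c (E (F -` {c} \<inter> space M) x))"

text \<open>Independence of the representation: \<open>F\<close> may be expanded over the level sets
  of any simple \<open>H\<close> through which it factors. With \<open>H\<close> a pair of simple
  functions this is the common refinement behind the rules for sums and products.\<close>

lemma simple_int_compose:
  assumes H: "simple_function M H" and F: "\<And>\<omega>. \<omega> \<in> space M \<Longrightarrow> F \<omega> = \<phi> (H \<omega>)"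
  shows "simple_int F x = (\<Sum>h\<in>H ` space M. smul (\<phi> h) (E (H -` {h} \<inter> space M) x))"
proof -
  have fin: "finite (H ` space M)" using H by (rule simple_functionD)
  have "F ` space M = \<phi> ` (H ` space M)" using F by (auto simp: image_iff)
  moreover have "smul c (E (F -` {c} \<inter> space M) x) =
      (\<Sum>h | h \<in> H ` space M \<and> \<phi> h = c. smul (\<phi> h) (E (H -` {h} \<inter> space M) x))" for c
  proof -
    have "F -` {c} \<inter> space M = (\<Union>h\<in>{h \<in> H ` space M. \<phi> h = c}. H -` {h} \<inter> space M)"
      using F by auto
    then have "E (F -` {c} \<inter> space M) x =
        (\<Sum>h | h \<in> H ` space M \<and> \<phi> h = c. E (H -` {h} \<inter> space M) x)"
      using fin simple_functionD(2)[OF H]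
      by (simp only:) (rule E_UN, auto simp: disjoint_family_on_def)
    then show ?thesis by (simp add: linear_sum[OF linear_smul])
  qed
  ultimately show ?thesis
    unfolding simple_int_def by (simp add: sum.image_gen[OF fin, of _ \<phi>])
qed

lemma bounded_linear_simple_int:
  assumes "simple_function M F"
  shows "bounded_linear (simple_int F)"
  unfolding simple_int_def[abs_def]
  using simple_functionD[OF assms]
  by (intro bounded_linear_sum bounded_linear_compose[OF bounded_linear_smul] bounded_linear_E)

lemma simple_int_add:
  assumes F: "simple_function M F" and G: "simple_function M G"
  shows "simple_int (\<lambda>\<omega>. F \<omega> + G \<omega>) x = simple_int F x + simple_int G x"
proof -
  have H: "simple_function M (\<lambda>\<omega>. (F \<omega>, G \<omega>))" using F G by simp
  show ?thesis
    unfolding simple_int_compose[OF H, of F fst, OF fst_conv[symmetric]]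
      simple_int_compose[OF H, of G snd, OF snd_conv[symmetric]]
    by (subst simple_int_compose[OF H, where \<phi> = "\<lambda>(a, b). a + b"])
       (auto simp: smul_add_left sum.distrib[symmetric] intro!: sum.cong)
qed

lemma simple_int_cmult:
  assumes F: "simple_function M F"
  shows "simple_int (\<lambda>\<omega>. c * F \<omega>) x = smul c (simple_int F x)"
  by (subst simple_int_compose[OF F, where \<phi> = "\<lambda>a. c * a"])
     (auto simp: smul_mult simple_int_def linear_sum[OF linear_smul])

text \<open>The projection of one level set annihilates the summands of all others, so on that piece
  the integral acts as a single complex scalar. This makes products of simple integrals multiply
  blockwise.\<close>

lemma E_level_simple_int:
  assumes H: "simple_function M H" and F: "\<And>\<omega>. \<omega> \<in> space M \<Longrightarrow> F \<omega> = \<phi> (H \<omega>)"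
    and h: "h \<in> H ` space M"
  shows "E (H -` {h} \<inter> space M) (simple_int F x) = smul (\<phi> h) (E (H -` {h} \<inter> space M) x)"
proof -
  note sets = simple_functionD(2)[OF H] and fin = simple_functionD(1)[OF H]
  have "E (H -` {h} \<inter> space M) (simple_int F x) =
      (\<Sum>k\<in>H ` space M. smul (\<phi> k) (E (H -` {h} \<inter> space M) (E (H -` {k} \<inter> space M) x)))"
    by (subst simple_int_compose[OF H, where \<phi> = \<phi>]) (simp_all add: linear_sum[OF linear_E[OF sets]] smul_E sets F)
  also have "\<dots> = (\<Sum>k\<in>H ` space M. if k = h then smul (\<phi> h) (E (H -` {h} \<inter> space M) x) else 0)"
  proof (intro sum.cong refl)
    fix k
    have "E (H -` {h} \<inter> space M) (E (H -` {k} \<inter> space M) x) = 0" if "k \<noteq> h"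
      using that sets by (intro E_disjoint) auto
    then show "smul (\<phi> k) (E (H -` {h} \<inter> space M) (E (H -` {k} \<inter> space M) x)) =
        (if k = h then smul (\<phi> h) (E (H -` {h} \<inter> space M) x) else 0)"
      using sets by (auto simp: E_idem)
  qed
  finally show ?thesis using fin h by simp
qed

lemma simple_int_mult:
  assumes F: "simple_function M F" and G: "simple_function M G"
  shows "simple_int F (simple_int G x) = simple_int (\<lambda>\<omega>. F \<omega> * G \<omega>) x"
proof -
  have H: "simple_function M (\<lambda>\<omega>. (F \<omega>, G \<omega>))" using F G by simp
  have "simple_int F (simple_int G x) = (\<Sum>h\<in>(\<lambda>\<omega>. (F \<omega>, G \<omega>)) ` space M.
      smul (fst h) (smul (snd h) (E ((\<lambda>\<omega>. (F \<omega>, G \<omega>)) -` {h} \<inter> space M) x)))"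
    unfolding simple_int_compose[OF H, of F fst, OF fst_conv[symmetric]]
    by (intro sum.cong refl arg_cong[where f = "smul _"] E_level_simple_int[OF H, of G snd]) auto
  also have "\<dots> = simple_int (\<lambda>\<omega>. F \<omega> * G \<omega>) x"
    by (subst simple_int_compose[OF H, where \<phi> = "\<lambda>(a, b). a * b"]) (auto simp: smul_mult intro!: sum.cong)
  finally show ?thesis .
qed

lemma simple_int_indicator:
  assumes A: "A \<in> sets M"
  shows "simple_int (indicator A) x = E A x"
proof -
  have level: "(\<lambda>\<omega>. \<omega> \<in> A) -` {b} \<inter> space M = (if b then A else space M - A)" for b
    using sets.sets_into_space[OF A] by auto
  have H: "simple_function M (\<lambda>\<omega>. \<omega> \<in> A)"
    unfolding simple_function_def level using A by auto
  have "simple_int (indicator A) x =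
      (\<Sum>b\<in>(\<lambda>\<omega>. \<omega> \<in> A) ` space M. smul (if b then 1 else 0) (E ((\<lambda>\<omega>. \<omega> \<in> A) -` {b} \<inter> space M) x))"
    by (rule simple_int_compose[OF H]) (simp add: indicator_def)
  also have "\<dots> = (\<Sum>b\<in>(\<lambda>\<omega>. \<omega> \<in> A) ` space M. if True = b then E A x else 0)"
    unfolding level by (intro sum.cong refl) auto
  also have "\<dots> = (if True \<in> (\<lambda>\<omega>. \<omega> \<in> A) ` space M then E A x else 0)"
    by (rule sum.delta') simp
  \<comment> \<open>For empty \<open>A\<close> the value \<open>True\<close> is not attained, but
    then \<open>E A x\<close> is zero as well; otherwise a point of \<open>A\<close> in
    \<open>space M\<close> attains it.\<close>
  also have "\<dots> = E A x"
    using sets.sets_into_space[OF A] by (cases "A = {}") auto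
  finally show ?thesis .
qed

lemma simple_int_inner:
  assumes F: "simple_function M F"
  shows "simple_int F x \<bullet> y = x \<bullet> simple_int (\<lambda>\<omega>. cnj (F \<omega>)) y"
proof -
  note sets = simple_functionD(2)[OF F]
  have "simple_int (\<lambda>\<omega>. cnj (F \<omega>)) y =
      (\<Sum>c\<in>F ` space M. smul (cnj c) (E (F -` {c} \<inter> space M) y))"
    by (rule simple_int_compose[OF F]) simp
  then show ?thesis
    using sets
    by (simp add: simple_int_def inner_sum_left inner_sum_right smul_inner E_inner smul_E)
qed

text \<open>The pieces belonging to different values of \<open>F\<close> are orthogonal, so the
  Pythagorean identity turns the norm of their sum into the integral of the simple function
  \<open>|F|^2\<close>.\<close>

lemma L2_simple:
  assumes F: "simple_function M F"
  shows "L2 F x = ennreal ((norm (simple_int F x))\<^sup>2)"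
proof -
  note sets = simple_functionD(2)[OF F] and fin = simple_functionD(1)[OF F]
  have F': "simple_function (scalar_measure x) F"
    using F by (subst simple_function_cong_algebra[where M = "scalar_measure x" and N = M]) auto
  have level: "{\<omega> \<in> space M. F \<omega> = c} = F -` {c} \<inter> space M" for c by auto
  have "L2 F x = integral\<^sup>S (scalar_measure x) (\<lambda>\<omega>. ennreal ((cmod (F \<omega>))\<^sup>2))"
    unfolding L2_def by (intro nn_integral_eq_simple_integral simple_function_compose1[OF F'])
  also have "\<dots> = (\<Sum>c\<in>F ` space M. ennreal ((cmod c)\<^sup>2) *
      emeasure (scalar_measure x) {\<omega> \<in> space M. F \<omega> = c})"
    using simple_function_partition[OF simple_function_compose1[OF F'] F', of
        "\<lambda>c. ennreal ((cmod c)\<^sup>2)" "\<lambda>c. ennreal ((cmod c)\<^sup>2)"] by simp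
  also have "\<dots> = (\<Sum>c\<in>F ` space M. ennreal ((norm (smul c (E (F -` {c} \<inter> space M) x)))\<^sup>2))"
    unfolding level using sets
    by (simp add: emeasure_scalar_measure norm_smul power_mult_distrib ennreal_mult)
  also have "\<dots> = ennreal (\<Sum>c\<in>F ` space M. (norm (smul c (E (F -` {c} \<inter> space M) x)))\<^sup>2)"
    by (rule sum_ennreal) simp
  also have "(\<Sum>c\<in>F ` space M. (norm (smul c (E (F -` {c} \<inter> space M) x)))\<^sup>2) =
      (norm (simple_int F x))\<^sup>2"
    unfolding simple_int_def
  proof (rule norm_sum_Pythagorean[OF fin, symmetric], rule pairwiseI)
    fix c d :: complex assume "c \<noteq> d"
    then have "E (F -` {c} \<inter> space M) (E (F -` {d} \<inter> space M) y) = 0" for y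
      using sets by (intro E_disjoint) auto
    then show "orthogonal (smul c (E (F -` {c} \<inter> space M) x)) (smul d (E (F -` {d} \<inter> space M) x))"
      unfolding orthogonal_def using sets by (simp add: smul_E E_inner)
  qed
  finally show ?thesis .
qed

lemma simple_int_commute:
  assumes F: "simple_function M F" and L: "bounded_linear L"
    and LE: "\<And>A x. A \<in> sets M \<Longrightarrow> L (E A x) = E A (L x)" and LJ: "\<And>x. L (J x) = J (L x)"
  shows "simple_int F (L x) = L (simple_int F x)"
proof -
  interpret L: bounded_linear L by (rule L)
  have "L (smul c x) = smul c (L x)" for c x
    by (simp add: smul_def L.add L.scale LJ)
  then show ?thesis
    using simple_functionD(2)[OF F] by (simp add: simple_int_def L.sum LE)
qed


subsection \<open>The integral of a measurable function at a vector of its domain\<close>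

definition dom_int :: "('a \<Rightarrow> complex) \<Rightarrow> 'v set" where
  "dom_int f = {x. L2 f x < \<infinity>}"

text \<open>The sequence depends on \<open>f\<close> alone and not on the vector, so linearity in
  the vector passes termwise to the limit. The factor 2 in the domination is the source of the
  constants 4 and 9 in the majorants below.\<close>

definition approx :: "('a \<Rightarrow> complex) \<Rightarrow> nat \<Rightarrow> 'a \<Rightarrow> complex" where
  "approx f = (SOME F. (\<forall>i. simple_function M (F i)) \<and>
    (\<forall>\<omega>\<in>space M. (\<lambda>i. F i \<omega>) \<longlonglongrightarrow> f \<omega>) \<and>
    (\<forall>i. \<forall>\<omega>\<in>space M. dist (F i \<omega>) 0 \<le> 2 * dist (f \<omega>) 0))"

text \<open>Meaningful for \<open>x \<in> dom_int f\<close> only: elsewhere the sequence need not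
  converge and \<open>lim\<close> is an arbitrary default.\<close>

definition integ :: "('a \<Rightarrow> complex) \<Rightarrow> 'v \<Rightarrow> 'v" where
  "integ f x = lim (\<lambda>j. simple_int (approx f j) x)"

lemma approx:
  assumes "f \<in> borel_measurable M"
  shows "simple_function M (approx f i)"
    and "\<omega> \<in> space M \<Longrightarrow> (\<lambda>i. approx f i \<omega>) \<longlonglongrightarrow> f \<omega>"
    and "\<omega> \<in> space M \<Longrightarrow> cmod (approx f i \<omega>) \<le> 2 * cmod (f \<omega>)"
  using someI_ex[OF borel_measurable_implies_sequence_metric[OF assms, of 0]]
  unfolding approx_def[symmetric] by auto

lemma L2_dominated_convergence:
  assumes [measurable]: "\<And>j. F j \<in> borel_measurable M" "f \<in> borel_measurable M"
    and lim: "\<And>\<omega>. \<omega> \<in> space M \<Longrightarrow> (\<lambda>j. F j \<omega>) \<longlonglongrightarrow> f \<omega>"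
    and bound: "\<And>j \<omega>. \<omega> \<in> space M \<Longrightarrow> cmod (F j \<omega>) \<le> 2 * cmod (f \<omega>)"
    and x: "x \<in> dom_int f"
  shows "(\<lambda>j. L2 (\<lambda>\<omega>. F j \<omega> - f \<omega>) x) \<longlonglongrightarrow> 0"
proof -
  have "(\<lambda>j. L2 (\<lambda>\<omega>. F j \<omega> - f \<omega>) x) \<longlonglongrightarrow> (\<integral>\<^sup>+\<omega>. 0 \<partial>scalar_measure x)"
    unfolding L2_def
  proof (rule nn_integral_dominated_convergence[where w = "\<lambda>\<omega>. 9 * ennreal ((cmod (f \<omega>))\<^sup>2)"])
    show "(\<integral>\<^sup>+\<omega>. 9 * ennreal ((cmod (f \<omega>))\<^sup>2) \<partial>scalar_measure x) < \<infinity>"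
      using x by (subst nn_integral_cmult) (auto simp: dom_int_def L2_def ennreal_mult_less_top)
    show "AE \<omega> in scalar_measure x. ennreal ((cmod (F j \<omega> - f \<omega>))\<^sup>2) \<le> 9 * ennreal ((cmod (f \<omega>))\<^sup>2)"
      for j
    proof (rule AE_I2)
      fix \<omega> assume "\<omega> \<in> space (scalar_measure x)"
      \<comment> \<open>\<open>2 * cmod (f \<omega>)\<close> for the approximant plus
        \<open>cmod (f \<omega>)\<close> for \<open>f\<close> itself gives the factor 3, whose
        square is the constant 9 of the majorant.\<close>
      then have "cmod (F j \<omega> - f \<omega>) \<le> 3 * cmod (f \<omega>)"
        using bound[of \<omega> j] norm_triangle_ineq4[of "F j \<omega>" "f \<omega>"] by simp
      then have "(cmod (F j \<omega> - f \<omega>))\<^sup>2 \<le> (3 * cmod (f \<omega>))\<^sup>2"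
        by (rule power_mono) simp
      then have "ennreal ((cmod (F j \<omega> - f \<omega>))\<^sup>2) \<le> ennreal (9 * (cmod (f \<omega>))\<^sup>2)"
        by (intro ennreal_leI) (simp add: power_mult_distrib)
      then show "ennreal ((cmod (F j \<omega> - f \<omega>))\<^sup>2) \<le> 9 * ennreal ((cmod (f \<omega>))\<^sup>2)"
        by (simp add: ennreal_mult)
    qed
    show "AE \<omega> in scalar_measure x. (\<lambda>j. ennreal ((cmod (F j \<omega> - f \<omega>))\<^sup>2)) \<longlonglongrightarrow> 0"
    proof (rule AE_I2)
      fix \<omega> assume "\<omega> \<in> space (scalar_measure x)"
      then have "(\<lambda>j. (cmod (F j \<omega> - f \<omega>))\<^sup>2) \<longlonglongrightarrow> (cmod (f \<omega> - f \<omega>))\<^sup>2"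
        by (intro tendsto_intros lim) simp
      then show "(\<lambda>j. ennreal ((cmod (F j \<omega> - f \<omega>))\<^sup>2)) \<longlonglongrightarrow> 0"
        by (simp add: ennreal_tendsto_0_iff)
    qed
  qed auto
  then show ?thesis by simp
qed

lemma simple_int_diff:
  assumes F: "simple_function M F" and G: "simple_function M G"
  shows "simple_int (\<lambda>\<omega>. F \<omega> - G \<omega>) x = simple_int F x - simple_int G x"
proof -
  have "simple_function M (\<lambda>\<omega>. F \<omega> - G \<omega>)" using F G by (rule simple_function_diff)
  from simple_int_add[OF this G, of x] show ?thesis by simp
qed

text \<open>By the isometry for simple functions the left side is the squared L2 distance of
  \<open>F\<close> and \<open>G\<close>, which is then compared through \<open>f\<close>. The same
  estimate yields the Cauchy property and the independence of the limit from the approximating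
  sequence.\<close>

lemma norm_simple_int_diff_le:
  assumes F: "simple_function M F" and G: "simple_function M G" and f: "f \<in> borel_measurable M"
  shows "ennreal ((norm (simple_int F x - simple_int G x))\<^sup>2) \<le>
    2 * L2 (\<lambda>\<omega>. F \<omega> - f \<omega>) x + 2 * L2 (\<lambda>\<omega>. G \<omega> - f \<omega>) x"
proof -
  note [measurable] = borel_measurable_simple_function[OF F] borel_measurable_simple_function[OF G] f
  have "ennreal ((norm (simple_int F x - simple_int G x))\<^sup>2) =
      L2 (\<lambda>\<omega>. (F \<omega> - f \<omega>) + (f \<omega> - G \<omega>)) x"
    using F G by (simp add: L2_simple simple_function_diff simple_int_diff)
  also have "\<dots> \<le> 2 * L2 (\<lambda>\<omega>. F \<omega> - f \<omega>) x + 2 * L2 (\<lambda>\<omega>. f \<omega> - G \<omega>) x"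
    by (rule L2_add_le) simp_all
  finally show ?thesis unfolding L2_diff_commute[of f G] .
qed

lemma approx_integ:
  assumes f: "f \<in> borel_measurable M" and x: "x \<in> dom_int f"
  shows "(\<lambda>j. L2 (\<lambda>\<omega>. approx f j \<omega> - f \<omega>) x) \<longlonglongrightarrow> 0"
    and "(\<lambda>j. simple_int (approx f j) x) \<longlonglongrightarrow> integ f x"
proof -
  note F = approx[OF f]
  show lim: "(\<lambda>j. L2 (\<lambda>\<omega>. approx f j \<omega> - f \<omega>) x) \<longlonglongrightarrow> 0"
    by (rule L2_dominated_convergence[OF borel_measurable_simple_function[OF F(1)] f F(2,3) x])
  have "Cauchy (\<lambda>j. simple_int (approx f j) x)"
  proof (rule metric_CauchyI)
    fix e :: real assume "e > 0"
    \<comment> \<open>Both L2 distances enter the estimate with a factor 2, so a quarter of the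
      square of \<open>e\<close> for each adds up to that square.\<close>
    then have "ennreal (e\<^sup>2 / 4) > 0" by simp
    with lim have "\<forall>\<^sub>F j in sequentially. L2 (\<lambda>\<omega>. approx f j \<omega> - f \<omega>) x < ennreal (e\<^sup>2 / 4)"
      by (rule order_tendstoD)
    then obtain k where k: "\<And>j. j \<ge> k \<Longrightarrow> L2 (\<lambda>\<omega>. approx f j \<omega> - f \<omega>) x < ennreal (e\<^sup>2 / 4)"
      by (auto simp: eventually_sequentially)
    have "dist (simple_int (approx f i) x) (simple_int (approx f j) x) < e" if "i \<ge> k" "j \<ge> k" for i j
    proof -
      have dbl: "2 * a < ennreal (e\<^sup>2 / 2)" if "a < ennreal (e\<^sup>2 / 4)" for a
      proof -
        have "2 * a < 2 * ennreal (e\<^sup>2 / 4)"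
          using that by (intro ennreal_mult_strict_left_mono) auto
        also have "2 * ennreal (e\<^sup>2 / 4) = ennreal (2 * (e\<^sup>2 / 4))"
          by (subst ennreal_mult) simp_all
        finally show ?thesis by simp
      qed
      have "ennreal ((norm (simple_int (approx f i) x - simple_int (approx f j) x))\<^sup>2) \<le>
          2 * L2 (\<lambda>\<omega>. approx f i \<omega> - f \<omega>) x + 2 * L2 (\<lambda>\<omega>. approx f j \<omega> - f \<omega>) x"
        by (rule norm_simple_int_diff_le[OF F(1) F(1) f])
      also have "\<dots> < ennreal (e\<^sup>2 / 2) + ennreal (e\<^sup>2 / 2)"
        by (intro add_strict_mono dbl k that)
      also have "\<dots> = ennreal (e\<^sup>2)"
        by (subst ennreal_plus[symmetric]) simp_all
      finally have "(norm (simple_int (approx f i) x - simple_int (approx f j) x))\<^sup>2 < e\<^sup>2"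
        by (simp add: ennreal_less_iff)
      then show ?thesis
        using \<open>e > 0\<close> by (simp add: dist_norm power_less_imp_less_base)
    qed
    then show "\<exists>k. \<forall>i\<ge>k. \<forall>j\<ge>k. dist (simple_int (approx f i) x) (simple_int (approx f j) x) < e"
      by blast
  qed
  \<comment> \<open>Completeness of the space enters here.\<close>
  then show "(\<lambda>j. simple_int (approx f j) x) \<longlonglongrightarrow> integ f x"
    unfolding integ_def by (simp add: Cauchy_convergent_iff convergent_LIMSEQ_iff)
qed

text \<open>Any simple functions converging to \<open>f\<close> in L2 of the scalar measure of
  \<open>x\<close> compute the integral. The algebraic rules below are proved by exhibiting a
  convenient sequence, such as the sum of two approximations.\<close>

lemma simple_int_tendsto_integ:
  assumes f: "f \<in> borel_measurable M" and x: "x \<in> dom_int f"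
    and F: "\<And>j. simple_function M (F j)" and lim: "(\<lambda>j. L2 (\<lambda>\<omega>. F j \<omega> - f \<omega>) x) \<longlonglongrightarrow> 0"
  shows "(\<lambda>j. simple_int (F j) x) \<longlonglongrightarrow> integ f x"
proof -
  have "(\<lambda>j. 2 * L2 (\<lambda>\<omega>. F j \<omega> - f \<omega>) x + 2 * L2 (\<lambda>\<omega>. approx f j \<omega> - f \<omega>) x) \<longlonglongrightarrow> 2 * 0 + 2 * 0"
    by (intro tendsto_add ennreal_tendsto_cmult lim approx_integ(1) f x) simp_all
  then have "(\<lambda>j. simple_int (F j) x - simple_int (approx f j) x) \<longlonglongrightarrow> 0"
    using norm_simple_int_diff_le[OF F approx(1)[OF f] f]
    by (intro tendsto_zero_of_ennreal_square_le) auto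
  from tendsto_add[OF this approx_integ(2)[OF f x]] show ?thesis by simp
qed

lemma simple_dom_int:
  assumes "simple_function M F"
  shows "x \<in> dom_int F"
  using assms by (simp add: dom_int_def L2_simple)

lemma integ_simple:
  assumes F: "simple_function M F"
  shows "integ F x = simple_int F x"
proof -
  have "L2 (\<lambda>\<omega>. F \<omega> - F \<omega>) x = 0" by (simp add: L2_def)
  then have "(\<lambda>j::nat. simple_int F x) \<longlonglongrightarrow> integ F x"
    by (intro simple_int_tendsto_integ simple_dom_int F borel_measurable_simple_function)
       (simp only: tendsto_const)
  then show ?thesis by (simp add: LIMSEQ_const_iff)
qed

text \<open>Both sides are limits of the identity for simple functions: the left by dominated
  convergence with majorant \<open>4 |f|^2\<close>, the right by continuity of the norm.\<close>

lemma L2_integ: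
  assumes f: "f \<in> borel_measurable M" and x: "x \<in> dom_int f"
  shows "L2 f x = ennreal ((norm (integ f x))\<^sup>2)"
proof -
  note F = approx[OF f] and [measurable] = f borel_measurable_simple_function[OF approx(1)[OF f]]
  have "(\<lambda>j. L2 (approx f j) x) \<longlonglongrightarrow> L2 f x"
    unfolding L2_def
  proof (rule nn_integral_dominated_convergence[where w = "\<lambda>\<omega>. 4 * ennreal ((cmod (f \<omega>))\<^sup>2)"])
    show "(\<integral>\<^sup>+\<omega>. 4 * ennreal ((cmod (f \<omega>))\<^sup>2) \<partial>scalar_measure x) < \<infinity>"
      using x by (subst nn_integral_cmult) (auto simp: dom_int_def L2_def ennreal_mult_less_top)
    show "AE \<omega> in scalar_measure x. ennreal ((cmod (approx f j \<omega>))\<^sup>2) \<le> 4 * ennreal ((cmod (f \<omega>))\<^sup>2)"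
      for j
    proof (rule AE_I2)
      fix \<omega> assume "\<omega> \<in> space (scalar_measure x)"
      then have "(cmod (approx f j \<omega>))\<^sup>2 \<le> (2 * cmod (f \<omega>))\<^sup>2"
        using F(3)[of \<omega> j] by (intro power_mono) auto
      then have "ennreal ((cmod (approx f j \<omega>))\<^sup>2) \<le> ennreal (4 * (cmod (f \<omega>))\<^sup>2)"
        by (intro ennreal_leI) (simp add: power_mult_distrib)
      then show "ennreal ((cmod (approx f j \<omega>))\<^sup>2) \<le> 4 * ennreal ((cmod (f \<omega>))\<^sup>2)"
        by (simp add: ennreal_mult)
    qed
    show "AE \<omega> in scalar_measure x.
        (\<lambda>j. ennreal ((cmod (approx f j \<omega>))\<^sup>2)) \<longlonglongrightarrow> ennreal ((cmod (f \<omega>))\<^sup>2)"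
      by (rule AE_I2) (intro tendsto_ennrealI tendsto_intros F(2), simp)
  qed auto
  moreover have "(\<lambda>j. L2 (approx f j) x) \<longlonglongrightarrow> ennreal ((norm (integ f x))\<^sup>2)"
    unfolding L2_simple[OF F(1)] by (intro tendsto_ennrealI tendsto_intros approx_integ f x)
  ultimately show ?thesis by (rule LIMSEQ_unique)
qed

lemma dom_int_add:
  assumes "f \<in> borel_measurable M" "g \<in> borel_measurable M" "x \<in> dom_int f" "x \<in> dom_int g"
  shows "x \<in> dom_int (\<lambda>\<omega>. f \<omega> + g \<omega>)"
proof -
  have "2 * L2 f x + 2 * L2 g x < \<infinity>"
    using assms by (simp add: dom_int_def ennreal_mult_less_top)
  with L2_add_le[OF assms(1,2), of x] show ?thesis
    unfolding dom_int_def by (simp add: le_less_trans)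
qed

lemma dom_int_mult:
  assumes "f \<in> borel_measurable M" "x \<in> dom_int f" "\<And>\<omega>. \<omega> \<in> space M \<Longrightarrow> cmod (h \<omega>) \<le> K"
  shows "x \<in> dom_int (\<lambda>\<omega>. h \<omega> * f \<omega>)"
proof -
  have "ennreal (K\<^sup>2) * L2 f x < top"
    using assms(2) by (simp add: dom_int_def ennreal_mult_less_top)
  with L2_mult_le[of f h K x, OF assms(1,3)] show ?thesis
    unfolding dom_int_def by (simp add: le_less_trans)
qed

lemma dom_int_mono:
  assumes "x \<in> dom_int g" "\<And>\<omega>. \<omega> \<in> space M \<Longrightarrow> cmod (f \<omega>) \<le> cmod (g \<omega>)"
  shows "x \<in> dom_int f"
  using assms L2_mono[of f g x] by (auto simp: dom_int_def)

lemma dom_int_bounded: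
  assumes "\<And>\<omega>. \<omega> \<in> space M \<Longrightarrow> cmod (f \<omega>) \<le> K"
  shows "x \<in> dom_int f"
  using L2_bounded[of f K x, OF assms] unfolding dom_int_def
  by (simp add: le_less_trans)

lemma integ_add:
  assumes f: "f \<in> borel_measurable M" "x \<in> dom_int f" and g: "g \<in> borel_measurable M" "x \<in> dom_int g"
  shows "integ (\<lambda>\<omega>. f \<omega> + g \<omega>) x = integ f x + integ g x"
proof -
  let ?F = "\<lambda>j \<omega>. approx f j \<omega> + approx g j \<omega>"
  note F = approx[OF f(1)] and G = approx[OF g(1)]
  note [measurable] = f(1) g(1) borel_measurable_simple_function[OF F(1)]
    borel_measurable_simple_function[OF G(1)]
  have "(\<lambda>j. simple_int (?F j) x) \<longlonglongrightarrow> integ (\<lambda>\<omega>. f \<omega> + g \<omega>) x"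
  proof (rule simple_int_tendsto_integ)
    show "x \<in> dom_int (\<lambda>\<omega>. f \<omega> + g \<omega>)" using f g by (intro dom_int_add)
    show "simple_function M (?F j)" for j using F(1) G(1) by (intro simple_function_add)
    have le: "L2 (\<lambda>\<omega>. ?F j \<omega> - (f \<omega> + g \<omega>)) x \<le>
        2 * L2 (\<lambda>\<omega>. approx f j \<omega> - f \<omega>) x + 2 * L2 (\<lambda>\<omega>. approx g j \<omega> - g \<omega>) x" for j
      using L2_add_le[of "\<lambda>\<omega>. approx f j \<omega> - f \<omega>" "\<lambda>\<omega>. approx g j \<omega> - g \<omega>" x]
      by (simp add: algebra_simps)
    have "(\<lambda>j. 2 * L2 (\<lambda>\<omega>. approx f j \<omega> - f \<omega>) x + 2 * L2 (\<lambda>\<omega>. approx g j \<omega> - g \<omega>) x) \<longlonglongrightarrow> 2 * 0 + 2 * 0"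
      using f g by (intro tendsto_add ennreal_tendsto_cmult approx_integ(1)) simp_all
    then show "(\<lambda>j. L2 (\<lambda>\<omega>. ?F j \<omega> - (f \<omega> + g \<omega>)) x) \<longlonglongrightarrow> 0"
      by (intro tendsto_zero_of_ennreal_le[OF _ le]) simp
  qed simp
  moreover have "(\<lambda>j. simple_int (?F j) x) \<longlonglongrightarrow> integ f x + integ g x"
    unfolding simple_int_add[OF F(1) G(1)] using f g by (intro tendsto_add approx_integ(2))
  ultimately show ?thesis by (rule LIMSEQ_unique)
qed

lemma integ_cmult:
  assumes f: "f \<in> borel_measurable M" "x \<in> dom_int f"
  shows "integ (\<lambda>\<omega>. c * f \<omega>) x = smul c (integ f x)"
proof -
  note F = approx[OF f(1)] and [measurable] = f(1) borel_measurable_simple_function[OF approx(1)[OF f(1)]]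
  have "(\<lambda>j. simple_int (\<lambda>\<omega>. c * approx f j \<omega>) x) \<longlonglongrightarrow> integ (\<lambda>\<omega>. c * f \<omega>) x"
  proof (rule simple_int_tendsto_integ)
    show "x \<in> dom_int (\<lambda>\<omega>. c * f \<omega>)" using f by (rule dom_int_mult[where K = "cmod c"]) simp
    show "simple_function M (\<lambda>\<omega>. c * approx f j \<omega>)" for j
      using F(1) by (intro simple_function_mult) simp_all
    have "L2 (\<lambda>\<omega>. c * (approx f j \<omega> - f \<omega>)) x \<le> ennreal ((cmod c)\<^sup>2) * L2 (\<lambda>\<omega>. approx f j \<omega> - f \<omega>) x"
      for j by (rule L2_mult_le) simp_all
    then have le: "L2 (\<lambda>\<omega>. c * approx f j \<omega> - c * f \<omega>) x \<le>
        ennreal ((cmod c)\<^sup>2) * L2 (\<lambda>\<omega>. approx f j \<omega> - f \<omega>) x" for j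
      by (simp add: right_diff_distrib)
    have "(\<lambda>j. ennreal ((cmod c)\<^sup>2) * L2 (\<lambda>\<omega>. approx f j \<omega> - f \<omega>) x) \<longlonglongrightarrow> ennreal ((cmod c)\<^sup>2) * 0"
      using f by (intro ennreal_tendsto_cmult approx_integ(1)) simp_all
    then show "(\<lambda>j. L2 (\<lambda>\<omega>. c * approx f j \<omega> - c * f \<omega>) x) \<longlonglongrightarrow> 0"
      by (intro tendsto_zero_of_ennreal_le[OF _ le]) simp
  qed simp
  moreover have "(\<lambda>j. simple_int (\<lambda>\<omega>. c * approx f j \<omega>) x) \<longlonglongrightarrow> smul c (integ f x)"
    unfolding simple_int_cmult[OF F(1)]
    by (intro bounded_linear.tendsto[OF bounded_linear_smul] approx_integ(2) f)
  ultimately show ?thesis by (rule LIMSEQ_unique)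
qed

lemma integ_diff:
  assumes f: "f \<in> borel_measurable M" "x \<in> dom_int f" and g: "g \<in> borel_measurable M" "x \<in> dom_int g"
  shows "x \<in> dom_int (\<lambda>\<omega>. f \<omega> - g \<omega>)"
    and "integ (\<lambda>\<omega>. f \<omega> - g \<omega>) x = integ f x - integ g x"
proof -
  note [measurable] = f(1) g(1)
  have m: "x \<in> dom_int (\<lambda>\<omega>. - 1 * g \<omega>)"
    using g by (rule dom_int_mult[where K = 1]) simp
  have "x \<in> dom_int (\<lambda>\<omega>. f \<omega> + - 1 * g \<omega>)"
    by (rule dom_int_add[OF f(1) _ f(2) m]) simp
  then show "x \<in> dom_int (\<lambda>\<omega>. f \<omega> - g \<omega>)" by simp
  have "integ (\<lambda>\<omega>. f \<omega> + - 1 * g \<omega>) x = integ f x + smul (- 1) (integ g x)"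
    unfolding integ_cmult[OF g, symmetric] by (rule integ_add[OF f _ m]) simp
  then show "integ (\<lambda>\<omega>. f \<omega> - g \<omega>) x = integ f x - integ g x"
    by (simp add: smul_def)
qed

text \<open>Norm distances of integrals are L2 distances of integrands; almost-everywhere equality
  and convergence of functions become statements about vectors through this identity.\<close>

lemma L2_diff:
  assumes "f \<in> borel_measurable M" "x \<in> dom_int f" "g \<in> borel_measurable M" "x \<in> dom_int g"
  shows "L2 (\<lambda>\<omega>. f \<omega> - g \<omega>) x = ennreal ((norm (integ f x - integ g x))\<^sup>2)"
  using assms by (simp add: L2_integ integ_diff)

lemma integ_cong_AE:
  assumes "f \<in> borel_measurable M" "g \<in> borel_measurable M" "x \<in> dom_int f"
    and "AE \<omega> in scalar_measure x. f \<omega> = g \<omega>"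
  shows "x \<in> dom_int g" "integ f x = integ g x"
proof -
  show g: "x \<in> dom_int g"
    using L2_cong_AE[OF assms(4)] assms(3) by (simp add: dom_int_def)
  have "L2 (\<lambda>\<omega>. f \<omega> - g \<omega>) x = L2 (\<lambda>_. 0) x"
    using assms(4) by (intro L2_cong_AE) auto
  then have "ennreal ((norm (integ f x - integ g x))\<^sup>2) = 0"
    using L2_diff[OF assms(1,3,2) g] by (simp add: L2_def)
  then show "integ f x = integ g x" by simp
qed

lemma integ_cong:
  assumes "f \<in> borel_measurable M" "x \<in> dom_int f" "\<And>\<omega>. \<omega> \<in> space M \<Longrightarrow> g \<omega> = f \<omega>"
  shows "integ g x = integ f x"
proof -
  have "g \<in> borel_measurable M" using assms(1,3) measurable_cong by blast
  then show ?thesis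
    using assms by (intro integ_cong_AE(2)[symmetric] AE_I2) auto
qed

lemma integ_tendsto:
  assumes f: "f \<in> borel_measurable M" "x \<in> dom_int f"
    and F: "\<And>j. F j \<in> borel_measurable M" "\<And>j. x \<in> dom_int (F j)"
    and lim: "(\<lambda>j. L2 (\<lambda>\<omega>. F j \<omega> - f \<omega>) x) \<longlonglongrightarrow> 0"
  shows "(\<lambda>j. integ (F j) x) \<longlonglongrightarrow> integ f x"
proof -
  have "(\<lambda>j. integ (F j) x - integ f x) \<longlonglongrightarrow> 0"
    using lim by (rule tendsto_zero_of_ennreal_square_le) (simp add: L2_diff[OF F f])
  then show ?thesis by (rule LIM_zero_cancel)
qed

text \<open>The factor 2 admits the sequence \<open>approx f\<close> as well as truncations by
  indicators.\<close>

lemma integ_dominated_convergence: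
  assumes f: "f \<in> borel_measurable M" "x \<in> dom_int f"
    and F: "\<And>j. F j \<in> borel_measurable M"
    and lim: "\<And>\<omega>. \<omega> \<in> space M \<Longrightarrow> (\<lambda>j. F j \<omega>) \<longlonglongrightarrow> f \<omega>"
    and bound: "\<And>j \<omega>. \<omega> \<in> space M \<Longrightarrow> cmod (F j \<omega>) \<le> 2 * cmod (f \<omega>)"
  shows "(\<lambda>j. integ (F j) x) \<longlonglongrightarrow> integ f x"
proof (rule integ_tendsto[OF f F])
  show "x \<in> dom_int (F j)" for j
    using dom_int_mult[OF f, of "\<lambda>_. 2" 2] by (rule dom_int_mono) (auto simp: norm_mult bound)
  show "(\<lambda>j. L2 (\<lambda>\<omega>. F j \<omega> - f \<omega>) x) \<longlonglongrightarrow> 0"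
    by (rule L2_dominated_convergence[OF F f(1) lim bound f(2)])
qed

subsection \<open>Multiplicativity\<close>

lemma simple_bounded:
  assumes "simple_function M F"
  shows "\<exists>K. \<forall>\<omega>\<in>space M. cmod (F \<omega>) \<le> K"
proof -
  have "finite ((\<lambda>\<omega>. cmod (F \<omega>)) ` space M)"
    using simple_functionD(1)[OF simple_function_compose1[OF assms, of cmod]] .
  then show ?thesis by (intro exI[of _ "Max ((\<lambda>\<omega>. cmod (F \<omega>)) ` space M)"]) simp
qed

text \<open>A simple \<open>F\<close> is bounded, so multiplication by \<open>F\<close> is
  continuous in L2 and the identity extends from the approximants of \<open>f\<close>. For an
  indicator it says that \<open>E A\<close> truncates the integrand to \<open>A\<close>.\<close>

lemma simple_int_integ:
  assumes F: "simple_function M F" and f: "f \<in> borel_measurable M" "x \<in> dom_int f"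
  shows "simple_int F (integ f x) = integ (\<lambda>\<omega>. F \<omega> * f \<omega>) x"
proof -
  obtain K where K: "\<And>\<omega>. \<omega> \<in> space M \<Longrightarrow> cmod (F \<omega>) \<le> K"
    using simple_bounded[OF F] by blast
  note G = approx[OF f(1)]
  note [measurable] = f(1) borel_measurable_simple_function[OF F] borel_measurable_simple_function[OF G(1)]
  have "(\<lambda>j. simple_int (\<lambda>\<omega>. F \<omega> * approx f j \<omega>) x) \<longlonglongrightarrow> integ (\<lambda>\<omega>. F \<omega> * f \<omega>) x"
  proof (rule simple_int_tendsto_integ)
    show "x \<in> dom_int (\<lambda>\<omega>. F \<omega> * f \<omega>)" by (rule dom_int_mult[OF f K])
    show "simple_function M (\<lambda>\<omega>. F \<omega> * approx f j \<omega>)" for j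
      using F G(1) by (intro simple_function_mult)
    have "L2 (\<lambda>\<omega>. F \<omega> * (approx f j \<omega> - f \<omega>)) x \<le> ennreal (K\<^sup>2) * L2 (\<lambda>\<omega>. approx f j \<omega> - f \<omega>) x"
      for j by (rule L2_mult_le) (simp_all add: K)
    then have le: "L2 (\<lambda>\<omega>. F \<omega> * approx f j \<omega> - F \<omega> * f \<omega>) x \<le>
        ennreal (K\<^sup>2) * L2 (\<lambda>\<omega>. approx f j \<omega> - f \<omega>) x" for j
      by (simp add: right_diff_distrib)
    have "(\<lambda>j. ennreal (K\<^sup>2) * L2 (\<lambda>\<omega>. approx f j \<omega> - f \<omega>) x) \<longlonglongrightarrow> ennreal (K\<^sup>2) * 0"
      using f by (intro ennreal_tendsto_cmult approx_integ(1)) simp_all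
    then show "(\<lambda>j. L2 (\<lambda>\<omega>. F \<omega> * approx f j \<omega> - F \<omega> * f \<omega>) x) \<longlonglongrightarrow> 0"
      by (intro tendsto_zero_of_ennreal_le[OF _ le]) simp
  qed simp
  moreover have "(\<lambda>j. simple_int (\<lambda>\<omega>. F \<omega> * approx f j \<omega>) x) \<longlonglongrightarrow> simple_int F (integ f x)"
    unfolding simple_int_mult[OF F G(1), symmetric]
    by (intro bounded_linear.tendsto[OF bounded_linear_simple_int[OF F]] approx_integ(2) f)
  ultimately show ?thesis by (rule LIMSEQ_unique[THEN sym])
qed

lemma E_integ:
  assumes "A \<in> sets M" "f \<in> borel_measurable M" "x \<in> dom_int f"
  shows "E A (integ f x) = integ (\<lambda>\<omega>. indicator A \<omega> * f \<omega>) x"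
  using simple_int_integ[of "indicator A" f x] assms
  by (simp add: simple_int_indicator simple_function_indicator)

lemma integ_indicator: "A \<in> sets M \<Longrightarrow> integ (indicator A) x = E A x"
  by (simp add: integ_simple simple_int_indicator simple_function_indicator)

text \<open>On a set \<open>A\<close> both measures give the integral of \<open>|g|^2\<close> over
  \<open>A\<close>: \<open>E A\<close> truncates \<open>g\<close> to \<open>A\<close>, and the
  isometry evaluates the norm of the result.\<close>

lemma scalar_measure_integ:
  assumes g: "g \<in> borel_measurable M" "x \<in> dom_int g"
  shows "scalar_measure (integ g x) = density (scalar_measure x) (\<lambda>\<omega>. ennreal ((cmod (g \<omega>))\<^sup>2))"
proof (rule measure_eqI)
  note [measurable] = g(1)
  fix A assume "A \<in> sets (scalar_measure (integ g x))"
  then have A[measurable]: "A \<in> sets M" by simp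
  have "x \<in> dom_int (\<lambda>\<omega>. indicator A \<omega> * g \<omega>)"
    by (rule dom_int_mult[OF g, where K = 1]) (simp add: indicator_def)
  then have "emeasure (scalar_measure (integ g x)) A = L2 (\<lambda>\<omega>. indicator A \<omega> * g \<omega>) x"
    using A g by (subst L2_integ) (simp_all add: emeasure_scalar_measure E_integ)
  also have "\<dots> = emeasure (density (scalar_measure x) (\<lambda>\<omega>. ennreal ((cmod (g \<omega>))\<^sup>2))) A"
    unfolding L2_def by (subst emeasure_density) (auto intro!: nn_integral_cong simp: indicator_def)
  finally show "emeasure (scalar_measure (integ g x)) A =
    emeasure (density (scalar_measure x) (\<lambda>\<omega>. ennreal ((cmod (g \<omega>))\<^sup>2))) A" .
qed simp

lemma L2_integ_mult:
  assumes f: "f \<in> borel_measurable M" and g: "g \<in> borel_measurable M" "x \<in> dom_int g"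
  shows "L2 f (integ g x) = L2 (\<lambda>\<omega>. f \<omega> * g \<omega>) x"
proof -
  note [measurable] = f g(1)
  have "L2 f (integ g x) = (\<integral>\<^sup>+\<omega>. ennreal ((cmod (g \<omega>))\<^sup>2) * ennreal ((cmod (f \<omega>))\<^sup>2) \<partial>scalar_measure x)"
    unfolding L2_def scalar_measure_integ[OF g] by (rule nn_integral_density) simp_all
  then show ?thesis
    unfolding L2_def by (simp add: norm_mult power_mult_distrib mult.commute flip: ennreal_mult)
qed

lemma integ_in_dom_int_iff:
  assumes "f \<in> borel_measurable M" "g \<in> borel_measurable M" "x \<in> dom_int g"
  shows "integ g x \<in> dom_int f \<longleftrightarrow> x \<in> dom_int (\<lambda>\<omega>. f \<omega> * g \<omega>)"
  using L2_integ_mult[OF assms] by (simp add: dom_int_def)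

text \<open>The rule for simple left factors passes to the limit in two ways: under the integral,
  since the products are dominated by \<open>2 |f g|\<close>, and outside, since the domain
  condition on \<open>f g\<close> places \<open>integ g x\<close> in the domain of
  \<open>f\<close>.\<close>

lemma integ_mult:
  assumes f: "f \<in> borel_measurable M" and g: "g \<in> borel_measurable M" "x \<in> dom_int g"
    and fg: "x \<in> dom_int (\<lambda>\<omega>. f \<omega> * g \<omega>)"
  shows "integ f (integ g x) = integ (\<lambda>\<omega>. f \<omega> * g \<omega>) x"
proof -
  note F = approx[OF f]
  note [measurable] = f g(1) borel_measurable_simple_function[OF F(1)]
  have "(\<lambda>j. integ (\<lambda>\<omega>. approx f j \<omega> * g \<omega>) x) \<longlonglongrightarrow> integ (\<lambda>\<omega>. f \<omega> * g \<omega>) x"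
  proof (rule integ_dominated_convergence[OF _ fg])
    show "(\<lambda>j. approx f j \<omega> * g \<omega>) \<longlonglongrightarrow> f \<omega> * g \<omega>" if "\<omega> \<in> space M" for \<omega>
      using F(2)[OF that] by (intro tendsto_intros)
    show "cmod (approx f j \<omega> * g \<omega>) \<le> 2 * cmod (f \<omega> * g \<omega>)" if "\<omega> \<in> space M" for j \<omega>
      using mult_right_mono[OF F(3)[OF that, of j], of "cmod (g \<omega>)"] by (simp add: norm_mult)
  qed simp_all
  moreover have "(\<lambda>j. integ (\<lambda>\<omega>. approx f j \<omega> * g \<omega>) x) \<longlonglongrightarrow> integ f (integ g x)"
    using approx_integ(2)[OF f, of "integ g x"] fg integ_in_dom_int_iff[OF f g]
    by (simp add: simple_int_integ[OF F(1) g])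
  ultimately show ?thesis by (rule LIMSEQ_unique[THEN sym])
qed


subsection \<open>Truncations and operators commuting with the calculus\<close>

definition level :: "('a \<Rightarrow> complex) \<Rightarrow> nat \<Rightarrow> 'a set" where
  "level f n = {\<omega> \<in> space M. cmod (f \<omega>) \<le> real n}"

lemma sets_level [measurable]: "f \<in> borel_measurable M \<Longrightarrow> level f n \<in> sets M"
  unfolding level_def by measurable

text \<open>Exhaustion is phrased as eventual membership so that the levels of two functions can
  simply be intersected.\<close>

lemma eventually_level: "\<omega> \<in> space M \<Longrightarrow> \<forall>\<^sub>F n in sequentially. \<omega> \<in> level f n"
  using eventually_ge_at_top[of "nat \<lceil>cmod (f \<omega>)\<rceil>"]
  by eventually_elim (auto simp: level_def nat_le_iff ceiling_le_iff)

lemma integ_indicator_tendsto: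
  assumes f: "f \<in> borel_measurable M" "x \<in> dom_int f"
    and A: "\<And>n. A n \<in> sets M" "\<And>\<omega>. \<omega> \<in> space M \<Longrightarrow> \<forall>\<^sub>F n in sequentially. \<omega> \<in> A n"
  shows "(\<lambda>n. integ (\<lambda>\<omega>. indicator (A n) \<omega> * f \<omega>) x) \<longlonglongrightarrow> integ f x"
proof (rule integ_dominated_convergence[OF f])
  note [measurable] = f(1) A(1)
  show "(\<lambda>\<omega>. indicator (A n) \<omega> * f \<omega>) \<in> borel_measurable M" for n by simp
  show "(\<lambda>n. indicator (A n) \<omega> * f \<omega>) \<longlonglongrightarrow> f \<omega>" if "\<omega> \<in> space M" for \<omega>
    by (intro tendsto_eventually eventually_mono[OF A(2)[OF that]]) simp
  show "cmod (indicator (A n) \<omega> * f \<omega>) \<le> 2 * cmod (f \<omega>)" for n \<omega>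
    by (auto simp: indicator_def)
qed

lemma E_tendsto:
  assumes "\<And>n. A n \<in> sets M" "\<And>\<omega>. \<omega> \<in> space M \<Longrightarrow> \<forall>\<^sub>F n in sequentially. \<omega> \<in> A n"
  shows "(\<lambda>n. E (A n) x) \<longlonglongrightarrow> x"
proof -
  have "integ (\<lambda>_. 1) x = integ (indicator (space M)) x"
    by (rule integ_cong) (auto intro: dom_int_bounded[where K = 1] simp: indicator_def)
  then have "integ (\<lambda>_. 1) x = x"
    by (simp add: integ_indicator E_space)
  moreover have "x \<in> dom_int (\<lambda>_. 1)" by (rule dom_int_bounded[where K = 1]) simp
  ultimately show ?thesis
    using integ_indicator_tendsto[of "\<lambda>_. 1" x A] assms by (simp add: integ_indicator)
qed

text \<open>
  Linear combinations and images of vectors are shown to lie in the domain through this criterion,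
  since no scalar measure has to be compared with another one.
\<close>

lemma dom_int_truncation:
  assumes f: "f \<in> borel_measurable M"
    and K: "\<And>n. norm (integ (\<lambda>\<omega>. indicator (level f n) \<omega> * f \<omega>) x) \<le> K"
  shows "x \<in> dom_int f"
proof -
  note [measurable] = f
  let ?t = "\<lambda>n \<omega>. indicator (level f n) \<omega> * f \<omega>"
  have dom: "x \<in> dom_int (?t n)" for n
    by (rule dom_int_bounded[where K = "real n"]) (auto simp: indicator_def level_def)
  \<comment> \<open>Pointwise, each truncation has modulus either 0 or that of \<open>f\<close>, and
    the latter from some \<open>n\<close> on. Monotone convergence presupposes no finiteness, so the
    uniform bound \<open>K\<close> itself delivers it.\<close>
  have "L2 f x = (\<integral>\<^sup>+\<omega>. (SUP n. ennreal ((cmod (?t n \<omega>))\<^sup>2)) \<partial>scalar_measure x)"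
    unfolding L2_def
  proof (rule nn_integral_cong)
    fix \<omega> assume "\<omega> \<in> space (scalar_measure x)"
    then obtain n where "\<omega> \<in> level f n"
      using eventually_happens[OF eventually_level[of \<omega> f]] by auto
    then show "ennreal ((cmod (f \<omega>))\<^sup>2) = (SUP n. ennreal ((cmod (?t n \<omega>))\<^sup>2))"
      by (intro antisym SUP_upper2[of n] SUP_least) (auto simp: indicator_def)
  qed
  also have "\<dots> = (SUP n. L2 (?t n) x)"
    unfolding L2_def
  proof (rule nn_integral_monotone_convergence_SUP)
    show "incseq (\<lambda>n \<omega>. ennreal ((cmod (?t n \<omega>))\<^sup>2))"
      by (auto simp: incseq_def le_fun_def indicator_def level_def intro: order_trans)
  qed simp
  also have "\<dots> \<le> ennreal (K\<^sup>2)"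
  proof (rule SUP_least)
    fix n
    show "L2 (?t n) x \<le> ennreal (K\<^sup>2)"
      using K[of n] by (subst L2_integ[OF _ dom]) (auto intro!: ennreal_leI power_mono)
  qed
  finally show ?thesis by (simp add: dom_int_def le_less_trans)
qed

lemma norm_integ_truncation_le:
  assumes f: "f \<in> borel_measurable M" "x \<in> dom_int f" and A: "A \<in> sets M"
  shows "norm (integ (\<lambda>\<omega>. indicator A \<omega> * f \<omega>) x) \<le> norm (integ f x)"
  using norm_E_le[OF A] by (simp add: E_integ[OF A f, symmetric])

lemma bounded_truncation:
  assumes "f \<in> borel_measurable M"
  shows "(\<lambda>\<omega>. indicator (level f n) \<omega> * f \<omega>) \<in> borel_measurable M"
    and "x \<in> dom_int (\<lambda>\<omega>. indicator (level f n) \<omega> * f \<omega>)"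
  using assms by (auto intro!: dom_int_bounded[where K = "real n"] simp: indicator_def level_def)

text \<open>Applied to real scalings, to the projections \<open>E A\<close> and to right Clifford
  multiplications, all of which commute with \<open>E\<close> and \<open>J\<close>; homogeneity,
  commutation with \<open>E\<close> and right linearity are instances.\<close>

lemma integ_commute:
  assumes f: "f \<in> borel_measurable M" "x \<in> dom_int f" and L: "bounded_linear L"
    and LE: "\<And>A x. A \<in> sets M \<Longrightarrow> L (E A x) = E A (L x)" and LJ: "\<And>x. L (J x) = J (L x)"
  shows "L x \<in> dom_int f" "integ f (L x) = L (integ f x)"
proof -
  \<comment> \<open>Here \<open>L x\<close> is assumed to lie in the domain. This is free for the
    truncations, whose bound then puts \<open>L x\<close> into the domain of \<open>f\<close>, after
    which \<open>aux\<close> applies to \<open>f\<close> itself.\<close>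
  have aux: "integ g (L x) = L (integ g x)"
    if g: "g \<in> borel_measurable M" "x \<in> dom_int g" "L x \<in> dom_int g" for g
  proof (rule LIMSEQ_unique)
    show "(\<lambda>j. simple_int (approx g j) (L x)) \<longlonglongrightarrow> integ g (L x)"
      by (rule approx_integ(2)[OF g(1,3)])
    show "(\<lambda>j. simple_int (approx g j) (L x)) \<longlonglongrightarrow> L (integ g x)"
    proof -
      have "simple_int (approx g j) (L x) = L (simple_int (approx g j) x)" for j
        by (rule simple_int_commute[OF approx(1)[OF g(1)] L]) (simp_all add: LE LJ)
      then show ?thesis
        by (simp only:) (intro bounded_linear.tendsto[OF L] approx_integ(2) g)
    qed
  qed
  obtain K where K: "K > 0" "\<And>y. norm (L y) \<le> norm y * K"
    using bounded_linear.pos_bounded[OF L] by blast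
  show "L x \<in> dom_int f"
  proof (rule dom_int_truncation[OF f(1)])
    fix n
    let ?t = "\<lambda>\<omega>. indicator (level f n) \<omega> * f \<omega>"
    have "norm (integ ?t (L x)) \<le> norm (integ ?t x) * K"
      using aux[of ?t] K by (simp add: bounded_truncation f)
    also have "\<dots> \<le> norm (integ f x) * K"
      using norm_integ_truncation_le[OF f] f K by (intro mult_right_mono) auto
    finally show "norm (integ ?t (L x)) \<le> norm (integ f x) * K" .
  qed
  then show "integ f (L x) = L (integ f x)" by (rule aux[OF f])
qed

lemma integ_add_right:
  assumes f: "f \<in> borel_measurable M" "x \<in> dom_int f" "y \<in> dom_int f"
  shows "x + y \<in> dom_int f" "integ f (x + y) = integ f x + integ f y"
proof -
  have aux: "integ g (x + y) = integ g x + integ g y"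
    if g: "g \<in> borel_measurable M" "x \<in> dom_int g" "y \<in> dom_int g" "x + y \<in> dom_int g" for g
  proof (rule LIMSEQ_unique)
    show "(\<lambda>j. simple_int (approx g j) (x + y)) \<longlonglongrightarrow> integ g (x + y)"
      by (rule approx_integ(2)[OF g(1,4)])
    show "(\<lambda>j. simple_int (approx g j) (x + y)) \<longlonglongrightarrow> integ g x + integ g y"
      unfolding linear_add[OF bounded_linear.linear[OF bounded_linear_simple_int[OF approx(1)[OF g(1)]]]]
      by (intro tendsto_add approx_integ(2) g)
  qed
  show "x + y \<in> dom_int f"
  proof (rule dom_int_truncation[OF f(1)])
    fix n
    let ?t = "\<lambda>\<omega>. indicator (level f n) \<omega> * f \<omega>"
    have "norm (integ ?t (x + y)) \<le> norm (integ ?t x) + norm (integ ?t y)"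
      using aux[of ?t] by (simp add: bounded_truncation f norm_triangle_ineq)
    also have "\<dots> \<le> norm (integ f x) + norm (integ f y)"
      using f by (intro add_mono norm_integ_truncation_le) auto
    finally show "norm (integ ?t (x + y)) \<le> norm (integ f x) + norm (integ f y)" .
  qed
  then show "integ f (x + y) = integ f x + integ f y" by (rule aux[OF f])
qed

lemma integ_E:
  assumes "f \<in> borel_measurable M" "x \<in> dom_int f" "A \<in> sets M"
  shows "integ f (E A x) = E A (integ f x)"
  using assms by (intro integ_commute(2)) (auto simp: bounded_linear_E E_Int Int_commute J_E)

lemma E_in_dom_int_iff:
  assumes "f \<in> borel_measurable M" "A \<in> sets M"
  shows "E A x \<in> dom_int f \<longleftrightarrow> x \<in> dom_int (\<lambda>\<omega>. indicator A \<omega> * f \<omega>)"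
  using integ_in_dom_int_iff[of f "indicator A" x] assms
  by (simp add: integ_indicator simple_dom_int simple_function_indicator mult.commute)

text \<open>\<open>E A x\<close> is the integral of an indicator, so the product rule applies. This
  provides vectors in every domain that occurs: those cut down to a set where the function is
  bounded.\<close>

lemma integ_E_bounded:
  assumes f: "f \<in> borel_measurable M" and A: "A \<in> sets M"
    and K: "\<And>\<omega>. \<omega> \<in> A \<Longrightarrow> cmod (f \<omega>) \<le> K"
  shows "E A x \<in> dom_int f"
    and "integ f (E A x) = integ (\<lambda>\<omega>. indicator A \<omega> * f \<omega>) x"
proof -
  \<comment> \<open>The absolute value covers an empty \<open>A\<close>, for which \<open>K\<close>
    may be negative while the truncated function is 0.\<close>
  have dom: "x \<in> dom_int (\<lambda>\<omega>. indicator A \<omega> * f \<omega>)"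
    by (rule dom_int_bounded[where K = "\<bar>K\<bar>"]) (auto simp: indicator_def dest: K)
  then show "E A x \<in> dom_int f" by (simp add: E_in_dom_int_iff f A)
  show "integ f (E A x) = integ (\<lambda>\<omega>. indicator A \<omega> * f \<omega>) x"
    using integ_mult[of f "indicator A" x] dom f A
    by (simp add: integ_indicator simple_dom_int simple_function_indicator mult.commute)
qed


subsection \<open>Bounded functions\<close>

lemma norm_integ_le:
  assumes g: "g \<in> borel_measurable M" and K: "K \<ge> 0" "\<And>\<omega>. \<omega> \<in> space M \<Longrightarrow> cmod (g \<omega>) \<le> K"
  shows "norm (integ g x) \<le> K * norm x"
proof -
  have dom: "x \<in> dom_int g" by (rule dom_int_bounded[OF K(2)])
  have "L2 g x \<le> ennreal (K\<^sup>2 * (norm x)\<^sup>2)" by (rule L2_bounded[OF K(2)])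
  then have "(norm (integ g x))\<^sup>2 \<le> K\<^sup>2 * (norm x)\<^sup>2"
    unfolding L2_integ[OF g dom] by simp
  then have "(norm (integ g x))\<^sup>2 \<le> (K * norm x)\<^sup>2"
    by (simp only: power_mult_distrib)
  then show ?thesis
    by (rule power2_le_imp_le) (simp add: K(1))
qed

lemma bounded_linear_integ:
  assumes g: "g \<in> borel_measurable M" and K: "\<And>\<omega>. \<omega> \<in> space M \<Longrightarrow> cmod (g \<omega>) \<le> K"
  shows "bounded_linear (integ g)"
proof (rule bounded_linear_intro[where K = "\<bar>K\<bar>"])
  have dom: "x \<in> dom_int g" for x by (rule dom_int_bounded[OF K])
  show "integ g (x + y) = integ g x + integ g y" for x y
    by (rule integ_add_right(2)[OF g dom dom])
  show "integ g (r *\<^sub>R x) = r *\<^sub>R integ g x" for r x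
    by (rule integ_commute(2)[OF g dom bounded_linear_scaleR_right])
       (simp_all add: linear_scale[OF linear_E] linear_scale[OF linear_J])
  show "norm (integ g x) \<le> norm x * \<bar>K\<bar>" for x
    unfolding mult.commute[of "norm x"] by (rule norm_integ_le[OF g]) (auto dest: K)
qed

text \<open>Uniform distance of functions controls operator norm distance of integrals, which is
  what the definition of the bounded integral measures.\<close>

lemma norm_simple_int_diff_integ_le:
  assumes g: "g \<in> borel_measurable M" "x \<in> dom_int g" and F: "simple_function M F"
    and e: "e \<ge> 0" "\<And>\<omega>. \<omega> \<in> space M \<Longrightarrow> cmod (F \<omega> - g \<omega>) \<le> e"
  shows "norm (simple_int F x - integ g x) \<le> e * norm x"
proof -
  note F' = borel_measurable_simple_function[OF F]
  have "simple_int F x - integ g x = integ (\<lambda>\<omega>. F \<omega> - g \<omega>) x"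
    using integ_diff(2)[OF F' simple_dom_int[OF F] g] by (simp add: integ_simple[OF F])
  then show ?thesis
    using norm_integ_le[of "\<lambda>\<omega>. F \<omega> - g \<omega>" e x] e F' g by simp
qed


subsection \<open>Adjoints and closures\<close>

lemma dom_int_cnj [simp]: "dom_int (\<lambda>\<omega>. cnj (f \<omega>)) = dom_int f"
  by (simp add: dom_int_def L2_def)

lemma integ_inner:
  assumes f: "f \<in> borel_measurable M" "x \<in> dom_int f" "y \<in> dom_int f"
  shows "integ f x \<bullet> y = x \<bullet> integ (\<lambda>\<omega>. cnj (f \<omega>)) y"
proof (rule LIMSEQ_unique)
  note F = approx[OF f(1)]
  show "(\<lambda>j. simple_int (approx f j) x \<bullet> y) \<longlonglongrightarrow> integ f x \<bullet> y"
    by (intro tendsto_intros approx_integ(2) f)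
  have "(\<lambda>j. simple_int (\<lambda>\<omega>. cnj (approx f j \<omega>)) y) \<longlonglongrightarrow> integ (\<lambda>\<omega>. cnj (f \<omega>)) y"
  proof (rule simple_int_tendsto_integ)
    show "simple_function M (\<lambda>\<omega>. cnj (approx f j \<omega>))" for j
      using F(1) by (rule simple_function_compose1)
    have "(\<lambda>j. L2 (\<lambda>\<omega>. cnj (approx f j \<omega>) - cnj (f \<omega>)) y) = (\<lambda>j. L2 (\<lambda>\<omega>. approx f j \<omega> - f \<omega>) y)"
      unfolding L2_def by (simp flip: complex_cnj_diff)
    then show "(\<lambda>j. L2 (\<lambda>\<omega>. cnj (approx f j \<omega>) - cnj (f \<omega>)) y) \<longlonglongrightarrow> 0"
      using approx_integ(1)[OF f(1,3)] by simp
  qed (use f in \<open>auto intro: borel_measurable_cnj\<close>)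
  then show "(\<lambda>j. simple_int (approx f j) x \<bullet> y) \<longlonglongrightarrow> x \<bullet> integ (\<lambda>\<omega>. cnj (f \<omega>)) y"
    unfolding simple_int_inner[OF F(1)] by (intro tendsto_intros)
qed

lemma adjoint_integ_iff:
  assumes f: "f \<in> borel_measurable M"
  shows "(\<forall>x\<in>dom_int f. integ f x \<bullet> y = x \<bullet> z) \<longleftrightarrow> y \<in> dom_int f \<and> z = integ (\<lambda>\<omega>. cnj (f \<omega>)) y"
proof
  assume "y \<in> dom_int f \<and> z = integ (\<lambda>\<omega>. cnj (f \<omega>)) y"
  then show "\<forall>x\<in>dom_int f. integ f x \<bullet> y = x \<bullet> z" by (simp add: integ_inner f)
next
  assume adj: "\<forall>x\<in>dom_int f. integ f x \<bullet> y = x \<bullet> z"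
  let ?t = "\<lambda>n \<omega>. indicator (level f n) \<omega> * f \<omega>"
  have cnj_t: "cnj (?t n \<omega>) = indicator (level f n) \<omega> * cnj (f \<omega>)" for n \<omega>
    by (simp add: indicator_def)
  note [measurable] = f
  have level: "level f n \<in> sets M" for n by simp
  \<comment> \<open>bounding the truncated integrals by \<open>norm z\<close> puts \<open>y\<close> into the domain\<close>
  have E: "E (level f n) z = integ (\<lambda>\<omega>. cnj (?t n \<omega>)) y" for n
  proof (rule vector_eq_ldot[THEN iffD1, rule_format])
    fix x
    have t: "E (level f n) x \<in> dom_int f" "integ f (E (level f n) x) = integ (?t n) x"
      by (rule integ_E_bounded[OF f level, of n "real n"]; simp add: level_def)+
    have "x \<bullet> E (level f n) z = E (level f n) x \<bullet> z" by (simp add: E_inner)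
    also have "\<dots> = integ (?t n) x \<bullet> y"
      using adj[rule_format, OF t(1)] t(2) by simp
    also have "\<dots> = x \<bullet> integ (\<lambda>\<omega>. cnj (?t n \<omega>)) y"
      by (intro integ_inner bounded_truncation f)
    finally show "x \<bullet> E (level f n) z = x \<bullet> integ (\<lambda>\<omega>. cnj (?t n \<omega>)) y" .
  qed
  have y: "y \<in> dom_int f"
  proof (rule dom_int_truncation[OF f])
    fix n
    have cnj: "(\<lambda>\<omega>. cnj (?t n \<omega>)) \<in> borel_measurable M"
      using bounded_truncation(1)[OF f] by (rule borel_measurable_cnj)
    \<comment> \<open>A function and its conjugate have the same modulus, so by the isometry their
      integrals have the same norm; the bound found for the conjugate transfers to
      \<open>f\<close>.\<close>
    have "ennreal ((norm (integ (?t n) y))\<^sup>2) = L2 (?t n) y"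
      by (intro L2_integ[symmetric] bounded_truncation f)
    also have "\<dots> = L2 (\<lambda>\<omega>. cnj (?t n \<omega>)) y" by (simp only: L2_def complex_mod_cnj)
    also have "\<dots> = ennreal ((norm (integ (\<lambda>\<omega>. cnj (?t n \<omega>)) y))\<^sup>2)"
      using bounded_truncation(2)[OF f] by (intro L2_integ cnj) (simp only: dom_int_cnj)
    finally have "(norm (integ (?t n) y))\<^sup>2 = (norm (E (level f n) z))\<^sup>2"
      by (simp add: E)
    then have "norm (integ (?t n) y) = norm (E (level f n) z)"
      by (rule power2_eq_imp_eq) simp_all
    then show "norm (integ (?t n) y) \<le> norm z"
      using norm_E_le[OF level, of n z] by simp
  qed
  have "(\<lambda>n. E (level f n) z) \<longlonglongrightarrow> z"
    by (intro E_tendsto eventually_level level)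
  moreover have "(\<lambda>n. E (level f n) z) \<longlonglongrightarrow> integ (\<lambda>\<omega>. cnj (f \<omega>)) y"
    unfolding E cnj_t
    by (intro integ_indicator_tendsto borel_measurable_cnj f level eventually_level) (simp_all add: y)
  ultimately have "z = integ (\<lambda>\<omega>. cnj (f \<omega>)) y"
    by (rule LIMSEQ_unique)
  with y show "y \<in> dom_int f \<and> z = integ (\<lambda>\<omega>. cnj (f \<omega>)) y" ..
qed

definition op_int :: "('a \<Rightarrow> complex) \<Rightarrow> 'v \<rightharpoonup> 'v" where
  "op_int f = (\<lambda>x. if x \<in> dom_int f then Some (integ f x) else None)"

lemma dom_op_int [simp]: "dom (op_int f) = dom_int f"
  by (auto simp: op_int_def dom_def)

lemma op_int_cong_AE:
  assumes "f \<in> borel_measurable M" "g \<in> borel_measurable M" "\<And>x. AE \<omega> in scalar_measure x. f \<omega> = g \<omega>"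
  shows "op_int f = op_int g"
proof
  fix x
  have "AE \<omega> in scalar_measure x. g \<omega> = f \<omega>" using assms(3)[of x] by eventually_elim simp
  then have "x \<in> dom_int f \<longleftrightarrow> x \<in> dom_int g"
    using integ_cong_AE(1)[OF assms(1,2) _ assms(3)] integ_cong_AE(1)[OF assms(2,1)] by blast
  then show "op_int f x = op_int g x"
    using integ_cong_AE(2)[OF assms(1,2) _ assms(3)] by (simp add: op_int_def)
qed

lemma graph_op_int: "(x, y) \<in> Map.graph (op_int f) \<longleftrightarrow> x \<in> dom_int f \<and> y = integ f x"
  by (auto simp: Map.graph_def op_int_def)

lemma closed_graph_op_int:
  assumes f: "f \<in> borel_measurable M"
  shows "closed (Map.graph (op_int f))"
  unfolding closed_sequential_limits
proof (intro allI impI, elim conjE)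
  fix p :: "nat \<Rightarrow> 'v \<times> 'v" and l
  assume p: "\<forall>n. p n \<in> Map.graph (op_int f)" and lim: "p \<longlonglongrightarrow> l"
  have p': "fst (p n) \<in> dom_int f" "snd (p n) = integ f (fst (p n))" for n
    using p graph_op_int[of "fst (p n)" "snd (p n)" f] by auto
  have lims: "(\<lambda>n. fst (p n)) \<longlonglongrightarrow> fst l" "(\<lambda>n. snd (p n)) \<longlonglongrightarrow> snd l"
    using lim by (auto intro: tendsto_intros)
  have "integ (\<lambda>\<omega>. cnj (f \<omega>)) w \<bullet> fst l = w \<bullet> snd l" if w: "w \<in> dom_int f" for w
  proof (rule LIMSEQ_unique)
    show "(\<lambda>n. integ (\<lambda>\<omega>. cnj (f \<omega>)) w \<bullet> fst (p n)) \<longlonglongrightarrow> integ (\<lambda>\<omega>. cnj (f \<omega>)) w \<bullet> fst l"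
      by (intro tendsto_intros lims)
    have "integ (\<lambda>\<omega>. cnj (f \<omega>)) w \<bullet> fst (p n) = w \<bullet> snd (p n)" for n
      unfolding p'(2) using integ_inner[OF f p'(1)[of n] w] by (metis inner_commute)
    then show "(\<lambda>n. integ (\<lambda>\<omega>. cnj (f \<omega>)) w \<bullet> fst (p n)) \<longlonglongrightarrow> w \<bullet> snd l"
      by (simp only:) (intro tendsto_intros lims)
  qed
  \<comment> \<open>The limit pair satisfies the adjoint relation of the conjugate function, and
    conjugating twice returns \<open>f\<close>.\<close>
  then have "fst l \<in> dom_int f \<and> snd l = integ f (fst l)"
    using adjoint_integ_iff[OF borel_measurable_cnj[OF f], of "fst l" "snd l"] by simp
  then show "l \<in> Map.graph (op_int f)"
    using graph_op_int[of "fst l" "snd l" f] by (metis prod.collapse)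
qed

text \<open>The vectors \<open>E (A n) x\<close> form a core.\<close>

lemma closure_graph_eq_op_int:
  assumes f: "f \<in> borel_measurable M" and S: "S \<subseteq>\<^sub>m op_int f"
    and A: "\<And>n. A n \<in> sets M" "\<And>\<omega>. \<omega> \<in> space M \<Longrightarrow> \<forall>\<^sub>F n in sequentially. \<omega> \<in> A n"
    and dom: "\<And>n x. E (A n) x \<in> dom S"
  shows "closure (Map.graph S) = Map.graph (op_int f)"
proof
  have "Map.graph S \<subseteq> Map.graph (op_int f)"
    using S by (force simp: map_le_def Map.graph_def dom_def)
  then show "closure (Map.graph S) \<subseteq> Map.graph (op_int f)"
    using closed_graph_op_int[OF f] by (rule closure_minimal)
  show "Map.graph (op_int f) \<subseteq> closure (Map.graph S)"
  proof
    fix p assume "p \<in> Map.graph (op_int f)"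
    then obtain x where x: "x \<in> dom_int f" "p = (x, integ f x)"
      using graph_op_int[of "fst p" "snd p" f] by (metis prod.collapse)
    \<comment> \<open>By \<open>integ_E\<close> truncating the vector truncates its integral, so one
      sequence approximates both components of the pair.\<close>
    have "(\<lambda>n. (E (A n) x, E (A n) (integ f x))) \<longlonglongrightarrow> (x, integ f x)"
      by (intro tendsto_Pair E_tendsto A)
    moreover have "(E (A n) x, E (A n) (integ f x)) \<in> Map.graph S" for n
    proof -
      have "S (E (A n) x) = op_int f (E (A n) x)"
        using S dom by (auto simp: map_le_def)
      moreover have "E (A n) x \<in> dom S" by (rule dom)
      ultimately have "S (E (A n) x) = Some (integ f (E (A n) x))"
        by (auto simp: op_int_def split: if_splits)
      then show ?thesis using f x A by (simp add: Map.graph_def integ_E)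
    qed
    ultimately show "p \<in> closure (Map.graph S)"
      unfolding closure_sequential x by (intro exI conjI allI)
  qed
qed

text \<open>The restriction is genuine: if \<open>f\<close> vanishes where \<open>g\<close> is
  large, the product may be bounded while \<open>x\<close> is outside the domain of
  \<open>g\<close>. Hence the closure in the product rule, and hence the intersection in the domain
  formula.\<close>

lemma op_int_comp:
  assumes f: "f \<in> borel_measurable M" and g: "g \<in> borel_measurable M"
  shows "op_int f \<circ>\<^sub>m op_int g = op_int (\<lambda>\<omega>. f \<omega> * g \<omega>) |` dom_int g"
proof
  fix x
  show "(op_int f \<circ>\<^sub>m op_int g) x = (op_int (\<lambda>\<omega>. f \<omega> * g \<omega>) |` dom_int g) x"
    using integ_in_dom_int_iff[OF f g, of x] integ_mult[OF f g, of x]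
    by (auto simp: map_comp_def op_int_def restrict_map_def)
qed

lemma closure_graph_op_int_comp:
  assumes f: "f \<in> borel_measurable M" and g: "g \<in> borel_measurable M"
  shows "closure (Map.graph (op_int f \<circ>\<^sub>m op_int g)) = Map.graph (op_int (\<lambda>\<omega>. f \<omega> * g \<omega>))"
proof (rule closure_graph_eq_op_int[where A = "\<lambda>n. level f n \<inter> level g n"])
  note [measurable] = f g
  show "(\<lambda>\<omega>. f \<omega> * g \<omega>) \<in> borel_measurable M" "level f n \<inter> level g n \<in> sets M" for n by simp_all
  show "op_int f \<circ>\<^sub>m op_int g \<subseteq>\<^sub>m op_int (\<lambda>\<omega>. f \<omega> * g \<omega>)"
    unfolding op_int_comp[OF f g] by (auto simp: map_le_def restrict_map_def)
  show "\<forall>\<^sub>F n in sequentially. \<omega> \<in> level f n \<inter> level g n" if "\<omega> \<in> space M" for \<omega>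
    using eventually_conj[OF eventually_level[OF that, of f] eventually_level[OF that, of g]] by simp
  fix n x
  have "E (level f n \<inter> level g n) x \<in> dom_int g"
    by (rule integ_E_bounded(1)[where K = "real n"]) (auto simp: level_def)
  moreover have "E (level f n \<inter> level g n) x \<in> dom_int (\<lambda>\<omega>. f \<omega> * g \<omega>)"
    by (rule integ_E_bounded(1)[where K = "real n * real n"])
       (auto simp: level_def norm_mult intro: mult_mono)
  ultimately show "E (level f n \<inter> level g n) x \<in> dom (op_int f \<circ>\<^sub>m op_int g)"
    unfolding op_int_comp[OF f g] by simp
qed

text \<open>Scalars are integrals of constants, so the right factor in the linear combination falls
  under the product rule. A constant is integrable at every vector, so no closure is taken at that
  stage.\<close>

lemma smul_eq_integ: "smul c x = integ (\<lambda>_. c) x"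
proof -
  have "x \<in> dom_int (\<lambda>_. 1)" by (rule dom_int_bounded[where K = 1]) simp
  then have "integ (\<lambda>_. c * 1) x = smul c (integ (\<lambda>_. 1) x)"
    by (intro integ_cmult) simp_all
  moreover have "integ (\<lambda>_. 1) x = integ (indicator (space M)) x"
    by (rule integ_cong) (auto intro: dom_int_bounded[where K = 1] simp: indicator_def)
  ultimately show ?thesis by (simp add: integ_indicator E_space)
qed

text \<open>Cancellation can enlarge the domain, as for \<open>g = - f c\<close>, so the sum of
  operators need only be a restriction. On the intersected levels both summands are bounded, which
  puts a core into its domain.\<close>

lemma closure_graph_op_int_add:
  assumes f: "f \<in> borel_measurable M" and g: "g \<in> borel_measurable M"
  shows "closure (Map.graph (op_add (op_int f \<circ>\<^sub>m total_op (smul c)) (op_int g))) =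
    Map.graph (op_int (\<lambda>\<omega>. f \<omega> * c + g \<omega>))"
proof (rule closure_graph_eq_op_int[where A = "\<lambda>n. level f n \<inter> level g n"])
  note [measurable] = f g
  have const: "x \<in> dom_int (\<lambda>_. c)" for x by (rule dom_int_bounded[where K = "cmod c"]) simp
  have fc: "op_int f \<circ>\<^sub>m total_op (smul c) = op_int (\<lambda>\<omega>. f \<omega> * c)"
  proof
    fix x
    show "(op_int f \<circ>\<^sub>m total_op (smul c)) x = op_int (\<lambda>\<omega>. f \<omega> * c) x"
      using integ_in_dom_int_iff[OF f _ const, of x] integ_mult[OF f _ const, of x]
      by (simp add: map_comp_def total_op_def op_int_def smul_eq_integ)
  qed
  show "(\<lambda>\<omega>. f \<omega> * c + g \<omega>) \<in> borel_measurable M" "level f n \<inter> level g n \<in> sets M" for n by simp_all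
  show "op_add (op_int f \<circ>\<^sub>m total_op (smul c)) (op_int g) \<subseteq>\<^sub>m op_int (\<lambda>\<omega>. f \<omega> * c + g \<omega>)"
    unfolding fc map_le_def
  proof
    fix x assume "x \<in> dom (op_add (op_int (\<lambda>\<omega>. f \<omega> * c)) (op_int g))"
    then have x: "x \<in> dom_int (\<lambda>\<omega>. f \<omega> * c)" "x \<in> dom_int g"
      by (auto simp: op_add_def dom_def op_int_def split: if_splits)
    then show "op_add (op_int (\<lambda>\<omega>. f \<omega> * c)) (op_int g) x = op_int (\<lambda>\<omega>. f \<omega> * c + g \<omega>) x"
      by (simp add: op_add_def op_int_def dom_def integ_add dom_int_add)
  qed
  show "\<forall>\<^sub>F n in sequentially. \<omega> \<in> level f n \<inter> level g n" if "\<omega> \<in> space M" for \<omega>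
    using eventually_conj[OF eventually_level[OF that, of f] eventually_level[OF that, of g]] by simp
  fix n x
  have "E (level f n \<inter> level g n) x \<in> dom_int g"
    by (rule integ_E_bounded(1)[where K = "real n"]) (auto simp: level_def)
  moreover have "E (level f n \<inter> level g n) x \<in> dom_int (\<lambda>\<omega>. f \<omega> * c)"
    by (rule integ_E_bounded(1)[where K = "real n * cmod c"])
       (auto simp: level_def norm_mult intro: mult_right_mono)
  ultimately show "E (level f n \<inter> level g n) x \<in> dom (op_add (op_int f \<circ>\<^sub>m total_op (smul c)) (op_int g))"
    unfolding fc by (simp add: op_add_def dom_def op_int_def)
qed

text \<open>Both products restrict the integral of \<open>|f|^2\<close> to the same set, since
  \<open>f\<close> and its conjugate have equal domains; the equality holds without
  closures.\<close>

lemma op_int_cnj_comp: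
  assumes f: "f \<in> borel_measurable M"
  shows "op_int f \<circ>\<^sub>m op_int (\<lambda>\<omega>. cnj (f \<omega>)) = op_int (\<lambda>\<omega>. cnj (f \<omega>)) \<circ>\<^sub>m op_int f"
  using f by (simp add: op_int_comp borel_measurable_cnj mult.commute)

lemma closure_dom_int:
  assumes f: "f \<in> borel_measurable M"
  shows "closure (dom_int f) = UNIV"
proof -
  have "x \<in> closure (dom_int f)" for x
    unfolding closure_sequential
  proof (intro exI conjI allI)
    show "E (level f n) x \<in> dom_int f" for n
      using f by (intro integ_E_bounded(1)[where K = "real n"]) (auto simp: level_def)
    show "(\<lambda>n. E (level f n) x) \<longlonglongrightarrow> x"
      using f by (intro E_tendsto eventually_level) simp
  qed
  then show ?thesis by auto
qed

end

section \<open>Clifford modules\<close>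

text \<open>Right multiplication by the basis element of \<open>\<alpha>\<close> moves the
  coefficient at \<open>\<alpha>\<close>, up to a sign, into the scalar part, so
  \<open>cl_re\<close> sees every coefficient in turn.\<close>

lemma clifford_eqI:
  assumes "\<And>a. cl_re (u \<odot> a) = cl_re (v \<odot> a)"
  shows "u = (v :: 'n::{finite,linorder} clifford)"
proof -
  have comp: "cl_re (w \<odot> axis \<alpha> 1) = cl_sign \<alpha> \<alpha> * w $ \<alpha>" for w :: "'n clifford" and \<alpha>
  proof -
    have "w \<odot> axis \<alpha> 1 = (\<Sum>\<gamma>\<in>UNIV. axis \<gamma> (w $ \<gamma>) \<odot> axis \<alpha> 1)"
      by (subst vec_axis_expand[of w]) (simp only: linear_sum[OF linear_cl_mult_left])
    then have "cl_re (w \<odot> axis \<alpha> 1) =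
        (\<Sum>\<gamma>\<in>UNIV. cl_sign \<gamma> \<alpha> * axis (sym_diff \<gamma> \<alpha>) (w $ \<gamma>) $ {})"
      by (simp add: cl_re_def cl_mult_axis)
    also have "\<dots> = (\<Sum>\<gamma>\<in>UNIV. if \<gamma> = \<alpha> then cl_sign \<alpha> \<alpha> * w $ \<alpha> else 0)"
      by (intro sum.cong refl) (auto simp: axis_def)
    finally show ?thesis by simp
  qed
  have "cl_sign \<alpha> \<alpha> \<noteq> 0" for \<alpha> :: "'n set" by (simp add: cl_sign_def)
  then show ?thesis
    using assms comp by (metis mult_cancel_left vec_eq_iff)
qed

text \<open>The step from real to Clifford-valued adjoint relations; the hypothesis ranges over
  right multiples because the real part alone determines only one coefficient.\<close>

lemma cl_inner_eq_of_inner_eq: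
  fixes x z y :: "('h::real_inner, 'n::{finite,linorder}) cl_module"
  assumes "\<And>a. (u \<odot> a) \<bullet> y = (x \<odot> a) \<bullet> z"
  shows "cl_inner u y = cl_inner x z"
  by (rule clifford_eqI) (simp add: cl_re_inner assms flip: cl_inner_mult_left)

text \<open>The value being \<open>Some\<close> guarantees a vector with the adjoint property; since
  \<open>T\<close> is defined everywhere, that vector is unique and is the one which
  \<open>THE\<close> selects.\<close>

lemma op_adjoint_total_opD:
  fixes T S :: "('h::real_inner, 'n::{finite,linorder}) cl_module \<Rightarrow> ('h, 'n) cl_module"
  assumes "op_adjoint (total_op T) = total_op S"
  shows "T x \<bullet> y = x \<bullet> S y"
proof -
  let ?P = "\<lambda>z. \<forall>x\<in>dom (total_op T). cl_inner (the (total_op T x)) y = cl_inner x z"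
  have "op_adjoint (total_op T) y = Some (S y)"
    unfolding assms by (simp add: total_op_def)
  then have eq: "(if \<exists>z. ?P z then Some (THE z. ?P z) else None) = Some (S y)"
    unfolding op_adjoint_def .
  have ex: "\<exists>z. ?P z"
  proof (rule ccontr)
    assume "\<nexists>z. ?P z"
    with eq show False by (simp only: if_False option.distinct)
  qed
  then have S: "S y = (THE z. ?P z)"
    using eq by (simp only: if_True option.inject)
  from ex obtain z where z: "?P z" by (elim exE)
  have inner: "T x \<bullet> y = x \<bullet> z'" if "?P z'" for z' x
    using that by (auto simp: total_op_def simp flip: cl_re_inner)
  have "S y = z"
    unfolding S
  proof (rule the_equality[of ?P, OF z])
    fix z' assume "?P z'"
    then have "\<forall>x. x \<bullet> z' = x \<bullet> z" using inner[OF z] inner[of z'] by metis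
    then show "z' = z" by (simp only: vector_eq_ldot)
  qed
  then show ?thesis using inner[OF z] by simp
qed

lemma bounded_linear_axis: "bounded_linear (axis k :: 'h::real_normed_vector \<Rightarrow> ('h, 'i::finite) vec)"
proof (rule bounded_linear_intro[where K = 1])
  show "norm (axis k x :: ('h, 'i) vec) \<le> norm x * 1" for x
  proof -
    have "(\<Sum>i\<in>UNIV. (norm ((axis k x :: ('h, 'i) vec) $ i))\<^sup>2) = (\<Sum>i\<in>UNIV. if i = k then (norm x)\<^sup>2 else 0)"
      by (intro sum.cong refl) (simp add: axis_def)
    then show ?thesis by (simp add: norm_vec_def L2_set_def)
  qed
qed (simp_all add: axis_add_right axis_scaleR_right)

lemma bounded_linear_cl_mult_left:
  "bounded_linear (\<lambda>x :: ('h::real_normed_vector, 'n::{finite,linorder}) cl_module. x \<odot> a)"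
  unfolding cl_mult_def
  by (intro bounded_linear_sum bounded_linear_compose[OF bounded_linear_scaleR_right]
      bounded_linear_compose[OF bounded_linear_axis] bounded_linear_vec_nth)

lemma bounded_opsD:
  assumes "T \<in> bounded_ops"
  shows "bounded_linear T" "T (x \<odot> a) = T x \<odot> a"
  using assms by (auto simp: bounded_ops_def right_linear_op_def total_op_def dom_def)

text \<open>Once the closure of a graph is known to be the graph of a map, closability and the value
  of the closure are both immediate; closure statements thus become equalities of sets.\<close>

lemma op_closure_eq:
  assumes "closure (Map.graph S) = Map.graph T"
  shows "closable_op S" "op_closure S = T"
proof -
  have graph: "(x, y) \<in> closure (Map.graph S) \<longleftrightarrow> T x = Some y" for x y
    unfolding assms by (simp add: Map.graph_def)
  show "closable_op S" by (auto simp: closable_op_def single_valued_def graph)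
  show "op_closure S = T"
  proof
    fix x
    show "op_closure S x = T x" by (cases "T x") (simp_all add: op_closure_def graph)
  qed
qed


subsection \<open>The complex plane of an imaginary unit\<close>

definition of_cplx :: "'n::{finite,linorder} clifford \<Rightarrow> complex \<Rightarrow> 'n clifford" where
  "of_cplx \<iota> c = Re c *\<^sub>R cl_one + Im c *\<^sub>R \<iota>"

text \<open>Orthogonal coordinates along \<open>cl_one\<close> and \<open>\<iota>\<close>. Unlike
  the description \<open>cl_im\<close>, this is linear and continuous on the whole algebra, also off
  the plane, which measurability arguments use.\<close>

definition to_cplx :: "'n::{finite,linorder} clifford \<Rightarrow> 'n clifford \<Rightarrow> complex" where
  "to_cplx \<iota> a = Complex (cl_re a) (a \<bullet> \<iota>)"

text \<open>The value \<open>None\<close> becomes \<open>0\<close>, which is harmless as it occurs on a null set only.\<close>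

definition cplx_fun :: "'n::{finite,linorder} clifford \<Rightarrow> ('a \<Rightarrow> 'n clifford option) \<Rightarrow> 'a \<Rightarrow> complex" where
  "cplx_fun \<iota> f \<omega> = (case f \<omega> of None \<Rightarrow> 0 | Some a \<Rightarrow> to_cplx \<iota> a)"

lemma cplane_eq: "cplane \<iota> = range (of_cplx \<iota>)"
  unfolding cplane_def of_cplx_def
  by (auto simp: image_iff) (metis complex.sel)

lemma of_cplx_in_cplane [simp]: "of_cplx \<iota> c \<in> cplane \<iota>"
  by (simp add: cplane_eq)

lemma of_cplx_zero [simp]: "of_cplx \<iota> 0 = 0"
  by (simp add: of_cplx_def)

lemma of_cplx_add: "of_cplx \<iota> (c + d) = of_cplx \<iota> c + of_cplx \<iota> d"
  by (simp add: of_cplx_def scaleR_add_left)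

lemma of_cplx_diff: "of_cplx \<iota> (c - d) = of_cplx \<iota> c - of_cplx \<iota> d"
  by (simp add: of_cplx_def scaleR_diff_left)

lemma linear_to_cplx: "linear (to_cplx \<iota>)"
  by (rule linearI) (simp_all add: to_cplx_def cl_re_def inner_add_left complex_eq_iff)

lemma to_cplx_zero [simp]: "to_cplx \<iota> 0 = 0"
  by (rule linear_0[OF linear_to_cplx])

context
  fixes \<iota> :: "'n::{finite,linorder} clifford"
  assumes \<iota>: "\<iota> \<in> imag_units"
begin

lemma inner_one_imag_unit: "cl_one \<bullet> \<iota> = 0"
  using imag_unit_nth_empty[OF \<iota>] by (simp add: cl_e_def inner_axis')

lemma to_of_cplx [simp]: "to_cplx \<iota> (of_cplx \<iota> c) = c"
proof -
  have "\<iota> \<bullet> \<iota> = 1" using imag_unit_norm[OF \<iota>] by (simp add: dot_square_norm)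
  then show ?thesis
    using cl_re_im_unique[OF \<iota>] inner_one_imag_unit
    by (simp add: to_cplx_def of_cplx_def inner_add_left)
qed

lemma of_to_cplx: "a \<in> cplane \<iota> \<Longrightarrow> of_cplx \<iota> (to_cplx \<iota> a) = a"
  by (auto simp: cplane_eq)

lemma norm_of_cplx: "norm (of_cplx \<iota> c) = cmod c"
proof -
  have "\<iota> \<bullet> \<iota> = 1" using imag_unit_norm[OF \<iota>] by (simp add: dot_square_norm)
  moreover have "(cl_one :: 'n clifford) \<bullet> cl_one = 1" by (simp add: cl_e_def inner_axis_axis)
  ultimately have "(norm (of_cplx \<iota> c))\<^sup>2 = (cmod c)\<^sup>2"
    using inner_one_imag_unit
    unfolding of_cplx_def power2_norm_eq_inner[of "_ + _"] cmod_power2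
    by (simp add: inner_add_left inner_add_right inner_commute[of \<iota> cl_one] power2_eq_square)
  then show ?thesis by (rule power2_eq_imp_eq) simp_all
qed

lemma cl_re_im_cplane:
  assumes "a \<in> cplane \<iota>"
  shows "cl_re a = Re (to_cplx \<iota> a)" "cl_im \<iota> a = Im (to_cplx \<iota> a)"
  using assms cl_re_im_unique[OF \<iota>] unfolding cplane_eq by (auto simp: of_cplx_def[symmetric]) 
    (simp_all add: of_cplx_def)

lemma of_cplx_mult: "of_cplx \<iota> c \<odot> of_cplx \<iota> d = of_cplx \<iota> (c * d)"
proof -
  note lin = linear_add[OF linear_cl_mult_left] linear_add[OF linear_cl_mult_right]
    linear_scale[OF linear_cl_mult_left] linear_scale[OF linear_cl_mult_right]
  show ?thesis
    unfolding of_cplx_def lin cl_mult_one_left cl_mult_one_right imag_unit_square[OF \<iota>]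
    by (simp add: algebra_simps)
qed

lemma cl_conj_of_cplx: "cl_conj (of_cplx \<iota> c) = of_cplx \<iota> (cnj c)"
proof -
  obtain b where b: "\<iota> = (\<Sum>j\<in>UNIV. b j *\<^sub>R cl_e {j})"
    using \<iota> by (auto simp: imag_units_def)
  have "cl_conj \<iota> = - \<iota>"
    unfolding b linear_sum[OF linear_cl_conj] linear_scale[OF linear_cl_conj] cl_conj_generator
    by (simp add: sum_negf)
  then show ?thesis
    unfolding of_cplx_def linear_add[OF linear_cl_conj] linear_scale[OF linear_cl_conj] cl_conj_one
    by simp
qed

text \<open>The plane is the fixed set of a continuous linear map, the orthogonal projection onto
  it.\<close>

lemma closed_cplane: "closed (cplane \<iota>)"
proof -
  have "cplane \<iota> = {a. of_cplx \<iota> (to_cplx \<iota> a) = a}"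
    using of_to_cplx of_cplx_in_cplane by (auto, metis)
  moreover have "linear (\<lambda>a. of_cplx \<iota> (to_cplx \<iota> a))"
    by (rule linearI)
       (simp_all add: linear_add[OF linear_to_cplx] linear_scale[OF linear_to_cplx] of_cplx_add,
        simp add: of_cplx_def scaleR_add_right)
  then have "continuous_on UNIV (\<lambda>a. of_cplx \<iota> (to_cplx \<iota> a))"
    by (simp add: linear_continuous_on linear_conv_bounded_linear)
  ultimately show ?thesis
    by (simp add: closed_Collect_eq continuous_on_id)
qed

end

section \<open>Measurable functions with values in the extended plane\<close>

definition plane_function :: "'a measure \<Rightarrow> 'n::{finite,linorder} clifford \<Rightarrow> ('a \<Rightarrow> 'n clifford option) \<Rightarrow> bool" where
  "plane_function M \<iota> f \<longleftrightarrow> (\<forall>\<omega>\<in>space M. f \<omega> \<in> ext_plane \<iota>) \<and>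
    {\<omega> \<in> space M. f \<omega> = None} \<in> sets M \<and> cplx_fun \<iota> f \<in> borel_measurable M"

lemma sets_ext_borel:
  assumes "B \<subseteq> ext_plane \<iota>" "Some -` B \<in> sets borel"
  shows "B \<in> sets (ext_borel \<iota>)"
  using assms unfolding ext_borel_def by (subst sets_measure_of) auto

lemma plane_functionI:
  assumes \<iota>: "\<iota> \<in> imag_units" and f: "f \<in> measurable M (ext_borel \<iota>)"
  shows "plane_function M \<iota> f"
  unfolding plane_function_def
proof (intro conjI ballI)
  have space: "space (ext_borel \<iota>) = ext_plane \<iota>"
    unfolding ext_borel_def by (rule space_measure_of) auto
  show "f \<omega> \<in> ext_plane \<iota>" if "\<omega> \<in> space M" for \<omega>
    using measurable_space[OF f that] space by simp
  have "{None} \<in> sets (ext_borel \<iota>)"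
    by (rule sets_ext_borel) (simp_all add: ext_plane_def vimage_def)
  from measurable_sets[OF f this] show "{\<omega> \<in> space M. f \<omega> = None} \<in> sets M"
    by (simp add: vimage_def Int_def conj_commute)
  have "(\<lambda>u. case u of None \<Rightarrow> 0 | Some a \<Rightarrow> to_cplx \<iota> a) \<in> borel_measurable (ext_borel \<iota>)"
  proof (rule measurableI)
    fix B :: "complex set" assume B: "B \<in> sets borel"
    let ?S = "(\<lambda>u. case u of None \<Rightarrow> 0 | Some a \<Rightarrow> to_cplx \<iota> a) -` B \<inter> space (ext_borel \<iota>)"
    have "to_cplx \<iota> \<in> borel_measurable borel"
      by (intro borel_measurable_continuous_onI linear_continuous_on)
         (simp add: linear_conv_bounded_linear[symmetric] linear_to_cplx)
    with B have "to_cplx \<iota> -` B \<in> sets borel" by (metis measurable_sets_borel)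
    \<comment> \<open>The preimage under \<open>to_cplx\<close> must be cut down to the plane, which
      is Borel because it is closed; the value \<open>None\<close> drops out.\<close>
    moreover have "Some -` ?S = to_cplx \<iota> -` B \<inter> cplane \<iota>"
      unfolding space by (auto simp: ext_plane_def)
    ultimately have "Some -` ?S \<in> sets borel"
      using borel_closed[OF closed_cplane[OF \<iota>]] by simp
    then show "?S \<in> sets (ext_borel \<iota>)"
      by (intro sets_ext_borel) (auto simp: space)
  qed simp
  from measurable_compose[OF f this] show "cplx_fun \<iota> f \<in> borel_measurable M"
    by (simp add: cplx_fun_def[abs_def])
qed


section \<open>The spectral integral on a Clifford module\<close>

locale clifford_spectral_calculus =
  fixes M :: "'a measure"
    and E :: "'a set \<Rightarrow> ('h::{real_inner,complete_space}, 'n::{finite,linorder}) cl_module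
      \<Rightarrow> ('h, 'n) cl_module"
    and J :: "('h, 'n) cl_module \<Rightarrow> ('h, 'n) cl_module"
    and \<iota> :: "'n clifford"
  assumes E: "spectral_measure M E"
    and \<iota>: "\<iota> \<in> imag_units"
    and J: "imaginary_op J"
    and JE: "associated_op M E J"
begin

lemma E_bounded_op: "A \<in> sets M \<Longrightarrow> E A \<in> bounded_ops"
  using E by (simp add: spectral_measure_def orthogonal_projection_def)

lemma J_bounded_op: "J \<in> bounded_ops"
  using J by (simp add: imaginary_op_def unitary_op_def)

end

sublocale clifford_spectral_calculus \<subseteq> spectral_calculus M E J
proof (rule spectral_calculus.intro)
  fix A assume A: "A \<in> sets M"
  then have P: "orthogonal_projection (E A)" using E by (simp add: spectral_measure_def)
  show "bounded_linear (E A)" using E_bounded_op[OF A] by (rule bounded_opsD)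
  show "E A x \<bullet> y = x \<bullet> E A y" for x y
    using P by (intro op_adjoint_total_opD) (simp add: orthogonal_projection_def)
  show "E A (E A x) = E A x" for x
    using P by (simp add: orthogonal_projection_def fun_eq_iff)
  show "J (E A x) = E A (J x)" for x
    using JE A by (simp add: associated_op_def fun_eq_iff)
next
  fix A :: "nat \<Rightarrow> 'a set" and x
  assume "range A \<subseteq> sets M" "disjoint_family A"
  then show "(\<lambda>i. E (A i) x) sums E (\<Union>i. A i) x"
    using E by (simp add: spectral_measure_def)
next
  show "E (space M) x = x" for x using E by (simp add: spectral_measure_def)
  show "bounded_linear J" using J_bounded_op by (rule bounded_opsD)
  have J': "op_adjoint (total_op J) = total_op (\<lambda>x. - J x)" using J by (simp add: imaginary_op_def)
  from op_adjoint_total_opD[OF J'] show "J x \<bullet> y = - (x \<bullet> J y)" for x y by simp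
  \<comment> \<open>Unitarity together with \<open>- J\<close> as the adjoint says that
    \<open>J\<close> composed with \<open>- J\<close> is the identity, that is, \<open>J\<close>
    squares to minus the identity.\<close>
  have "total_op J \<circ>\<^sub>m total_op (\<lambda>x. - J x) = Some"
    using J J' by (simp add: imaginary_op_def unitary_op_def)
  from fun_cong[OF this] have "J (- J x) = x" for x
    by (simp add: total_op_def map_comp_def)
  moreover have "J (- J x) = - J (J x)" for x
    by (rule linear_neg[OF bounded_linear.linear[OF bounded_opsD(1)[OF J_bounded_op]]])
  ultimately have "- J (J x) = x" for x by simp
  then show "J (J x) = - x" for x by (metis minus_minus)
qed

context clifford_spectral_calculus
begin

section \<open>Identification of the defined spectral integrals with the abstract calculus\<close>

lemma scalar_measure_eq: "spectral_scalar_measure M E x = scalar_measure x"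
  by (simp add: spectral_scalar_measure_def scalar_measure_def cl_re_inner)

lemma spectral_int_simple_eq:
  assumes F: "simple_plane_function M \<iota> F"
  shows "spectral_int_simple M E \<iota> J F x = simple_int (\<lambda>\<omega>. to_cplx \<iota> (F \<omega>)) x"
proof -
  have F': "simple_function M F" "F ` space M \<subseteq> cplane \<iota>"
    using F by (simp_all add: simple_plane_function_def)
  have "simple_int (\<lambda>\<omega>. to_cplx \<iota> (F \<omega>)) x =
      (\<Sum>c\<in>F ` space M. smul (to_cplx \<iota> c) (E (F -` {c} \<inter> space M) x))"
    by (rule simple_int_compose[OF F'(1)]) simp
  also have "\<dots> = spectral_int_simple M E \<iota> J F x"
    unfolding spectral_int_simple_def
  proof (intro sum.cong refl)
    fix c assume "c \<in> F ` space M"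
    then have "c \<in> cplane \<iota>" using F'(2) by auto
    then show "smul (to_cplx \<iota> c) (E (F -` {c} \<inter> space M) x) =
        cl_re c *\<^sub>R E (F -` {c} \<inter> space M) x + cl_im \<iota> c *\<^sub>R E (F -` {c} \<inter> space M) (J x)"
      by (simp add: smul_def cl_re_im_cplane[OF \<iota>] J_E simple_functionD(2)[OF F'(1)])
  qed
  finally show ?thesis ..
qed

lemma integ_cl_mult:
  assumes f: "f \<in> borel_measurable M" "x \<in> dom_int f"
  shows "x \<odot> a \<in> dom_int f" "integ f (x \<odot> a) = integ f x \<odot> a"
  by (rule integ_commute[OF f bounded_linear_cl_mult_left];
      simp add: bounded_opsD(2)[OF E_bounded_op] bounded_opsD(2)[OF J_bounded_op])+

lemma integ_in_bounded_ops:
  assumes g: "g \<in> borel_measurable M" and K: "\<And>\<omega>. \<omega> \<in> space M \<Longrightarrow> cmod (g \<omega>) \<le> K"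
  shows "integ g \<in> bounded_ops"
proof -
  have "x \<in> dom_int g" for x by (rule dom_int_bounded[OF K])
  then show ?thesis
    using bounded_linear_integ[OF g K] integ_cl_mult(2)[OF g] integ_add_right(2)[OF g]
    by (auto simp: bounded_ops_def right_linear_op_def total_op_def dom_def)
qed

text \<open>\<open>close\<close> forces every admissible sequence towards \<open>integ g\<close>,
  and the rounded functions provide one. Any other candidate \<open>T\<close> comes with its own
  sequence, along which the simple integrals at \<open>x\<close> tend both to \<open>T x\<close> and
  to \<open>integ g x\<close>.\<close>

lemma spectral_int_bounded_eq:
  assumes h: "\<And>\<omega>. \<omega> \<in> space M \<Longrightarrow> h \<omega> \<in> cplane \<iota>"
    and g: "g \<in> borel_measurable M" "\<And>\<omega>. \<omega> \<in> space M \<Longrightarrow> to_cplx \<iota> (h \<omega>) = g \<omega>"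
    and K: "\<And>\<omega>. \<omega> \<in> space M \<Longrightarrow> cmod (g \<omega>) \<le> K"
  shows "spectral_int_bounded M E \<iota> J h = integ g"
proof -
  have dom: "x \<in> dom_int g" for x by (rule dom_int_bounded[OF K])
  have T: "integ g \<in> bounded_ops" by (rule integ_in_bounded_ops[OF g(1) K])
  have close: "\<forall>\<^sub>F j in sequentially. \<forall>x.
      norm (spectral_int_simple M E \<iota> J (F j) x - integ g x) \<le> e * norm x"
    if F: "\<And>j. simple_plane_function M \<iota> (F j)" "uniform_limit (space M) F h sequentially" and "e > 0"
    for F :: "nat \<Rightarrow> 'a \<Rightarrow> 'n clifford" and e :: real
    using uniform_limitD[OF F(2) \<open>e > 0\<close>]
  proof eventually_elim
    case (elim j)
    have "simple_function M (F j)" "F j ` space M \<subseteq> cplane \<iota>"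
      using F(1)[of j] by (auto simp: simple_plane_function_def)
    have "norm (simple_int (\<lambda>\<omega>. to_cplx \<iota> (F j \<omega>)) x - integ g x) \<le> e * norm x" for x
    proof (rule norm_simple_int_diff_integ_le[OF g(1) dom])
      show "simple_function M (\<lambda>\<omega>. to_cplx \<iota> (F j \<omega>))"
        using \<open>simple_function M (F j)\<close> by (rule simple_function_compose1)
      fix \<omega> assume \<omega>: "\<omega> \<in> space M"
      have "of_cplx \<iota> (to_cplx \<iota> (F j \<omega>) - g \<omega>) = F j \<omega> - h \<omega>"
        using \<omega> h \<open>F j ` space M \<subseteq> cplane \<iota>\<close>
        by (simp add: of_cplx_diff of_to_cplx[OF \<iota>] image_subset_iff g(2)[symmetric])
      then have "cmod (to_cplx \<iota> (F j \<omega>) - g \<omega>) = norm (F j \<omega> - h \<omega>)"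
        by (metis norm_of_cplx[OF \<iota>])
      then show "cmod (to_cplx \<iota> (F j \<omega>) - g \<omega>) \<le> e"
        using elim \<omega> by (auto simp: dist_norm intro: less_imp_le)
    qed (use \<open>e > 0\<close> in simp)
    then show ?case by (simp add: spectral_int_simple_eq[OF F(1)])
  qed
  have simple_blin: "bounded_linear (spectral_int_simple M E \<iota> J F)" if "simple_plane_function M \<iota> F" for F
  proof -
    have "simple_function M (\<lambda>\<omega>. to_cplx \<iota> (F \<omega>))"
      by (rule simple_function_compose1) (use that in \<open>simp add: simple_plane_function_def\<close>)
    moreover have "spectral_int_simple M E \<iota> J F = simple_int (\<lambda>\<omega>. to_cplx \<iota> (F \<omega>))"
      by (rule ext) (rule spectral_int_simple_eq[OF that])
    ultimately show ?thesis by (simp add: bounded_linear_simple_int)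
  qed
  show ?thesis
    unfolding spectral_int_bounded_def
  proof (rule the_equality)
    have "\<exists>G. (\<forall>j. simple_function M (G j)) \<and> uniform_limit (space M) G g sequentially"
      by (rule bounded_uniform_simple_approx[OF g(1) K])
    then obtain G where G: "\<And>j. simple_function M (G j)" "uniform_limit (space M) G g sequentially"
      by blast
    let ?F = "\<lambda>j \<omega>. of_cplx \<iota> (G j \<omega>)"
    have F: "simple_plane_function M \<iota> (?F j)" for j
      using simple_function_compose1[OF G(1)] by (auto simp: simple_plane_function_def)
    have lim: "uniform_limit (space M) ?F h sequentially"
    proof (rule uniform_limitI)
      fix e :: real assume "e > 0"
      from uniform_limitD[OF G(2) this]
      show "\<forall>\<^sub>F j in sequentially. \<forall>\<omega>\<in>space M. dist (?F j \<omega>) (h \<omega>) < e"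
      proof eventually_elim
        case (elim j)
        have "dist (?F j \<omega>) (h \<omega>) = dist (G j \<omega>) (g \<omega>)" if "\<omega> \<in> space M" for \<omega>
        proof -
          have "h \<omega> = of_cplx \<iota> (g \<omega>)" using of_to_cplx[OF \<iota> h[OF that]] g(2)[OF that] by simp
          then show ?thesis
            by (simp add: dist_norm norm_of_cplx[OF \<iota>] flip: of_cplx_diff)
        qed
        with elim show ?case by simp
      qed
    qed
    have "(\<lambda>j. onorm (\<lambda>x. spectral_int_simple M E \<iota> J (?F j) x - integ g x)) \<longlonglongrightarrow> 0"
    proof (rule tendstoI)
      fix e :: real assume "e > 0"
      \<comment> \<open>Half of \<open>e\<close>, because the pointwise estimate bounds
        \<open>onorm\<close> only non-strictly.\<close>
      then have "e / 2 > 0" by simp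
      from close[OF F lim this]
      show "\<forall>\<^sub>F j in sequentially.
          dist (onorm (\<lambda>x. spectral_int_simple M E \<iota> J (?F j) x - integ g x)) 0 < e"
      proof eventually_elim
        case (elim j)
        then have "onorm (\<lambda>x. spectral_int_simple M E \<iota> J (?F j) x - integ g x) \<le> e / 2"
          using \<open>e > 0\<close> by (intro onorm_bound) simp_all
        moreover have "0 \<le> onorm (\<lambda>x. spectral_int_simple M E \<iota> J (?F j) x - integ g x)"
          using simple_blin[OF F] bounded_opsD(1)[OF T] by (intro onorm_pos_le bounded_linear_sub)
        ultimately show ?case using \<open>e > 0\<close> by simp
      qed
    qed
    then show "integ g \<in> bounded_ops \<and> (\<exists>F. (\<forall>j. simple_plane_function M \<iota> (F j)) \<and>
        uniform_limit (space M) F h sequentially \<and>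
        (\<lambda>j. onorm (\<lambda>x. spectral_int_simple M E \<iota> J (F j) x - integ g x)) \<longlonglongrightarrow> 0)"
      by (intro conjI exI[of _ ?F] allI T F lim)
  next
    fix T assume "T \<in> bounded_ops \<and> (\<exists>F. (\<forall>j. simple_plane_function M \<iota> (F j)) \<and>
        uniform_limit (space M) F h sequentially \<and>
        (\<lambda>j. onorm (\<lambda>x. spectral_int_simple M E \<iota> J (F j) x - T x)) \<longlonglongrightarrow> 0)"
    then obtain F where T: "T \<in> bounded_ops" and F: "\<And>j. simple_plane_function M \<iota> (F j)"
        "uniform_limit (space M) F h sequentially"
      and on: "(\<lambda>j. onorm (\<lambda>x. spectral_int_simple M E \<iota> J (F j) x - T x)) \<longlonglongrightarrow> 0"
      by blast
    show "T = integ g"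
    proof
      fix x
      have "(\<lambda>j. spectral_int_simple M E \<iota> J (F j) x - T x) \<longlonglongrightarrow> 0"
      proof (rule Lim_null_comparison)
        show "\<forall>\<^sub>F j in sequentially. norm (spectral_int_simple M E \<iota> J (F j) x - T x) \<le>
            onorm (\<lambda>x. spectral_int_simple M E \<iota> J (F j) x - T x) * norm x"
          using simple_blin[OF F(1)] bounded_opsD(1)[OF T]
          by (intro always_eventually allI onorm bounded_linear_sub)
        show "(\<lambda>j. onorm (\<lambda>x. spectral_int_simple M E \<iota> J (F j) x - T x) * norm x) \<longlonglongrightarrow> 0"
          using tendsto_mult_right[OF on, of "norm x"] by simp
      qed
      moreover have "(\<lambda>j. spectral_int_simple M E \<iota> J (F j) x - integ g x) \<longlonglongrightarrow> 0"
      proof (rule tendstoI)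
        fix e :: real assume "e > 0"
        \<comment> \<open>Adding 1 keeps the quotient defined for \<open>x = 0\<close> and makes the
          final inequality strict.\<close>
        then have "e / (norm x + 1) > 0" by (simp add: add_nonneg_pos)
        from close[OF F this]
        show "\<forall>\<^sub>F j in sequentially. dist (spectral_int_simple M E \<iota> J (F j) x - integ g x) 0 < e"
        proof eventually_elim
          case (elim j)
          have "e / (norm x + 1) * norm x < e"
            using \<open>e > 0\<close> add_nonneg_pos[OF norm_ge_zero zero_less_one, of x]
            by (simp add: pos_divide_less_eq distrib_left)
          with elim show ?case by (simp add: le_less_trans[of _ "e / (norm x + 1) * norm x"])
        qed
      qed
      ultimately have "(\<lambda>j. (spectral_int_simple M E \<iota> J (F j) x - T x) -
          (spectral_int_simple M E \<iota> J (F j) x - integ g x)) \<longlonglongrightarrow> 0 - 0"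
        by (rule tendsto_diff)
      then show "T x = integ g x" by (simp add: LIMSEQ_const_iff)
    qed
  qed
qed

definition finite_plane_function :: "('a \<Rightarrow> 'n clifford option) \<Rightarrow> bool" where
  "finite_plane_function f \<longleftrightarrow> plane_function M \<iota> f \<and> ae_finite M E f"

lemma finite_plane_functionD:
  assumes "finite_plane_function f"
  shows "\<And>\<omega>. \<omega> \<in> space M \<Longrightarrow> f \<omega> \<in> ext_plane \<iota>"
    and "{\<omega> \<in> space M. f \<omega> = None} \<in> sets M" "\<And>x. E {\<omega> \<in> space M. f \<omega> = None} x = 0"
    and "cplx_fun \<iota> f \<in> borel_measurable M"
  using assms by (auto simp: finite_plane_function_def plane_function_def ae_finite_def)

lemma plane_value:
  assumes "finite_plane_function f" "\<omega> \<in> space M" "f \<omega> \<noteq> None"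
  shows "f \<omega> = Some (of_cplx \<iota> (cplx_fun \<iota> f \<omega>))"
  using finite_plane_functionD(1)[OF assms(1,2)] assms(3)
  by (auto simp: ext_plane_def cplx_fun_def of_to_cplx[OF \<iota>])

lemma spectral_int_bounded_restrict:
  assumes f: "finite_plane_function f" and A: "A \<in> sets M"
    and K: "\<And>\<omega>. \<omega> \<in> A \<Longrightarrow> \<exists>a. f \<omega> = Some a \<and> norm a \<le> K"
  shows "spectral_int_bounded M E \<iota> J (ext_restrict f A) =
    integ (\<lambda>\<omega>. indicator A \<omega> * cplx_fun \<iota> f \<omega>)"
proof (rule spectral_int_bounded_eq[where K = "\<bar>K\<bar>"])
  note [measurable] = finite_plane_functionD(4)[OF f] A
  show "(\<lambda>\<omega>. indicator A \<omega> * cplx_fun \<iota> f \<omega>) \<in> borel_measurable M" by simp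
  fix \<omega> assume \<omega>: "\<omega> \<in> space M"
  have A: "f \<omega> = Some (of_cplx \<iota> (cplx_fun \<iota> f \<omega>))" "cmod (cplx_fun \<iota> f \<omega>) \<le> \<bar>K\<bar>"
    if \<omega>A: "\<omega> \<in> A"
  proof -
    obtain a where a: "f \<omega> = Some a" "norm a \<le> K" using K[OF \<omega>A] by blast
    then show "f \<omega> = Some (of_cplx \<iota> (cplx_fun \<iota> f \<omega>))" by (intro plane_value f \<omega>) simp
    with a show "cmod (cplx_fun \<iota> f \<omega>) \<le> \<bar>K\<bar>" using norm_of_cplx[OF \<iota>] by force
  qed
  show "ext_restrict f A \<omega> \<in> cplane \<iota>"
    using A(1) of_cplx_in_cplane[of \<iota> 0] by (auto simp: ext_restrict_def)
  show "to_cplx \<iota> (ext_restrict f A \<omega>) = indicator A \<omega> * cplx_fun \<iota> f \<omega>"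
    using A(1) by (auto simp: ext_restrict_def indicator_def to_of_cplx[OF \<iota>])
  show "cmod (indicator A \<omega> * cplx_fun \<iota> f \<omega>) \<le> \<bar>K\<bar>"
    using A(2) by (auto simp: indicator_def)
qed

text \<open>Domains agree because \<open>f\<close> and its complex version differ on a null set
  only. Every bounding sequence gives the same limit by dominated convergence, and the levels of
  \<open>f\<close>, with the infinite values removed, form such a sequence.\<close>

lemma spectral_integral_eq:
  assumes f: "finite_plane_function f"
  shows "spectral_integral M E \<iota> J f = op_int (cplx_fun \<iota> f)"
proof
  fix x
  let ?g = "cplx_fun \<iota> f" and ?N = "{\<omega> \<in> space M. f \<omega> = None}"
  note f' = finite_plane_functionD[OF f]
  note [measurable] = f'(4)
  have "(\<integral>\<^sup>+\<omega>. (ext_norm (f \<omega>))\<^sup>2 \<partial>spectral_scalar_measure M E x) = L2 ?g x"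
    unfolding L2_def scalar_measure_eq
  proof (rule nn_integral_cong_AE, rule AE_scalar_measure[OF f'(2,3)])
    fix \<omega> assume "\<omega> \<in> space M" "\<omega> \<notin> ?N"
    then have "f \<omega> = Some (of_cplx \<iota> (?g \<omega>))" by (intro plane_value f) auto
    then show "(ext_norm (f \<omega>))\<^sup>2 = ennreal ((cmod (?g \<omega>))\<^sup>2)"
      by (simp add: ext_norm_def norm_of_cplx[OF \<iota>] ennreal_power)
  qed
  then have dom: "(\<integral>\<^sup>+\<omega>. (ext_norm (f \<omega>))\<^sup>2 \<partial>spectral_scalar_measure M E x) < \<infinity> \<longleftrightarrow> x \<in> dom_int ?g"
    by (simp add: dom_int_def)
  have lim: "(\<lambda>j. spectral_int_bounded M E \<iota> J (ext_restrict f (A j)) x) \<longlonglongrightarrow> integ ?g x"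
    if A: "bounding_sequence M E f A" and x: "x \<in> dom_int ?g" for A
  proof -
    have sets[measurable]: "A j \<in> sets M" and mono: "A j \<subseteq> A (Suc j)"
      and bounded: "\<exists>K. \<forall>\<omega>\<in>A j. \<exists>a. f \<omega> = Some a \<and> norm a \<le> K"
      and U: "E (\<Union>j. A j) = id" for j
      using A by (auto simp: bounding_sequence_def)
    \<comment> \<open>The union need not exhaust the space: the limit is the integral of
      \<open>f\<close> cut to \<open>?U\<close>, and the complement of \<open>?U\<close> is null
      because \<open>E ?U\<close> is the identity.\<close>
    let ?U = "\<Union>j. A j" and ?h = "\<lambda>\<omega>. indicator (\<Union>j. A j) \<omega> * ?g \<omega>"
    have "spectral_int_bounded M E \<iota> J (ext_restrict f (A j)) = integ (\<lambda>\<omega>. indicator (A j) \<omega> * ?g \<omega>)" for j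
      using bounded[of j] spectral_int_bounded_restrict[OF f sets] by blast
    moreover have "(\<lambda>j. integ (\<lambda>\<omega>. indicator (A j) \<omega> * ?g \<omega>) x) \<longlonglongrightarrow> integ ?h x"
    proof (rule integ_dominated_convergence)
      show "x \<in> dom_int ?h"
        by (rule dom_int_mult[OF f'(4) x, where K = 1]) (simp add: indicator_def)
      show "(\<lambda>j. indicator (A j) \<omega> * ?g \<omega>) \<longlonglongrightarrow> ?h \<omega>" for \<omega>
        using mono by (intro tendsto_mult tendsto_const LIMSEQ_indicator_incseq incseq_SucI)
      show "cmod (indicator (A j) \<omega> * ?g \<omega>) \<le> 2 * cmod (?h \<omega>)" for j \<omega>
        by (auto simp: indicator_def)
    qed simp_all
    moreover have "integ ?h x = integ ?g x"
    proof (rule integ_cong_AE(2)[symmetric], rule f'(4))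
      show "AE \<omega> in scalar_measure x. ?g \<omega> = ?h \<omega>"
      proof (rule AE_scalar_measure[where N = "space M - ?U"])
        have "E (?U \<union> (space M - ?U)) y = E ?U y + E (space M - ?U) y" for y
          by (rule E_Un) auto
        moreover have "?U \<union> (space M - ?U) = space M"
          using sets.sets_into_space[OF sets] by auto
        ultimately show "E (space M - ?U) y = 0" for y by (simp add: E_space U)
      qed auto
    qed (use x in simp_all)
    ultimately show ?thesis by simp
  qed
  have ex: "\<exists>A. bounding_sequence M E f A"
  proof (intro exI)
    \<comment> \<open>At infinite values of \<open>f\<close> the function \<open>cplx_fun\<close> is
      0, so these points lie in every level and have to be removed.\<close>
    let ?A = "\<lambda>j. level ?g j - ?N"
    have "E (\<Union>j. ?A j) = id"
    proof
      fix y
      have "(\<Union>j. ?A j) = space M - ?N"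
      proof -
        have "\<exists>j. \<omega> \<in> level ?g j" if "\<omega> \<in> space M" for \<omega>
          using eventually_happens[OF eventually_level[OF that, of ?g]] by auto
        then show ?thesis by (auto simp: level_def)
      qed
      moreover have "E (?N \<union> (space M - ?N)) y = E ?N y + E (space M - ?N) y"
        using f'(2) by (intro E_Un) auto
      moreover have "?N \<union> (space M - ?N) = space M" by auto
      ultimately show "E (\<Union>j. ?A j) y = id y" using f'(3)[of y] by (simp add: E_space)
    qed
    moreover have "?A j \<in> sets M" for j using f'(2) sets_level[OF f'(4)] by blast
    moreover have "?A j \<subseteq> ?A (Suc j)" for j by (auto simp: level_def)
    moreover have "\<exists>a. f \<omega> = Some a \<and> norm a \<le> real j" if "\<omega> \<in> ?A j" for \<omega> j
      using that plane_value[OF f, of \<omega>] by (auto simp: level_def norm_of_cplx[OF \<iota>])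
    ultimately show "bounding_sequence M E f ?A"
      unfolding bounding_sequence_def by blast
  qed
  have "(THE y. \<exists>A. bounding_sequence M E f A \<and>
      (\<lambda>j. spectral_int_bounded M E \<iota> J (ext_restrict f (A j)) x) \<longlonglongrightarrow> y) = integ ?g x"
    if x: "x \<in> dom_int ?g"
  proof (rule the_equality)
    show "\<exists>A. bounding_sequence M E f A \<and>
        (\<lambda>j. spectral_int_bounded M E \<iota> J (ext_restrict f (A j)) x) \<longlonglongrightarrow> integ ?g x"
      using ex lim x by blast
  qed (use lim x in \<open>blast intro: LIMSEQ_unique\<close>)
  with dom show "spectral_integral M E \<iota> J f x = op_int ?g x"
    by (simp add: spectral_integral_def op_int_def)
qed


subsection \<open>Algebra of extended functions\<close>

lemma E_Un_null:
  assumes "A \<in> sets M" "B \<in> sets M" "\<And>x. E A x = 0" "\<And>x. E B x = 0"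
  shows "E (A \<union> B) x = 0"
proof -
  have "E (A \<union> (B - A)) x = E A x + E (B - A) x" using assms by (intro E_Un) auto
  moreover have "E (B - A) (E B x) = E (B - A) x"
    using E_Int[of "B - A" B x] assms(1,2) by (simp add: Int_absorb2)
  ultimately show ?thesis using assms by (simp add: linear_0[OF linear_E])
qed

lemma finite_plane_functionI:
  assumes "\<And>\<omega>. \<omega> \<in> space M \<Longrightarrow> f \<omega> \<in> ext_plane \<iota>"
    and "N \<in> sets M" "\<And>x. E N x = 0" "{\<omega> \<in> space M. f \<omega> = None} = N"
    and g: "g \<in> borel_measurable M" "\<And>\<omega>. \<omega> \<in> space M \<Longrightarrow> cplx_fun \<iota> f \<omega> = g \<omega>"
  shows "finite_plane_function f"
  using assms measurable_cong[of M "cplx_fun \<iota> f" g borel]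
  by (auto simp: finite_plane_function_def plane_function_def ae_finite_def)

lemma finite_plane_function_const:
  assumes "c \<in> cplane \<iota>"
  shows "finite_plane_function (\<lambda>_. Some c)" "cplx_fun \<iota> (\<lambda>_. Some c) \<omega> = to_cplx \<iota> c"
  using assms
  by (auto intro!: finite_plane_functionI[where N = "{}" and g = "\<lambda>_. to_cplx \<iota> c"]
      simp: ext_plane_def cplx_fun_def)

lemma ext_conj:
  assumes f: "finite_plane_function f"
  shows "finite_plane_function (ext_conj f)"
    and "\<omega> \<in> space M \<Longrightarrow> cplx_fun \<iota> (ext_conj f) \<omega> = cnj (cplx_fun \<iota> f \<omega>)"
proof -
  note f' = finite_plane_functionD[OF f]
  have val: "ext_conj f \<omega> = (if f \<omega> = None then None else Some (of_cplx \<iota> (cnj (cplx_fun \<iota> f \<omega>))))"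
    if "\<omega> \<in> space M" for \<omega>
    using plane_value[OF f that] by (auto simp: ext_conj_def cl_conj_of_cplx[OF \<iota>])
  show cplx: "cplx_fun \<iota> (ext_conj f) \<omega> = cnj (cplx_fun \<iota> f \<omega>)" if "\<omega> \<in> space M" for \<omega>
    using val[OF that] by (auto simp: cplx_fun_def to_of_cplx[OF \<iota>])
  show "finite_plane_function (ext_conj f)"
    by (rule finite_plane_functionI[OF _ f'(2,3) _ borel_measurable_cnj[OF f'(4)] cplx])
       (auto simp: val ext_plane_def split: if_splits)
qed

lemma ext_mult:
  assumes f: "finite_plane_function f" and g: "finite_plane_function g"
  shows "finite_plane_function (ext_mult f g)"
    and "\<omega> \<in> space M \<Longrightarrow> cplx_fun \<iota> (ext_mult f g) \<omega> = cplx_fun \<iota> f \<omega> * cplx_fun \<iota> g \<omega>"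
proof -
  note f' = finite_plane_functionD[OF f] and g' = finite_plane_functionD[OF g]
  have val: "ext_mult f g \<omega> = (if f \<omega> = None \<or> g \<omega> = None then None
      else Some (of_cplx \<iota> (cplx_fun \<iota> f \<omega> * cplx_fun \<iota> g \<omega>)))" if "\<omega> \<in> space M" for \<omega>
    using plane_value[OF f that] plane_value[OF g that]
    by (auto simp: ext_mult_def of_cplx_mult[OF \<iota>] split: option.splits)
  show cplx: "cplx_fun \<iota> (ext_mult f g) \<omega> = cplx_fun \<iota> f \<omega> * cplx_fun \<iota> g \<omega>" if "\<omega> \<in> space M" for \<omega>
    using val[OF that] by (auto simp: cplx_fun_def to_of_cplx[OF \<iota>])
  show "finite_plane_function (ext_mult f g)"
  proof (rule finite_plane_functionI[OF _ _ E_Un_null[OF f'(2) g'(2) f'(3) g'(3)]])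
    show "(\<lambda>\<omega>. cplx_fun \<iota> f \<omega> * cplx_fun \<iota> g \<omega>) \<in> borel_measurable M"
      by (intro borel_measurable_times f'(4) g'(4))
    show "{\<omega> \<in> space M. ext_mult f g \<omega> = None} =
        {\<omega> \<in> space M. f \<omega> = None} \<union> {\<omega> \<in> space M. g \<omega> = None}"
      using val by (auto split: if_splits)
  qed (use f'(2) g'(2) cplx in \<open>auto simp: val ext_plane_def\<close>)
qed

text \<open>A product with an infinite factor is matched by a product with 0, but a sum of
  \<open>\<infinity>\<close> and a finite value becomes 0 where the complex sum is not; hence an
  identity almost everywhere in place of a pointwise one.\<close>

lemma ext_add:
  assumes f: "finite_plane_function f" and g: "finite_plane_function g"
  shows "finite_plane_function (ext_add f g)"
    and "AE \<omega> in scalar_measure x. cplx_fun \<iota> (ext_add f g) \<omega> = cplx_fun \<iota> f \<omega> + cplx_fun \<iota> g \<omega>"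
proof -
  note f' = finite_plane_functionD[OF f] and g' = finite_plane_functionD[OF g]
  let ?N = "{\<omega> \<in> space M. f \<omega> = None} \<union> {\<omega> \<in> space M. g \<omega> = None}"
  have N: "?N \<in> sets M" "E ?N x = 0" for x
    using f'(2) g'(2) E_Un_null[OF f'(2) g'(2) f'(3) g'(3)] by auto
  have val: "ext_add f g \<omega> = (if \<omega> \<in> ?N then None
      else Some (of_cplx \<iota> (cplx_fun \<iota> f \<omega> + cplx_fun \<iota> g \<omega>)))" if "\<omega> \<in> space M" for \<omega>
    using plane_value[OF f that] plane_value[OF g that] that
    by (auto simp: ext_add_def of_cplx_add split: option.splits)
  have cplx: "cplx_fun \<iota> (ext_add f g) \<omega> =
      (if \<omega> \<in> ?N then 0 else cplx_fun \<iota> f \<omega> + cplx_fun \<iota> g \<omega>)" if "\<omega> \<in> space M" for \<omega>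
    using val[OF that] by (simp add: cplx_fun_def[of _ "ext_add f g"] to_of_cplx[OF \<iota>])
  show "finite_plane_function (ext_add f g)"
  proof (rule finite_plane_functionI[OF _ N])
    note [measurable] = N(1) f'(4) g'(4)
    show "(\<lambda>\<omega>. if \<omega> \<in> ?N then 0 else cplx_fun \<iota> f \<omega> + cplx_fun \<iota> g \<omega>) \<in> borel_measurable M"
      by measurable
    show "{\<omega> \<in> space M. ext_add f g \<omega> = None} = ?N"
      using val by (auto split: if_splits)
    show "ext_add f g \<omega> \<in> ext_plane \<iota>" if "\<omega> \<in> space M" for \<omega>
      by (auto simp: val[OF that] ext_plane_def)
  qed (rule cplx)
  show "AE \<omega> in scalar_measure x. cplx_fun \<iota> (ext_add f g) \<omega> = cplx_fun \<iota> f \<omega> + cplx_fun \<iota> g \<omega>"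
    using N
  proof (rule AE_scalar_measure)
    fix \<omega> assume "\<omega> \<in> space M" "\<omega> \<notin> ?N"
    then show "cplx_fun \<iota> (ext_add f g) \<omega> = cplx_fun \<iota> f \<omega> + cplx_fun \<iota> g \<omega>"
      using cplx by (simp only: if_False)
  qed
qed


subsection \<open>Operator properties\<close>

lemma right_linear_op_int:
  assumes f: "f \<in> borel_measurable M"
  shows "right_linear_op (op_int f)"
proof -
  have "0 \<in> dom_int f" using E_in_dom_int_iff[OF f, of "{}" 0] by (simp add: dom_int_def L2_def)
  then show ?thesis
    using integ_add_right[OF f] integ_cl_mult[OF f]
    by (auto simp: right_linear_op_def op_int_def)
qed

lemma op_adjoint_op_int:
  assumes f: "f \<in> borel_measurable M"
  shows "op_adjoint (op_int f) = op_int (\<lambda>\<omega>. cnj (f \<omega>))"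
proof
  fix y
  have the: "the (op_int f x) = integ f x" if "x \<in> dom_int f" for x
    using that by (simp add: op_int_def)
  have iff: "(\<forall>x\<in>dom (op_int f). cl_inner (the (op_int f x)) y = cl_inner x z) \<longleftrightarrow>
      y \<in> dom_int f \<and> z = integ (\<lambda>\<omega>. cnj (f \<omega>)) y" for z
  proof -
    have "(\<forall>x\<in>dom (op_int f). cl_inner (the (op_int f x)) y = cl_inner x z) \<longleftrightarrow>
        (\<forall>x\<in>dom_int f. integ f x \<bullet> y = x \<bullet> z)"
    proof
      assume "\<forall>x\<in>dom (op_int f). cl_inner (the (op_int f x)) y = cl_inner x z"
      then show "\<forall>x\<in>dom_int f. integ f x \<bullet> y = x \<bullet> z"
        by (simp add: the flip: cl_re_inner)
    next
      assume "\<forall>x\<in>dom_int f. integ f x \<bullet> y = x \<bullet> z"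
      \<comment> \<open>The domain contains all right multiples of \<open>x\<close> and the integral
        is right linear, so the real relation holds at each \<open>x \<odot> a\<close>.\<close>
      then have "cl_inner (integ f x) y = cl_inner x z" if "x \<in> dom_int f" for x
        using integ_cl_mult[OF f that] by (intro cl_inner_eq_of_inner_eq) metis
      then show "\<forall>x\<in>dom (op_int f). cl_inner (the (op_int f x)) y = cl_inner x z"
        by (simp add: the)
    qed
    then show ?thesis using adjoint_integ_iff[OF f] by simp
  qed
  show "op_adjoint (op_int f) y = op_int (\<lambda>\<omega>. cnj (f \<omega>)) y"
    unfolding op_adjoint_def iff by (simp add: op_int_def)
qed

lemma normal_op_int:
  assumes f: "f \<in> borel_measurable M"
  shows "normal_op (op_int f)"
  using f closed_graph_op_int[OF f] closure_dom_int[OF f]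
  by (simp add: normal_op_def densely_defined_def closed_op_def op_adjoint_op_int op_int_cnj_comp)

end

theorem theorem5p3p7:
  fixes M :: "'a measure"
    and E :: "'a set \<Rightarrow> ('h::{real_inner,complete_space}, 'n::{finite,linorder}) cl_module
      \<Rightarrow> ('h, 'n) cl_module"
    and J :: "('h, 'n) cl_module \<Rightarrow> ('h, 'n) cl_module"
    and \<iota> :: "'n clifford"
    and f g :: "'a \<Rightarrow> 'n clifford option"
  assumes "spectral_measure M E"
    and "\<iota> \<in> imag_units"
    and "imaginary_op J"
    and "associated_op M E J"
    and "f \<in> measurable M (ext_borel \<iota>)" and "ae_finite M E f"
    and "g \<in> measurable M (ext_borel \<iota>)" and "ae_finite M E g"
  defines "\<II> \<equiv> spectral_integral M E \<iota> J"
  shows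
    "\<II> (ext_conj f) = op_adjoint (\<II> f) \<and>
     (closable_op (\<II> f \<circ>\<^sub>m \<II> g) \<and> \<II> (ext_mult f g) = op_closure (\<II> f \<circ>\<^sub>m \<II> g)) \<and>
     (\<forall>c\<in>cplane \<iota>.
       closable_op (op_add (\<II> f \<circ>\<^sub>m total_op (\<lambda>x. cl_re c *\<^sub>R x + cl_im \<iota> c *\<^sub>R J x)) (\<II> g)) \<and>
       \<II> (ext_add (ext_mult f (\<lambda>_. Some c)) g) =
         op_closure (op_add (\<II> f \<circ>\<^sub>m total_op (\<lambda>x. cl_re c *\<^sub>R x + cl_im \<iota> c *\<^sub>R J x)) (\<II> g))) \<and>
     (closed_op (\<II> f) \<and> normal_op (\<II> f) \<and> right_linear_op (\<II> f)) \<and>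
     dom (\<II> f \<circ>\<^sub>m \<II> g) = dom (\<II> (ext_mult f g)) \<inter> dom (\<II> g)"
proof -
  interpret clifford_spectral_calculus M E J \<iota> by unfold_locales fact+
  have f: "finite_plane_function f" and g: "finite_plane_function g"
    using assms(2,5-8) by (simp_all add: finite_plane_function_def plane_functionI)
  note cplx = finite_plane_functionD(4)[OF f] finite_plane_functionD(4)[OF g]
  have \<II>: "\<II> h = op_int (cplx_fun \<iota> h)" if "finite_plane_function h" for h
    unfolding \<II>_def by (rule spectral_integral_eq[OF that])
  \<comment> \<open>Only the class modulo \<open>E\<close>-null sets matters, which allows a complex
    function \<open>u\<close> that ignores where the extended function is infinite.\<close>
  have op_eq: "\<II> h = op_int u" if "finite_plane_function h" "u \<in> borel_measurable M"
    "\<And>x. AE \<omega> in scalar_measure x. cplx_fun \<iota> h \<omega> = u \<omega>" for h u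
    unfolding \<II>[OF that(1)] by (rule op_int_cong_AE[OF finite_plane_functionD(4)[OF that(1)] that(2,3)])
  have conj: "\<II> (ext_conj f) = op_int (\<lambda>\<omega>. cnj (cplx_fun \<iota> f \<omega>))"
    by (rule op_eq[OF ext_conj(1)[OF f] borel_measurable_cnj[OF cplx(1)]])
       (rule AE_I2, simp add: ext_conj(2)[OF f])
  have mult: "\<II> (ext_mult f h) = op_int (\<lambda>\<omega>. cplx_fun \<iota> f \<omega> * cplx_fun \<iota> h \<omega>)"
    if h: "finite_plane_function h" for h
    by (rule op_eq[OF ext_mult(1)[OF f h] borel_measurable_times[OF cplx(1) finite_plane_functionD(4)[OF h]]])
       (rule AE_I2, simp add: ext_mult(2)[OF f h])
  have add: "closable_op (op_add (\<II> f \<circ>\<^sub>m total_op (\<lambda>x. cl_re c *\<^sub>R x + cl_im \<iota> c *\<^sub>R J x)) (\<II> g)) \<and>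
      \<II> (ext_add (ext_mult f (\<lambda>_. Some c)) g) =
        op_closure (op_add (\<II> f \<circ>\<^sub>m total_op (\<lambda>x. cl_re c *\<^sub>R x + cl_im \<iota> c *\<^sub>R J x)) (\<II> g))"
    if c: "c \<in> cplane \<iota>" for c
  proof -
    note const = finite_plane_function_const[OF c]
    have smul: "(\<lambda>x. cl_re c *\<^sub>R x + cl_im \<iota> c *\<^sub>R J x) = smul (to_cplx \<iota> c)"
      by (simp add: smul_def[abs_def] cl_re_im_cplane[OF assms(2) c])
    have "\<II> (ext_add (ext_mult f (\<lambda>_. Some c)) g) =
        op_int (\<lambda>\<omega>. cplx_fun \<iota> f \<omega> * to_cplx \<iota> c + cplx_fun \<iota> g \<omega>)"
    proof (rule op_eq)
      note fc = ext_mult(1)[OF f const(1)]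
      show "finite_plane_function (ext_add (ext_mult f (\<lambda>_. Some c)) g)"
        by (rule ext_add(1)[OF fc g])
      show "AE \<omega> in scalar_measure x. cplx_fun \<iota> (ext_add (ext_mult f (\<lambda>_. Some c)) g) \<omega> =
          cplx_fun \<iota> f \<omega> * to_cplx \<iota> c + cplx_fun \<iota> g \<omega>" for x
        using ext_add(2)[OF fc g, of x] AE_space
        by eventually_elim (simp add: ext_mult(2)[OF f const(1)] const(2))
    qed (use cplx in simp)
    with op_closure_eq[OF closure_graph_op_int_add[OF cplx, of "to_cplx \<iota> c"]] show ?thesis
      by (simp add: \<II> f g smul)
  qed
  have comp: "dom (\<II> f \<circ>\<^sub>m \<II> g) = dom (\<II> (ext_mult f g)) \<inter> dom (\<II> g)"
    by (simp add: mult[OF g] \<II>[OF f] \<II>[OF g] op_int_comp[OF cplx])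
  show ?thesis
    using op_closure_eq[OF closure_graph_op_int_comp[OF cplx]] add comp
      normal_op_int[OF cplx(1)] right_linear_op_int[OF cplx(1)]
    by (simp add: conj op_adjoint_op_int[OF cplx(1)] mult[OF g] \<II>[OF f] \<II>[OF g] normal_op_def)
qed

end
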